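(* Let $G=SL_2(\mathbb{R})\ltimes\mathbb{R}^2$. (1) Up to the equivalence relation $\sim$ in $G$, the non-trivial connected subgroups of $G$ (those which are equivalent neither to $\{e\}$ nor to $G$) are $$\mathbb{R}^2,\quad SL_2(\mathbb{R}),\quad S,\quad L,\quad M,\quad N .$$ (2) Among the pairs (in either order, including a subgroup paired with itself) formed from $SL_2(\mathbb{R}),\mathbb{R}^2,S,L,M,N$, the proper pairs in $G$ are exactly the following (and the same pairs with the order exchanged): $$(SL_2(\mathbb{R}),\mathbb{R}^2),\quad (SL_2(\mathbb{R}),M),\quad (SL_2(\mathbb{R}),N),\quad (\mathbb{R}^2,N),\quad (S,N).$$ All other pairs among these six subgroups are not proper.
   Context: For subsets $L,H$ of a locally compact group $G$ and $C\subset G$ write $CHC^{-1}=\{chd^{-1}: c,d\in C,\ h\in H\}$. The pair $(L,H)$ is called proper, written $L\pitchfork H$ in $G$, if $L\cap CHC^{-1}$ is relatively compact for every compact subset $C\subset G$. One writes $L\sim H$ (in $G$) if there is a compact subset $C\subset G$ with $L\subset CHC^{-1}$ and $H\subset CLC^{-1}$. Connected subgroup means connected Lie subgroup. The group $GL_2(\mathbb{R})\ltimes\mathbb{R}^2$ is realized as the matrices $\begin{pmatrix} g & v\\ 0&1\end{pmatrix}\in GL_3(\mathbb{R})$ with $g\in GL_2(\mathbb{R})$, $v\in\mathbb{R}^2$; such an element is abbreviated by the $2\times 3$ matrix $(g\ v)$. $SL_2(\mathbb{R})\ltimes\mathbb{R}^2$ is the subgroup with $\det g=1$; $SL_2(\mathbb{R})$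 is the subgroup with $v=0$ and $\mathbb{R}^2$ the subgroup with $g=I$. The subgroups $S,L,M,N$ are $$S=\left\{\begin{pmatrix} e^a&0&e\\0&e^{-a}&0\end{pmatrix}: a,e\in\mathbb{R}\right\},\quad L=\left\{\begin{pmatrix}1&0&0\\ b&1&f\end{pmatrix}: b,f\in\mathbb{R}\right\},$$ $$M=\left\{\begin{pmatrix}1&0&b\\ b&1&e\end{pmatrix}: b,e\in\mathbb{R}\right\},\quad N=\left\{\begin{pmatrix}1&0&b\\ b&1&\frac12 b^2\end{pmatrix}: b\in\mathbb{R}\right\}.$$ *)

theory Defs
  imports "HOL-Analysis.Analysis" "HOL-Algebra.Group"
begin

section \<open>Proper pairs and the relation \<open>\<sim>\<close>\<close>

text \<open>
  \<open>G\<close> is a group whose topology is the subspace topology that its carrier inherits from the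
  ambient type. Compactness of a subset of the carrier does not depend on the ambient space.
\<close>

definition thickening :: "('a, 'b) monoid_scheme \<Rightarrow> 'a set \<Rightarrow> 'a set \<Rightarrow> 'a set"
  where "thickening G C H = {c \<otimes>\<^bsub>G\<^esub> h \<otimes>\<^bsub>G\<^esub> inv\<^bsub>G\<^esub> d |c h d. c \<in> C \<and> d \<in> C \<and> h \<in> H}"

text \<open>For \<open>A\<close> inside the carrier, \<open>carrier G \<inter> closure A\<close> is the closure of \<open>A\<close> in \<open>G\<close>.\<close>

definition relatively_compact_in :: "('a::topological_space, 'b) monoid_scheme \<Rightarrow> 'a set \<Rightarrow> bool"
  where "relatively_compact_in G A \<longleftrightarrow> A \<subseteq> carrier G \<and> compact (carrier G \<inter> closure A)"

definition proper_pair :: "('a::topological_space, 'b) monoid_scheme \<Rightarrow> 'a set \<Rightarrow> 'a set \<Rightarrow> bool"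
  where "proper_pair G L H \<longleftrightarrow>
    (\<forall>C. C \<subseteq> carrier G \<and> compact C \<longrightarrow> relatively_compact_in G (L \<inter> thickening G C H))"

definition sim_in :: "('a::topological_space, 'b) monoid_scheme \<Rightarrow> 'a set \<Rightarrow> 'a set \<Rightarrow> bool"
  where "sim_in G L H \<longleftrightarrow>
    (\<exists>C. C \<subseteq> carrier G \<and> compact C \<and> L \<subseteq> thickening G C H \<and> H \<subseteq> thickening G C L)"

text \<open>Not equivalent to the trivial subgroup and not equivalent to \<open>G\<close> itself.\<close>

definition nontrivial_in :: "('a::topological_space, 'b) monoid_scheme \<Rightarrow> 'a set \<Rightarrow> bool"
  where "nontrivial_in G H \<longleftrightarrow> \<not> sim_in G H {\<one>\<^bsub>G\<^esub>} \<and> \<not> sim_in G H (carrier G)"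

section \<open>Connected Lie subgroups of matrix groups\<close>

definition matrix_group :: "(real^'n^'n) set \<Rightarrow> (real^'n^'n) monoid"
  where "matrix_group X = \<lparr>carrier = X, monoid.mult = (**), one = mat 1\<rparr>"

text \<open>
  The constant \<^const>\<open>exp\<close> and the class operation \<open>*\<close> on \<^typ>\<open>real^'n^'n\<close> do not refer to the
  matrix product, so the matrix exponential is defined from its power series.
\<close>

definition mexp :: "real^'n^'n \<Rightarrow> real^'n^'n"
  where "mexp X = (\<Sum>k. (1 / fact k) *\<^sub>R (((**) X ^^ k) (mat 1)))"

definition lie_algebra_of :: "(real^'n^'n) set \<Rightarrow> (real^'n^'n) set"
  where "lie_algebra_of H = {X. \<forall>t. mexp (t *\<^sub>R X) \<in> H}"

text \<open>
  The definition of a connected Lie subgroup of a matrix Lie group in B. C. Hall, Lie Groups,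
  Lie Algebras, and Representations: a subgroup (not required to be closed) whose Lie algebra is
  a Lie subalgebra and whose elements are finite products of exponentials from that Lie algebra.
\<close>

definition connected_lie_subgroup :: "(real^'n^'n) set \<Rightarrow> (real^'n^'n) monoid \<Rightarrow> bool"
  where "connected_lie_subgroup H G \<longleftrightarrow>
    subgroup H G \<and>
    subspace (lie_algebra_of H) \<and>
    (\<forall>X\<in>lie_algebra_of H. \<forall>Y\<in>lie_algebra_of H. X ** Y - Y ** X \<in> lie_algebra_of H) \<and>
    (\<forall>A\<in>H. \<exists>Xs. set Xs \<subseteq> lie_algebra_of H \<and> A = foldr (**) (map mexp Xs) (mat 1))"

section \<open>The group \<open>SL\<^sub>2(\<real>) \<ltimes> \<real>\<^sup>2\<close> and its subgroups\<close>

definition aff :: "real^2^2 \<Rightarrow> real^2 \<Rightarrow> real^3^3"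
  where "aff g v = vector [vector [g$1$1, g$1$2, v$1],
                           vector [g$2$1, g$2$2, v$2],
                           vector [0,     0,     1  ]]"

definition SL2_R2 :: "(real^3^3) monoid"
  where "SL2_R2 = matrix_group {aff g v |g v. det g = 1}"

definition SL2_sub :: "(real^3^3) set"
  where "SL2_sub = {aff g 0 |g. det g = 1}"

definition R2_sub :: "(real^3^3) set"
  where "R2_sub = {aff (mat 1) v |v. True}"

definition S_sub :: "(real^3^3) set"
  where "S_sub = {aff (vector [vector [exp a, 0], vector [0, exp (- a)]]) (vector [e, 0]) |a e. True}"

definition L_sub :: "(real^3^3) set"
  where "L_sub = {aff (vector [vector [1, 0], vector [b, 1]]) (vector [0, f]) |b f. True}"

definition M_sub :: "(real^3^3) set"
  where "M_sub = {aff (vector [vector [1, 0], vector [b, 1]]) (vector [b, e]) |b e. True}"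

definition N_sub :: "(real^3^3) set"
  where "N_sub = {aff (vector [vector [1, 0], vector [b, 1]]) (vector [b, b\<^sup>2 / 2]) |b. True}"

lemma aff_mult: "aff g v ** aff h w = aff (g ** h) (g *v w + v)"
  by (simp add: aff_def vec_eq_iff forall_3 matrix_matrix_mult_def matrix_vector_mult_def
      sum_3 sum_2)

lemma aff_one: "aff (mat 1) 0 = mat 1"
  by (simp add: aff_def vec_eq_iff forall_3 mat_def)

lemma carrier_SL2_R2_iff: "x \<in> carrier SL2_R2 \<longleftrightarrow> (\<exists>g v. x = aff g v \<and> det g = 1)"
  by (auto simp: SL2_R2_def matrix_group_def)

lemma mult_SL2_R2: "x \<otimes>\<^bsub>SL2_R2\<^esub> y = x ** y"
  by (simp add: SL2_R2_def matrix_group_def)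

lemma one_SL2_R2: "\<one>\<^bsub>SL2_R2\<^esub> = mat 1"
  by (simp add: SL2_R2_def matrix_group_def)

lemma group_SL2_R2: "group SL2_R2"
proof (rule groupI)
  fix x y assume "x \<in> carrier SL2_R2" "y \<in> carrier SL2_R2"
  then obtain g v h w where "det g = 1" "x = aff g v" "det h = 1" "y = aff h w"
    by (auto simp: carrier_SL2_R2_iff)
  then have "x ** y = aff (g ** h) (g *v w + v)" "det (g ** h) = 1"
    by (simp_all add: aff_mult det_mul)
  then show "x \<otimes>\<^bsub>SL2_R2\<^esub> y \<in> carrier SL2_R2"
    unfolding carrier_SL2_R2_iff mult_SL2_R2 by blast
next
  show "\<one>\<^bsub>SL2_R2\<^esub> \<in> carrier SL2_R2"
    unfolding carrier_SL2_R2_iff one_SL2_R2 by (metis aff_one det_I)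
next
  fix x assume "x \<in> carrier SL2_R2"
  then obtain g v where g: "det g = 1" and x: "x = aff g v"
    by (auto simp: carrier_SL2_R2_iff)
  obtain h where h: "h ** g = mat 1"
    using g by (metis invertible_det_nz invertible_left_inverse zero_neq_one)
  then have "det h = 1"
    using g by (metis det_I det_mul mult.right_neutral)
  moreover have "aff h (- (h *v v)) ** x = mat 1"
    by (simp add: x aff_mult h aff_one)
  ultimately show "\<exists>y\<in>carrier SL2_R2. y \<otimes>\<^bsub>SL2_R2\<^esub> x = \<one>\<^bsub>SL2_R2\<^esub>"
    unfolding Bex_def carrier_SL2_R2_iff mult_SL2_R2 one_SL2_R2 by blast
qed (simp_all add: mult_SL2_R2 one_SL2_R2 matrix_mul_assoc)

end

theory Submission
  imports Defs
begin

text \<open>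
  Write \<open>(g, v)\<close> for the element with linear part \<open>g\<close> and translation part \<open>v\<close>, and \<open>e\<^sub>1, e\<^sub>2\<close> for the
  standard basis of the plane. Every statement about compact sets reduces to explicit inequalities:
  the carrier is closed in the space of matrices, so compact sets are those with bounded entries, and
  \<open>L \<inter> C H C\<inverse>\<close> is governed by the solutions of \<open>l d = c h\<close> with \<open>c\<close>, \<open>d\<close> in a ball
  (lemmas \<open>proper_iff\<close> and \<open>sim_iff\<close>, relation \<open>near\<close>).

  Proper pairs. In \<open>l d = c h\<close> the entries of \<open>c\<close> and \<open>d\<close> are bounded and both determinants are \<open>1\<close>.
  For \<open>SL\<^sub>2\<close> against \<open>M\<close> a comparison of translations exhibits the parameter of \<open>h\<close> as a bounded
  expression; for \<open>\<real>\<^sup>2\<close> against \<open>N\<close> the linear part does; for \<open>S\<close> against \<open>N\<close> a large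
  parameter would make the second row of \<open>c\<close> or of \<open>d\<close> small, against determinant \<open>1\<close>. All other pairs
  fail because, after moving one of the groups by bounded elements, the two share an unbounded family;
  the one that is not visible is \<open>L\<close> with \<open>N\<close>, where a shear of slope \<open>-2/b\<close> turns the parabola of
  translations of \<open>N\<close> into the vertical line of \<open>L\<close>.

  Distinctness. Properness is invariant under equivalence, and the six rows of the table of proper
  pairs are different, so the six groups are pairwise inequivalent. Nothing unbounded is
  equivalent to the trivial group, and a group that is proper with an unbounded set is not equivalent
  to the whole group. Only \<open>L\<close> has an empty row; it is separated from the whole group by a growth
  estimate (\<open>L_not_sim_carrier\<close>).

  Classification. A connected subgroup is generated by the exponentials of its Lie algebra \<open>V\<close>, a subspace
  of the five-dimensional Lie algebra of matrices \<open>lie_elt a b c x y\<close>. Conjugation changes neither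
  the class nor the hypotheses, and \<open>a\<^sup>2 + b c\<close>, minus the determinant of the linear part of an element, splits
  the problem. If it is positive somewhere, \<open>V\<close> may be taken to contain \<open>diag(1, -1)\<close>, whose adjoint
  action has distinct eigenvalues, so \<open>V\<close> is spanned by coordinate vectors. If it is negative
  somewhere and positive nowhere, \<open>V\<close> may be taken to contain the rotation generator and consists of
  rotations and translations. If it vanishes identically but some linear part is non-zero, \<open>V\<close> may be
  taken to contain a shear with translation \<open>k e\<^sub>1\<close>, \<open>k \<in> {0, 1}\<close>, and is lower triangular. Otherwise \<open>V\<close>
  consists of translations. In each case \<open>H\<close>, up to conjugation, equals one of \<open>S, L, M, N\<close> or becomes the trivial group,
  \<open>\<real>\<^sup>2\<close>, \<open>SL\<^sub>2\<close> or everything after multiplication by a compact set on both sides; the latter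
  uses \<open>SL\<^sub>2 = K A K\<close> and its relatives (\<open>near_diag\<close>, \<open>near_lower\<close>, \<open>near_upper_translate\<close>), with \<open>K\<close> the
  rotations and \<open>A\<close> the positive diagonal matrices.
\<close>

section \<open>Coordinates\<close>

definition elt :: "real \<Rightarrow> real \<Rightarrow> real \<Rightarrow> real \<Rightarrow> real \<Rightarrow> real \<Rightarrow> real^3^3"
  where "elt a b c d x y = vector [vector [a, b, x], vector [c, d, y], vector [0, 0, 1]]"

lemma elt_nth [simp]:
  "elt a b c d x y $ 1 $ 1 = a" "elt a b c d x y $ 1 $ 2 = b" "elt a b c d x y $ 1 $ 3 = x"
  "elt a b c d x y $ 2 $ 1 = c" "elt a b c d x y $ 2 $ 2 = d" "elt a b c d x y $ 2 $ 3 = y"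
  "elt a b c d x y $ 3 $ 1 = 0" "elt a b c d x y $ 3 $ 2 = 0" "elt a b c d x y $ 3 $ 3 = 1"
  by (simp_all add: elt_def)

lemma elt_eq_iff [simp]:
  "elt a b c d x y = elt a' b' c' d' x' y' \<longleftrightarrow>
     a = a' \<and> b = b' \<and> c = c' \<and> d = d' \<and> x = x' \<and> y = y'"
  by (auto simp: vec_eq_iff forall_3)

lemma elt_mult:
  "elt a b c d x y ** elt a' b' c' d' x' y' =
     elt (a * a' + b * c') (a * b' + b * d') (c * a' + d * c') (c * b' + d * d')
         (a * x' + b * y' + x) (c * x' + d * y' + y)"
  by (simp add: vec_eq_iff forall_3 matrix_matrix_mult_def sum_3)

lemma mat_1_elt: "mat 1 = elt 1 0 0 1 0 0"
  by (simp add: vec_eq_iff forall_3 mat_def)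

lemma aff_elt: "aff g v = elt (g$1$1) (g$1$2) (g$2$1) (g$2$2) (v$1) (v$2)"
  by (simp add: aff_def elt_def)

lemma carrier_elt: "z \<in> carrier SL2_R2 \<longleftrightarrow> (\<exists>a b c d x y. z = elt a b c d x y \<and> a * d - b * c = 1)"
proof
  assume "z \<in> carrier SL2_R2"
  then show "\<exists>a b c d x y. z = elt a b c d x y \<and> a * d - b * c = 1"
    by (auto simp: carrier_SL2_R2_iff aff_elt det_2)
next
  assume "\<exists>a b c d x y. z = elt a b c d x y \<and> a * d - b * c = 1"
  then obtain a b c d x y where z: "z = elt a b c d x y" and d: "a * d - b * c = 1"
    by blast
  have "z = aff (vector [vector [a, b], vector [c, d]]) (vector [x, y])"
    by (simp add: aff_elt z)
  moreover have "det (vector [vector [a, b], vector [c, d]] :: real^2^2) = 1"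
    using d by (simp add: det_2)
  ultimately show "z \<in> carrier SL2_R2"
    unfolding carrier_SL2_R2_iff by blast
qed

lemma elt_in_carrier [simp]: "elt a b c d x y \<in> carrier SL2_R2 \<longleftrightarrow> a * d - b * c = 1"
  by (auto simp: carrier_elt)

lemma carrier_cases:
  assumes "z \<in> carrier SL2_R2"
  obtains a b c d x y where "z = elt a b c d x y" "a * d - b * c = 1"
  using assms by (auto simp: carrier_elt)

lemma inv_elt:
  assumes "a * d - b * c = 1"
  shows "inv\<^bsub>SL2_R2\<^esub> (elt a b c d x y) = elt d (- b) (- c) a (b * y - d * x) (c * x - a * y)"
proof (rule group.inv_equality[OF group_SL2_R2])
  have "a * d = 1 + b * c" using assms by simp
  then show "elt d (- b) (- c) a (b * y - d * x) (c * x - a * y) \<otimes>\<^bsub>SL2_R2\<^esub> elt a b c d x y = \<one>\<^bsub>SL2_R2\<^esub>"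
    by (simp add: mult_SL2_R2 one_SL2_R2 elt_mult mat_1_elt algebra_simps)
qed (use assms in \<open>simp_all add: algebra_simps\<close>)

lemma SL2_sub_elt: "SL2_sub = {elt a b c d 0 0 |a b c d. a * d - b * c = 1}"
proof
  show "SL2_sub \<subseteq> {elt a b c d 0 0 |a b c d. a * d - b * c = 1}"
    by (auto simp: SL2_sub_def aff_elt det_2)
  show "{elt a b c d 0 0 |a b c d. a * d - b * c = 1} \<subseteq> SL2_sub"
  proof
    fix z assume "z \<in> {elt a b c d 0 0 |a b c d. a * d - b * c = 1}"
    then obtain a b c d where z: "z = elt a b c d 0 0" and d: "a * d - b * c = 1" by blast
    have "z = aff (vector [vector [a, b], vector [c, d]]) 0" by (simp add: aff_elt z)
    moreover have "det (vector [vector [a, b], vector [c, d]] :: real^2^2) = 1"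
      using d by (simp add: det_2)
    ultimately show "z \<in> SL2_sub" unfolding SL2_sub_def by blast
  qed
qed

lemma R2_sub_elt: "R2_sub = {elt 1 0 0 1 x y |x y. True}"
proof -
  have "elt 1 0 0 1 x y = aff (mat 1) (vector [x, y])" for x y
    by (simp add: aff_elt mat_def)
  moreover have "aff (mat 1) v = elt 1 0 0 1 (v$1) (v$2)" for v
    by (simp add: aff_elt mat_def)
  ultimately show ?thesis
    unfolding R2_sub_def by blast
qed

lemma S_sub_elt: "S_sub = {elt (exp a) 0 0 (exp (- a)) e 0 |a e. True}"
  and L_sub_elt: "L_sub = {elt 1 0 b 1 0 f |b f. True}"
  and M_sub_elt: "M_sub = {elt 1 0 b 1 b e |b e. True}"
  and N_sub_elt: "N_sub = {elt 1 0 b 1 b (b\<^sup>2 / 2) |b. True}"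
  by (simp_all add: S_sub_def L_sub_def M_sub_def N_sub_def aff_elt)

lemmas subs_elt = SL2_sub_elt R2_sub_elt S_sub_elt L_sub_elt M_sub_elt N_sub_elt

lemma subs_carrier:
  "SL2_sub \<subseteq> carrier SL2_R2" "R2_sub \<subseteq> carrier SL2_R2" "S_sub \<subseteq> carrier SL2_R2"
  "L_sub \<subseteq> carrier SL2_R2" "M_sub \<subseteq> carrier SL2_R2" "N_sub \<subseteq> carrier SL2_R2"
  by (auto simp: subs_elt simp flip: exp_add)

section \<open>Bounded sets\<close>

text \<open>
  The balls exhaust the group, and each is compact, so they are cofinal among its compact subsets. Bounding
  entries rather than a norm makes the bounds for products and inverses one-line estimates.
\<close>

definition coord_ball :: "real \<Rightarrow> (real^3^3) set"
  where "coord_ball R = {z \<in> carrier SL2_R2. \<forall>i j. \<bar>z$i$j\<bar> \<le> R}"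

lemma elt_coord_ball:
  "elt a b c d x y \<in> coord_ball R \<longleftrightarrow> a * d - b * c = 1 \<and> 1 \<le> R \<and>
     \<bar>a\<bar> \<le> R \<and> \<bar>b\<bar> \<le> R \<and> \<bar>c\<bar> \<le> R \<and> \<bar>d\<bar> \<le> R \<and> \<bar>x\<bar> \<le> R \<and> \<bar>y\<bar> \<le> R"
  by (auto simp: coord_ball_def forall_3)

lemma coord_ball_cases:
  assumes "z \<in> coord_ball R"
  obtains a b c d x y where "z = elt a b c d x y" "a * d - b * c = 1" "1 \<le> R"
    "\<bar>a\<bar> \<le> R" "\<bar>b\<bar> \<le> R" "\<bar>c\<bar> \<le> R" "\<bar>d\<bar> \<le> R" "\<bar>x\<bar> \<le> R" "\<bar>y\<bar> \<le> R"
proof -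
  have "z \<in> carrier SL2_R2" using assms by (simp add: coord_ball_def)
  then obtain a b c d x y where z: "z = elt a b c d x y" by (rule carrier_cases)
  show thesis using assms that[OF z] unfolding z elt_coord_ball by blast
qed

lemma coord_ball_carrier: "coord_ball R \<subseteq> carrier SL2_R2"
  by (auto simp: coord_ball_def)

lemma coord_ball_mono: "R \<le> R' \<Longrightarrow> coord_ball R \<subseteq> coord_ball R'"
  unfolding coord_ball_def by (blast intro: order_trans)

lemma abs_mult_le: "\<bar>a\<bar> \<le> R \<Longrightarrow> \<bar>b\<bar> \<le> S \<Longrightarrow> \<bar>a * b\<bar> \<le> R * (S::real)"
  unfolding abs_mult by (rule mult_mono') auto

lemma coord_ball_mult:
  assumes "z \<in> coord_ball R" "w \<in> coord_ball S"
  shows "z ** w \<in> coord_ball (3 * (R * S))"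
proof -
  obtain a b c d x y where z: "z = elt a b c d x y" "a * d - b * c = 1" and R: "1 \<le> R"
    "\<bar>a\<bar> \<le> R" "\<bar>b\<bar> \<le> R" "\<bar>c\<bar> \<le> R" "\<bar>d\<bar> \<le> R" "\<bar>x\<bar> \<le> R" "\<bar>y\<bar> \<le> R"
    using assms(1) by (rule coord_ball_cases)
  obtain a' b' c' d' x' y' where w: "w = elt a' b' c' d' x' y'" "a' * d' - b' * c' = 1"
    and S: "1 \<le> S"
    "\<bar>a'\<bar> \<le> S" "\<bar>b'\<bar> \<le> S" "\<bar>c'\<bar> \<le> S" "\<bar>d'\<bar> \<le> S" "\<bar>x'\<bar> \<le> S" "\<bar>y'\<bar> \<le> S"
    using assms(2) by (rule coord_ball_cases)
  have RS: "1 \<le> R * S" "R \<le> R * S"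
    using R(1) S(1) by (simp_all add: mult_ge1_I)
  have *: "\<bar>p * p' + q * q'\<bar> \<le> 3 * (R * S)" and **: "\<bar>p * p' + q * q' + r\<bar> \<le> 3 * (R * S)"
    if "\<bar>p\<bar> \<le> R" "\<bar>q\<bar> \<le> R" "\<bar>r\<bar> \<le> R" "\<bar>p'\<bar> \<le> S" "\<bar>q'\<bar> \<le> S" for p q r p' q'
    using abs_mult_le[OF that(1,4)] abs_mult_le[OF that(2,5)] that(3) RS by linarith+
  have "(a * a' + b * c') * (c * b' + d * d') - (a * b' + b * d') * (c * a' + d * c')
      = (a * d - b * c) * (a' * d' - b' * c')" by algebra
  then show ?thesis
    using R S RS(1) z(2) w(2) by (auto simp: z(1) w(1) elt_mult elt_coord_ball intro!: * **)
qed

lemma coord_ball_inv: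
  assumes "z \<in> coord_ball R"
  shows "inv\<^bsub>SL2_R2\<^esub> z \<in> coord_ball (2 * (R * R))"
proof -
  obtain a b c d x y where z: "z = elt a b c d x y" "a * d - b * c = 1" and R: "1 \<le> R"
    "\<bar>a\<bar> \<le> R" "\<bar>b\<bar> \<le> R" "\<bar>c\<bar> \<le> R" "\<bar>d\<bar> \<le> R" "\<bar>x\<bar> \<le> R" "\<bar>y\<bar> \<le> R"
    using assms(1) by (rule coord_ball_cases)
  have RR: "1 \<le> R * R" "R \<le> R * R"
    using R(1) by (simp_all add: mult_ge1_I)
  have *: "\<bar>p * p' - q * q'\<bar> \<le> 2 * (R * R)"
    if "\<bar>p\<bar> \<le> R" "\<bar>q\<bar> \<le> R" "\<bar>p'\<bar> \<le> R" "\<bar>q'\<bar> \<le> R" for p q p' q'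
    using abs_mult_le[OF that(1,3)] abs_mult_le[OF that(2,4)] RR by linarith
  have **: "\<bar>p\<bar> \<le> 2 * (R * R)" if "\<bar>p\<bar> \<le> R" for p
    using that RR by linarith
  have "1 \<le> 2 * (R * R)" "d * a - b * c = 1"
    using RR z(2) by (simp_all add: mult.commute)
  then show ?thesis
    using R **[of a] **[of b] **[of c] **[of d] *[of b d y x] *[of c a x y]
    unfolding z(1) inv_elt[OF z(2)] elt_coord_ball by simp
qed

lemma closed_carrier: "closed (carrier SL2_R2)"
proof -
  have "carrier SL2_R2 = {z. z$1$1 * z$2$2 - z$1$2 * z$2$1 = 1 \<and> z$3$1 = 0 \<and> z$3$2 = 0 \<and> z$3$3 = 1}"
  proof (intro equalityI subsetI)
    fix z :: "real^3^3"
    assume z: "z \<in> {z. z$1$1 * z$2$2 - z$1$2 * z$2$1 = 1 \<and> z$3$1 = 0 \<and> z$3$2 = 0 \<and> z$3$3 = 1}"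
    then have "z = elt (z$1$1) (z$1$2) (z$2$1) (z$2$2) (z$1$3) (z$2$3)"
      by (simp add: vec_eq_iff forall_3)
    with z show "z \<in> carrier SL2_R2"
      unfolding carrier_elt by blast
  qed (auto simp: carrier_elt)
  also have "closed \<dots>"
    by (intro closed_Collect_conj closed_Collect_eq continuous_intros)
  finally show ?thesis .
qed

lemma bounded_iff_coord_ball:
  assumes "A \<subseteq> carrier SL2_R2"
  shows "bounded A \<longleftrightarrow> (\<exists>R. A \<subseteq> coord_ball R)"
proof
  assume "bounded A"
  then obtain R where R: "\<forall>z\<in>A. norm z \<le> R" by (auto simp: bounded_iff)
  have "\<bar>z$i$j\<bar> \<le> norm z" for z :: "real^3^3" and i j
    by (metis Finite_Cartesian_Product.norm_nth_le order_trans real_norm_def)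
  then have "A \<subseteq> coord_ball R" using assms R unfolding coord_ball_def by (blast intro: order_trans)
  then show "\<exists>R. A \<subseteq> coord_ball R" ..
next
  assume "\<exists>R. A \<subseteq> coord_ball R"
  then obtain R where R: "A \<subseteq> coord_ball R" ..
  have "norm z \<le> (\<Sum>i\<in>(UNIV::3 set). \<Sum>j\<in>(UNIV::3 set). R)" if "z \<in> A" for z
  proof -
    have "norm z \<le> (\<Sum>i\<in>UNIV. norm (z$i))"
      by (simp add: norm_vec_def L2_set_le_sum)
    also have "\<dots> \<le> (\<Sum>i\<in>(UNIV::3 set). \<Sum>j\<in>(UNIV::3 set). \<bar>z$i$j\<bar>)"
      by (intro sum_mono norm_le_l1_cart)
    also have "\<dots> \<le> (\<Sum>i\<in>(UNIV::3 set). \<Sum>j\<in>(UNIV::3 set). R)"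
      using R that by (intro sum_mono) (auto simp: coord_ball_def)
    finally show ?thesis .
  qed
  then show "bounded A" by (auto simp: bounded_iff)
qed

lemma compact_coord_ball: "compact (coord_ball R)"
proof -
  have "coord_ball R = carrier SL2_R2 \<inter> (\<Inter>i. \<Inter>j. {z. \<bar>z$i$j\<bar> \<le> R})"
    by (auto simp: coord_ball_def)
  also have "closed \<dots>"
    by (intro closed_Int closed_carrier closed_INT ballI closed_Collect_le continuous_intros)
  finally have "closed (coord_ball R)" .
  then show ?thesis
    using bounded_iff_coord_ball[OF coord_ball_carrier] by (auto simp: compact_eq_bounded_closed)
qed

lemma relatively_compact_iff:
  assumes "A \<subseteq> carrier SL2_R2"
  shows "relatively_compact_in SL2_R2 A \<longleftrightarrow> (\<exists>R. A \<subseteq> coord_ball R)"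
proof -
  have "closure A \<subseteq> carrier SL2_R2"
    using assms closed_carrier closure_minimal by blast
  then have "carrier SL2_R2 \<inter> closure A = closure A" by blast
  then show ?thesis
    using assms by (simp add: relatively_compact_in_def compact_closure bounded_iff_coord_ball)
qed

section \<open>Comparing elements up to bounded factors\<close>

text \<open>
  This says \<open>z \<in> C w C\<inverse>\<close> for the ball \<open>C\<close> of radius \<open>R\<close>. Clearing the inverse turns membership into six
  polynomial equations between the entries of \<open>c\<close>, \<open>d\<close>, \<open>z\<close> and \<open>w\<close>.
\<close>

definition near :: "real \<Rightarrow> real^3^3 \<Rightarrow> real^3^3 \<Rightarrow> bool"
  where "near R z w \<longleftrightarrow> (\<exists>c\<in>coord_ball R. \<exists>d\<in>coord_ball R. z ** d = c ** w)"

interpretation G: group SL2_R2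
  rewrites "z \<otimes>\<^bsub>SL2_R2\<^esub> w = z ** w" and "\<one>\<^bsub>SL2_R2\<^esub> = mat 1"
  by (simp_all add: group_SL2_R2 mult_SL2_R2 one_SL2_R2)

lemma conj_eq_iff:
  assumes "z \<in> carrier SL2_R2" "h \<in> carrier SL2_R2" "c \<in> coord_ball R" "d \<in> coord_ball S"
  shows "z = c ** h ** inv\<^bsub>SL2_R2\<^esub> d \<longleftrightarrow> z ** d = c ** h"
proof -
  have "c \<in> carrier SL2_R2" "d \<in> carrier SL2_R2" using assms(3,4) coord_ball_carrier by auto
  then show ?thesis
    using G.inv_solve_right[of z "c ** h" d] assms(1,2) by auto
qed

lemma thickening_coord_ball_iff:
  assumes "H \<subseteq> carrier SL2_R2" "z \<in> carrier SL2_R2"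
  shows "z \<in> thickening SL2_R2 (coord_ball R) H \<longleftrightarrow> (\<exists>h\<in>H. near R z h)"
proof -
  have "z = c ** h ** inv\<^bsub>SL2_R2\<^esub> d \<longleftrightarrow> z ** d = c ** h"
    if "h \<in> H" "c \<in> coord_ball R" "d \<in> coord_ball R" for c d h
    using conj_eq_iff[OF assms(2) subsetD[OF assms(1) that(1)] that(2,3)] .
  then show ?thesis
    unfolding thickening_def near_def mult_SL2_R2 by fast
qed

lemma thickening_mono: "C \<subseteq> D \<Longrightarrow> thickening X C H \<subseteq> thickening X D H"
  unfolding thickening_def by blast

lemma compact_subset_coord_ball:
  assumes "C \<subseteq> carrier SL2_R2" "compact C"
  obtains R where "C \<subseteq> coord_ball R"
  using assms bounded_iff_coord_ball compact_imp_bounded by blast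

lemma sim_iff:
  assumes "L \<subseteq> carrier SL2_R2" "H \<subseteq> carrier SL2_R2"
  shows "sim_in SL2_R2 L H \<longleftrightarrow>
    (\<exists>R. (\<forall>l\<in>L. \<exists>h\<in>H. near R l h) \<and> (\<forall>h\<in>H. \<exists>l\<in>L. near R h l))" (is "_ \<longleftrightarrow> ?r")
proof
  assume "sim_in SL2_R2 L H"
  then obtain C where C: "C \<subseteq> carrier SL2_R2" "compact C"
    "L \<subseteq> thickening SL2_R2 C H" "H \<subseteq> thickening SL2_R2 C L"
    unfolding sim_in_def by blast
  obtain R where R: "C \<subseteq> coord_ball R" using C(1,2) by (rule compact_subset_coord_ball)
  have "L \<subseteq> thickening SL2_R2 (coord_ball R) H" "H \<subseteq> thickening SL2_R2 (coord_ball R) L"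
    using C(3,4) thickening_mono[OF R] by blast+
  then show ?r
    using assms by (simp add: subset_eq thickening_coord_ball_iff) blast
next
  assume ?r
  then obtain R where "L \<subseteq> thickening SL2_R2 (coord_ball R) H" "H \<subseteq> thickening SL2_R2 (coord_ball R) L"
    using assms by (simp add: subset_eq thickening_coord_ball_iff) blast
  then show "sim_in SL2_R2 L H"
    unfolding sim_in_def using compact_coord_ball coord_ball_carrier by blast
qed

text \<open>
  Every compact set lies in a ball and every ball is compact, so the quantifier over compact sets may be
  replaced by one over radii.
\<close>

lemma proper_iff:
  assumes "L \<subseteq> carrier SL2_R2" "H \<subseteq> carrier SL2_R2"
  shows "proper_pair SL2_R2 L H \<longleftrightarrow>
    (\<forall>R. \<exists>R'. \<forall>l\<in>L. \<forall>h\<in>H. near R l h \<longrightarrow> l \<in> coord_ball R')" (is "_ \<longleftrightarrow> ?r")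
proof
  assume P: "proper_pair SL2_R2 L H"
  show ?r
  proof
    fix R
    have "L \<inter> thickening SL2_R2 (coord_ball R) H \<subseteq> carrier SL2_R2" using assms by blast
    moreover have "relatively_compact_in SL2_R2 (L \<inter> thickening SL2_R2 (coord_ball R) H)"
      using P compact_coord_ball coord_ball_carrier unfolding proper_pair_def by blast
    ultimately obtain R' where "L \<inter> thickening SL2_R2 (coord_ball R) H \<subseteq> coord_ball R'"
      using relatively_compact_iff by blast
    then show "\<exists>R'. \<forall>l\<in>L. \<forall>h\<in>H. near R l h \<longrightarrow> l \<in> coord_ball R'"
      using assms thickening_coord_ball_iff by blast
  qed
next
  assume r: ?r
  show "proper_pair SL2_R2 L H"
    unfolding proper_pair_def
  proof (intro allI impI, elim conjE)
    fix C assume C: "C \<subseteq> carrier SL2_R2" "compact C"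
    obtain R where R: "C \<subseteq> coord_ball R" using C by (rule compact_subset_coord_ball)
    obtain R' where R': "\<forall>l\<in>L. \<forall>h\<in>H. near R l h \<longrightarrow> l \<in> coord_ball R'" using r by blast
    have "L \<inter> thickening SL2_R2 (coord_ball R) H \<subseteq> coord_ball R'"
      using R' assms thickening_coord_ball_iff by blast
    then have "L \<inter> thickening SL2_R2 C H \<subseteq> coord_ball R'"
      using thickening_mono[OF R] by blast
    then show "relatively_compact_in SL2_R2 (L \<inter> thickening SL2_R2 C H)"
      using assms by (subst relatively_compact_iff) auto
  qed
qed

lemma near_refl: "near 1 z z"
  unfolding near_def
  by (intro bexI[of _ "mat 1"]) (simp, simp_all add: mat_1_elt elt_coord_ball)

lemma near_mono: "near R z w \<Longrightarrow> R \<le> R' \<Longrightarrow> near R' z w"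
  unfolding near_def using coord_ball_mono by blast

lemma near_sym:
  assumes "near R z w" "z \<in> carrier SL2_R2" "w \<in> carrier SL2_R2"
  shows "near (2 * (R * R)) w z"
proof -
  obtain c d where c: "c \<in> coord_ball R" and d: "d \<in> coord_ball R" and e: "z ** d = c ** w"
    using assms(1) unfolding near_def by blast
  have cd: "c \<in> carrier SL2_R2" "d \<in> carrier SL2_R2" using c d coord_ball_carrier by blast+
  have "w = inv\<^bsub>SL2_R2\<^esub> c ** (z ** d)"
    using cd assms by (simp add: e flip: G.m_assoc)
  then have "w ** inv\<^bsub>SL2_R2\<^esub> d = inv\<^bsub>SL2_R2\<^esub> c ** z"
    using cd assms by (simp add: G.m_assoc)
  then show ?thesis
    unfolding near_def using coord_ball_inv c d by blast
qed

lemma near_trans: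
  assumes "near R z w" "near S w u" "z \<in> carrier SL2_R2" "w \<in> carrier SL2_R2" "u \<in> carrier SL2_R2"
  shows "near (3 * (R * S)) z u"
proof -
  obtain c d where c: "c \<in> coord_ball R" and d: "d \<in> coord_ball R" and e: "z ** d = c ** w"
    using assms(1) unfolding near_def by blast
  obtain c' d' where c': "c' \<in> coord_ball S" and d': "d' \<in> coord_ball S" and e': "w ** d' = c' ** u"
    using assms(2) unfolding near_def by blast
  have "z ** (d ** d') = (c ** c') ** u"
    using e e' by (metis matrix_mul_assoc)
  then show ?thesis
    unfolding near_def using coord_ball_mult c d c' d' by blast
qed

text \<open>
  The radius \<open>T\<close> depends on \<open>R\<close> and \<open>S\<close> only: it bounds products of an element of the ball of radius \<open>R\<close>,
  one of radius \<open>S\<close>, and the inverse of one of radius \<open>R\<close>.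
\<close>

lemma near_coord_ball:
  obtains T where "\<And>z w. near R z w \<Longrightarrow> w \<in> coord_ball S \<Longrightarrow> z \<in> carrier SL2_R2 \<Longrightarrow> z \<in> coord_ball T"
proof -
  have "z \<in> coord_ball (3 * (3 * (R * S) * (2 * (R * R))))"
    if zw: "near R z w" "w \<in> coord_ball S" "z \<in> carrier SL2_R2" for z w
  proof -
    obtain c d where c: "c \<in> coord_ball R" and d: "d \<in> coord_ball R" and e: "z ** d = c ** w"
      using zw unfolding near_def by blast
    have "z = c ** w ** inv\<^bsub>SL2_R2\<^esub> d"
      using conj_eq_iff[OF zw(3) _ c d] e zw(2) coord_ball_carrier by auto
    then show ?thesis using coord_ball_mult[OF coord_ball_mult[OF c zw(2)] coord_ball_inv[OF d]] by simp
  qed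
  then show thesis using that by blast
qed

section \<open>Invariance of proper pairs under equivalence\<close>

lemma sim_sym: "sim_in X L H \<Longrightarrow> sim_in X H L"
  unfolding sim_in_def by blast

lemma sim_refl: "L \<subseteq> carrier SL2_R2 \<Longrightarrow> sim_in SL2_R2 L L"
  unfolding sim_iff using near_refl by blast

lemma sim_trans:
  assumes LH: "sim_in SL2_R2 L H" and HK: "sim_in SL2_R2 H K"
    and c: "L \<subseteq> carrier SL2_R2" "H \<subseteq> carrier SL2_R2" "K \<subseteq> carrier SL2_R2"
  shows "sim_in SL2_R2 L K"
proof -
  obtain R where R: "\<forall>l\<in>L. \<exists>h\<in>H. near R l h" "\<forall>h\<in>H. \<exists>l\<in>L. near R h l"
    using LH unfolding sim_iff[OF c(1,2)] by blast
  obtain S where S: "\<forall>h\<in>H. \<exists>k\<in>K. near S h k" "\<forall>k\<in>K. \<exists>h\<in>H. near S k h"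
    using HK unfolding sim_iff[OF c(2,3)] by blast
  have "\<exists>k\<in>K. near (3 * (R * S)) l k" if "l \<in> L" for l
    using bspec[OF R(1) that] S(1) near_trans that c by (meson subsetD)
  moreover have "\<exists>l\<in>L. near (3 * (S * R)) k l" if "k \<in> K" for k
    using bspec[OF S(2) that] R(2) near_trans that c by (meson subsetD)
  ultimately show ?thesis
    unfolding sim_iff[OF c(1,3)] by (intro exI[of _ "3 * (R * S)"]) (simp add: mult.commute)
qed

lemma simI:
  assumes "L \<subseteq> carrier SL2_R2" "H \<subseteq> carrier SL2_R2"
    and "\<And>l. l \<in> L \<Longrightarrow> \<exists>h\<in>H. near R l h" and "\<And>h. h \<in> H \<Longrightarrow> \<exists>l\<in>L. near S h l"
  shows "sim_in SL2_R2 L H"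
proof -
  have "\<forall>l\<in>L. \<exists>h\<in>H. near (max R S) l h" "\<forall>h\<in>H. \<exists>l\<in>L. near (max R S) h l"
    using assms(3,4) near_mono by (meson max.cobounded1 max.cobounded2)+
  then show ?thesis unfolding sim_iff[OF assms(1,2)] by blast
qed

lemma simI_subset:
  assumes "L \<subseteq> H" "H \<subseteq> carrier SL2_R2" "\<And>h. h \<in> H \<Longrightarrow> \<exists>l\<in>L. near R h l"
  shows "sim_in SL2_R2 L H"
proof (rule simI)
  show "\<exists>h\<in>H. near 1 l h" if "l \<in> L" for l
    using near_refl that assms(1) by blast
qed (use assms in blast)+

lemma proper_sym:
  assumes P: "proper_pair SL2_R2 L H" and c: "L \<subseteq> carrier SL2_R2" "H \<subseteq> carrier SL2_R2"
  shows "proper_pair SL2_R2 H L"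
  unfolding proper_iff[OF c(2,1)]
proof
  fix R
  obtain R' where R': "\<forall>l\<in>L. \<forall>h\<in>H. near (2 * (R * R)) l h \<longrightarrow> l \<in> coord_ball R'"
    using P unfolding proper_iff[OF c] by blast
  obtain T where T: "\<And>z w. near R z w \<Longrightarrow> w \<in> coord_ball R' \<Longrightarrow> z \<in> carrier SL2_R2 \<Longrightarrow> z \<in> coord_ball T"
    using near_coord_ball by blast
  have "h \<in> coord_ball T" if "h \<in> H" "l \<in> L" "near R h l" for h l
  proof -
    have "near (2 * (R * R)) l h" using near_sym that c by blast
    then show ?thesis using T R' that c by blast
  qed
  then show "\<exists>R'. \<forall>l\<in>H. \<forall>h\<in>L. near R l h \<longrightarrow> l \<in> coord_ball R'" by blast
qed

text \<open>
  If \<open>l\<close> is close to both \<open>l' \<in> L'\<close> and \<open>h \<in> H\<close>, then \<open>l'\<close> is close to \<open>h\<close>, hence bounded, and so is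
  \<open>l\<close>. This invariance is what separates the equivalence classes below.
\<close>

lemma proper_sim:
  assumes S: "sim_in SL2_R2 L L'" and P: "proper_pair SL2_R2 L' H"
    and c: "L \<subseteq> carrier SL2_R2" "L' \<subseteq> carrier SL2_R2" "H \<subseteq> carrier SL2_R2"
  shows "proper_pair SL2_R2 L H"
  unfolding proper_iff[OF c(1,3)]
proof
  fix R
  obtain S where S: "\<forall>l\<in>L. \<exists>h\<in>L'. near S l h"
    using S unfolding sim_iff[OF c(1,2)] by blast
  obtain R' where R': "\<forall>l\<in>L'. \<forall>h\<in>H. near (3 * (2 * (S * S) * R)) l h \<longrightarrow> l \<in> coord_ball R'"
    using P unfolding proper_iff[OF c(2,3)] by blast
  obtain T where T: "\<And>z w. near S z w \<Longrightarrow> w \<in> coord_ball R' \<Longrightarrow> z \<in> carrier SL2_R2 \<Longrightarrow> z \<in> coord_ball T"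
    using near_coord_ball by blast
  have "l \<in> coord_ball T" if lL: "l \<in> L" and "h \<in> H" "near R l h" for l h
  proof -
    obtain l' where l': "l' \<in> L'" "near S l l'" using bspec[OF S lL] by blast
    have m: "l \<in> carrier SL2_R2" "l' \<in> carrier SL2_R2" "h \<in> carrier SL2_R2"
      using that l' c by auto
    have "near (3 * (2 * (S * S) * R)) l' h"
      using near_trans[OF near_sym[OF l'(2)] \<open>near R l h\<close>] m by blast
    then show ?thesis using T R' l' \<open>h \<in> H\<close> m by blast
  qed
  then show "\<exists>R'. \<forall>l\<in>L. \<forall>h\<in>H. near R l h \<longrightarrow> l \<in> coord_ball R'" by blast
qed

lemma proper_mono:
  assumes "proper_pair SL2_R2 L H" "H' \<subseteq> H" "L \<subseteq> carrier SL2_R2" "H \<subseteq> carrier SL2_R2"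
  shows "proper_pair SL2_R2 L H'"
proof -
  have "H' \<subseteq> carrier SL2_R2" using assms by blast
  then show ?thesis using assms by (simp add: proper_iff) (meson subsetD)
qed

text \<open>
  By \<open>near_coord_ball\<close>, it is enough to find a bounded element close to \<open>l\<close>. It need not be \<open>h\<close>: often it is
  \<open>h\<close> with its uncontrolled translation part removed.
\<close>

lemma proper_pairI:
  assumes c: "L \<subseteq> carrier SL2_R2" "H \<subseteq> carrier SL2_R2"
    and bound: "\<And>R l h. 1 \<le> R \<Longrightarrow> l \<in> L \<Longrightarrow> h \<in> H \<Longrightarrow> near R l h \<Longrightarrow> \<exists>h'\<in>coord_ball (f R). near R l h'"
  shows "proper_pair SL2_R2 L H"
  unfolding proper_iff[OF c]
proof
  fix R
  obtain T where T: "\<And>z w. near R z w \<Longrightarrow> w \<in> coord_ball (f R) \<Longrightarrow> z \<in> carrier SL2_R2 \<Longrightarrow> z \<in> coord_ball T"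
    using near_coord_ball by blast
  have "l \<in> coord_ball T" if lh: "l \<in> L" "h \<in> H" "near R l h" for l h
  proof -
    have "1 \<le> R" using lh(3) unfolding near_def by (auto elim: coord_ball_cases)
    then obtain h' where "h' \<in> coord_ball (f R)" "near R l h'" using bound lh by blast
    then show ?thesis using T lh(1) c by blast
  qed
  then show "\<exists>R'. \<forall>l\<in>L. \<forall>h\<in>H. near R l h \<longrightarrow> l \<in> coord_ball R'" by blast
qed

lemma nearE:
  assumes "near R z w"
  obtains \<alpha> \<beta> \<gamma> \<delta> u v p q r s x y where
    "z ** elt p q r s x y = elt \<alpha> \<beta> \<gamma> \<delta> u v ** w"
    "\<alpha> * \<delta> - \<beta> * \<gamma> = 1" "p * s - q * r = 1" "1 \<le> R"
    "\<bar>\<alpha>\<bar> \<le> R" "\<bar>\<beta>\<bar> \<le> R" "\<bar>\<gamma>\<bar> \<le> R" "\<bar>\<delta>\<bar> \<le> R" "\<bar>u\<bar> \<le> R" "\<bar>v\<bar> \<le> R"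
    "\<bar>p\<bar> \<le> R" "\<bar>q\<bar> \<le> R" "\<bar>r\<bar> \<le> R" "\<bar>s\<bar> \<le> R" "\<bar>x\<bar> \<le> R" "\<bar>y\<bar> \<le> R"
proof -
  obtain c d where c: "c \<in> coord_ball R" and d: "d \<in> coord_ball R" and e: "z ** d = c ** w"
    using assms unfolding near_def by blast
  obtain \<alpha> \<beta> \<gamma> \<delta> u v where c': "c = elt \<alpha> \<beta> \<gamma> \<delta> u v" "\<alpha> * \<delta> - \<beta> * \<gamma> = 1" "1 \<le> R"
    "\<bar>\<alpha>\<bar> \<le> R" "\<bar>\<beta>\<bar> \<le> R" "\<bar>\<gamma>\<bar> \<le> R" "\<bar>\<delta>\<bar> \<le> R" "\<bar>u\<bar> \<le> R" "\<bar>v\<bar> \<le> R"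
    using c by (rule coord_ball_cases)
  obtain p q r s x y where d': "d = elt p q r s x y" "p * s - q * r = 1"
    "\<bar>p\<bar> \<le> R" "\<bar>q\<bar> \<le> R" "\<bar>r\<bar> \<le> R" "\<bar>s\<bar> \<le> R" "\<bar>x\<bar> \<le> R" "\<bar>y\<bar> \<le> R"
    using d by (rule coord_ball_cases)
  show thesis
    by (rule that[OF e[unfolded c' d'] c'(2) d'(2) c'(3-9) d'(3-8)])
qed

lemma nearI:
  assumes "elt a b c d x y ** elt p q r s x' y' = elt \<alpha> \<beta> \<gamma> \<delta> u v ** w"
    and "elt p q r s x' y' \<in> coord_ball R" "elt \<alpha> \<beta> \<gamma> \<delta> u v \<in> coord_ball R"
  shows "near R (elt a b c d x y) w"
  using assms unfolding near_def by blast

section \<open>Proper pairs\<close>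

text \<open>
  Forgetting translations is a homomorphism that maps each ball into itself.
\<close>

lemma near_linear_part:
  assumes "near R (elt a b c d x y) (elt a' b' c' d' x' y')"
  shows "near R (elt a b c d 0 0) (elt a' b' c' d' 0 0)"
proof -
  obtain \<alpha> \<beta> \<gamma> \<delta> u v p q r s i j where
    e: "elt a b c d x y ** elt p q r s i j = elt \<alpha> \<beta> \<gamma> \<delta> u v ** elt a' b' c' d' x' y'"
    and d1: "\<alpha> * \<delta> - \<beta> * \<gamma> = 1" "p * s - q * r = 1" and R: "1 \<le> R"
    "\<bar>\<alpha>\<bar> \<le> R" "\<bar>\<beta>\<bar> \<le> R" "\<bar>\<gamma>\<bar> \<le> R" "\<bar>\<delta>\<bar> \<le> R" "\<bar>u\<bar> \<le> R" "\<bar>v\<bar> \<le> R"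
    "\<bar>p\<bar> \<le> R" "\<bar>q\<bar> \<le> R" "\<bar>r\<bar> \<le> R" "\<bar>s\<bar> \<le> R" "\<bar>i\<bar> \<le> R" "\<bar>j\<bar> \<le> R"
    by (rule nearE[OF assms]) (rule that)
  show ?thesis
  proof (rule nearI)
    show "elt a b c d 0 0 ** elt p q r s 0 0 = elt \<alpha> \<beta> \<gamma> \<delta> 0 0 ** elt a' b' c' d' 0 0"
      using e by (simp add: elt_mult)
    have "\<bar>0\<bar> \<le> R" using R(1) by simp
    then show "elt p q r s 0 0 \<in> coord_ball R" "elt \<alpha> \<beta> \<gamma> \<delta> 0 0 \<in> coord_ball R"
      unfolding elt_coord_ball by (intro conjI R d1; assumption)+
  qed
qed

lemma proper_SL2_R2: "proper_pair SL2_R2 SL2_sub R2_sub"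
proof (rule proper_pairI[OF subs_carrier(1,2), where f = "\<lambda>R. R"])
  fix R l h
  assume R: "1 \<le> R" and "l \<in> SL2_sub" "h \<in> R2_sub" and near: "near R l h"
  then obtain a b c d x y where l: "l = elt a b c d 0 0" and h: "h = elt 1 0 0 1 x y"
    by (auto simp: SL2_sub_elt R2_sub_elt)
  have "near R l (elt 1 0 0 1 0 0)"
    using near_linear_part near unfolding l h by blast
  moreover have "elt 1 0 0 1 0 0 \<in> coord_ball R" using R by (simp add: elt_coord_ball)
  ultimately show "\<exists>h'\<in>coord_ball R. near R l h'" by blast
qed

text \<open>
  Let \<open>n\<close> and \<open>w\<close> be the linear and translation parts of \<open>h\<close>, and \<open>c\<close>, \<open>d\<close> the linear parts of the bounded
  factors. Comparing translations in \<open>l d = c h\<close> and cancelling \<open>c\<close> gives \<open>n d\<inverse>(x, y) = w + c\<inverse>(u, v)\<close>.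
  The shear \<open>n\<close> fixes first coordinates, and the first coordinate of \<open>w\<close> is the parameter \<open>t\<close>.
\<close>

lemma proper_SL2_M: "proper_pair SL2_R2 SL2_sub M_sub"
proof (rule proper_pairI[OF subs_carrier(1,5), where f = "\<lambda>R. 1 + 4 * (R * R)"])
  fix R l h
  assume "l \<in> SL2_sub" "h \<in> M_sub" and near: "near R l h"
  then obtain a b c d t m where l: "l = elt a b c d 0 0" "a * d - b * c = 1" and h: "h = elt 1 0 t 1 t m"
    by (auto simp: SL2_sub_elt M_sub_elt)
  obtain \<alpha> \<beta> \<gamma> \<delta> u v p q r s x y where
    e: "l ** elt p q r s x y = elt \<alpha> \<beta> \<gamma> \<delta> u v ** h"
    and d1: "\<alpha> * \<delta> - \<beta> * \<gamma> = 1" "p * s - q * r = 1" and R: "1 \<le> R"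
    "\<bar>\<alpha>\<bar> \<le> R" "\<bar>\<beta>\<bar> \<le> R" "\<bar>\<gamma>\<bar> \<le> R" "\<bar>\<delta>\<bar> \<le> R" "\<bar>u\<bar> \<le> R" "\<bar>v\<bar> \<le> R"
    "\<bar>p\<bar> \<le> R" "\<bar>q\<bar> \<le> R" "\<bar>r\<bar> \<le> R" "\<bar>s\<bar> \<le> R" "\<bar>x\<bar> \<le> R" "\<bar>y\<bar> \<le> R"
    by (rule nearE[OF near]) (rule that)
  have "a * p + b * r = \<alpha> + \<beta> * t" "a * q + b * s = \<beta>" "c * p + d * r = \<gamma> + \<delta> * t"
     "c * q + d * s = \<delta>" "a * x + b * y = \<alpha> * t + \<beta> * m + u" "c * x + d * y = \<gamma> * t + \<delta> * m + v"
    using e by (simp_all add: l h elt_mult)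
  then have "t = (s * x - q * y) - (\<delta> * u - \<beta> * v)"
    using l(2) d1 by algebra
  moreover have "\<bar>s * x\<bar> \<le> R * R" "\<bar>q * y\<bar> \<le> R * R" "\<bar>\<delta> * u\<bar> \<le> R * R" "\<bar>\<beta> * v\<bar> \<le> R * R"
    by (intro abs_mult_le R)+
  ultimately have "\<bar>t\<bar> \<le> 4 * (R * R)" by linarith
  then have "elt 1 0 t 1 0 0 \<in> coord_ball (1 + 4 * (R * R))"
    by (simp add: elt_coord_ball)
  moreover have "near R l (elt 1 0 t 1 0 0)"
    using near_linear_part near unfolding l h by blast
  ultimately show "\<exists>h'\<in>coord_ball (1 + 4 * (R * R)). near R l h'" by blast
qed

lemma N_subset_M: "N_sub \<subseteq> M_sub"
  by (auto simp: N_sub_elt M_sub_elt)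

lemma N_coord_ball:
  assumes "\<bar>t\<bar> \<le> T" shows "elt 1 0 t 1 t (t\<^sup>2 / 2) \<in> coord_ball (1 + T + T * T)"
proof -
  have "\<bar>t * t\<bar> \<le> T * T" "0 \<le> T" "0 \<le> T * T"
    using assms abs_mult_le[OF assms assms] by auto
  then have "\<bar>t * t / 2\<bar> \<le> 1 + T + T * T" "\<bar>t\<bar> \<le> 1 + T + T * T" "1 \<le> 1 + T + T * T"
    using assms by linarith+
  then show ?thesis unfolding elt_coord_ball power2_eq_square by simp
qed

text \<open>
  A translation has linear part \<open>1\<close>, so the linear part of \<open>h\<close> is \<open>c\<inverse> d\<close>, which is bounded; in \<open>N\<close> the
  linear part determines the whole element.
\<close>

lemma proper_R2_N: "proper_pair SL2_R2 R2_sub N_sub"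
proof (rule proper_pairI[OF subs_carrier(2,6), where
        f = "\<lambda>R. 1 + 4 * (R * R) + 4 * (R * R) * (4 * (R * R))"])
  fix R l h
  assume "l \<in> R2_sub" "h \<in> N_sub" and near: "near R l h"
  then obtain w z t where l: "l = elt 1 0 0 1 w z" and h: "h = elt 1 0 t 1 t (t\<^sup>2 / 2)"
    by (auto simp: R2_sub_elt N_sub_elt)
  obtain \<alpha> \<beta> \<gamma> \<delta> u v p q r s x y where
    e: "l ** elt p q r s x y = elt \<alpha> \<beta> \<gamma> \<delta> u v ** h"
    and d1: "\<alpha> * \<delta> - \<beta> * \<gamma> = 1" "p * s - q * r = 1" and R: "1 \<le> R"
    "\<bar>\<alpha>\<bar> \<le> R" "\<bar>\<beta>\<bar> \<le> R" "\<bar>\<gamma>\<bar> \<le> R" "\<bar>\<delta>\<bar> \<le> R" "\<bar>u\<bar> \<le> R" "\<bar>v\<bar> \<le> R"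
    "\<bar>p\<bar> \<le> R" "\<bar>q\<bar> \<le> R" "\<bar>r\<bar> \<le> R" "\<bar>s\<bar> \<le> R" "\<bar>x\<bar> \<le> R" "\<bar>y\<bar> \<le> R"
    by (rule nearE[OF near]) (rule that)
  have e: "p = \<alpha> + \<beta> * t" "r = \<gamma> + \<delta> * t"
    using e by (simp_all add: l h elt_mult)
  have "t = \<alpha> * r - \<gamma> * p" using e d1 by algebra
  moreover have "\<bar>\<alpha> * r\<bar> \<le> R * R" "\<bar>\<gamma> * p\<bar> \<le> R * R"
    by (intro abs_mult_le R)+
  ultimately have "\<bar>t\<bar> \<le> 4 * (R * R)" by linarith
  then show "\<exists>h'\<in>coord_ball (1 + 4 * (R * R) + 4 * (R * R) * (4 * (R * R))). near R l h'"
    using N_coord_ball near h by blast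
qed

text \<open>
  The form in which determinant \<open>1\<close> is used: a row of a bounded matrix of determinant \<open>1\<close> satisfies the first
  hypothesis, so its two entries cannot be of order \<open>1/t\<^sup>2\<close> and \<open>1/t\<close> for large \<open>t\<close>.
\<close>

lemma abs_bound_of_unit_row:
  fixes t :: real
  assumes "1 \<le> R * (\<bar>\<sigma>\<bar> + \<bar>\<rho>\<bar>)" "\<bar>\<sigma>\<bar> * t\<^sup>2 \<le> A" "\<bar>\<rho>\<bar> * \<bar>t\<bar> \<le> A" "0 \<le> R"
  shows "\<bar>t\<bar> \<le> R * A + 1"
proof (rule ccontr)
  assume "\<not> ?thesis"
  then have t: "R * A + 1 < \<bar>t\<bar>" by simp
  have A: "0 \<le> R * A" using assms by (meson abs_ge_zero mult_nonneg_nonneg order_trans)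
  have "\<bar>t\<bar> * \<bar>t\<bar> \<le> R * (\<bar>\<sigma>\<bar> + \<bar>\<rho>\<bar>) * (\<bar>t\<bar> * \<bar>t\<bar>)"
    using mult_right_mono[OF assms(1), of "\<bar>t\<bar> * \<bar>t\<bar>"] by simp
  also have "\<dots> = R * (\<bar>\<sigma>\<bar> * t\<^sup>2) + R * (\<bar>\<rho>\<bar> * \<bar>t\<bar>) * \<bar>t\<bar>"
    by (simp add: algebra_simps power2_eq_square)
  also have "\<dots> \<le> R * A + R * A * \<bar>t\<bar>"
    using assms by (intro add_mono mult_right_mono mult_left_mono) auto
  also have "\<dots> < \<bar>t\<bar> + R * A * \<bar>t\<bar>" using t A by linarith
  also have "\<dots> = (R * A + 1) * \<bar>t\<bar>" by (simp add: algebra_simps)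
  also have "\<dots> \<le> \<bar>t\<bar> * \<bar>t\<bar>" using t by (intro mult_right_mono) auto
  finally show False by simp
qed

lemma abs_twice_sum_le:
  fixes x y z :: real
  assumes "\<bar>x\<bar> \<le> a" "\<bar>y\<bar> \<le> b" "\<bar>z\<bar> \<le> c"
  shows "\<bar>2 * (x - y + z)\<bar> \<le> 2 * (a + b + c)"
  using assms unfolding abs_le_iff by auto

text \<open>
  The diagonal parameter \<open>e\<^sup>a\<close> of \<open>l\<close> and the parameter \<open>t\<close> of \<open>h\<close> are tied by \<open>\<bar>t\<bar> = O(e\<^sup>\<bar>\<^sup>a\<^sup>\<bar>)\<close>. Comparing
  second rows, the translation \<open>\<gamma> t + \<delta> t\<^sup>2/2\<close> differs from \<open>t\<close> times the entry \<open>\<gamma> + \<delta> t\<close> by half of the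
  quadratic term, and this difference can only be absorbed if the second row of \<open>c\<close> (for \<open>a \<ge> 0\<close>) or of \<open>d\<close> (for \<open>a < 0\<close>) is
  of order \<open>(1/t, 1/t\<^sup>2)\<close>.
\<close>

lemma proper_S_N: "proper_pair SL2_R2 S_sub N_sub"
proof (rule proper_pairI[OF subs_carrier(3,6), where
        f = "\<lambda>R. 1 + (R * (6 * (R * (R * R)) + 4 * R) + 1)
              + (R * (6 * (R * (R * R)) + 4 * R) + 1) * (R * (6 * (R * (R * R)) + 4 * R) + 1)"])
  fix R l h
  assume "l \<in> S_sub" "h \<in> N_sub" and near: "near R l h"
  then obtain a w t where l: "l = elt (exp a) 0 0 (exp (- a)) w 0" and h: "h = elt 1 0 t 1 t (t\<^sup>2 / 2)"
    by (auto simp: S_sub_elt N_sub_elt)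
  define E E' where "E = exp a" and "E' = exp (- a)"
  have E: "0 < E" "0 < E'" "E * E' = 1" by (simp_all add: E_def E'_def flip: exp_add)
  obtain \<alpha> \<beta> \<gamma> \<delta> u v p q r s x y where
    e: "l ** elt p q r s x y = elt \<alpha> \<beta> \<gamma> \<delta> u v ** h"
    and d1: "\<alpha> * \<delta> - \<beta> * \<gamma> = 1" "p * s - q * r = 1" and R: "1 \<le> R"
    "\<bar>\<alpha>\<bar> \<le> R" "\<bar>\<beta>\<bar> \<le> R" "\<bar>\<gamma>\<bar> \<le> R" "\<bar>\<delta>\<bar> \<le> R" "\<bar>u\<bar> \<le> R" "\<bar>v\<bar> \<le> R"
    "\<bar>p\<bar> \<le> R" "\<bar>q\<bar> \<le> R" "\<bar>r\<bar> \<le> R" "\<bar>s\<bar> \<le> R" "\<bar>x\<bar> \<le> R" "\<bar>y\<bar> \<le> R"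
    by (rule nearE[OF near]) (rule that)
  have e: "E * p = \<alpha> + \<beta> * t" "E' * r = \<gamma> + \<delta> * t" "E' * s = \<delta>"
      "E' * y = \<gamma> * t + \<delta> * (t\<^sup>2 / 2) + v"
    using e by (simp_all add: l h elt_mult E_def E'_def)
  let ?A = "6 * (R * (R * R)) + 4 * R"
  have t: "t = (\<alpha> * r) * E' - (\<gamma> * p) * E" using e d1 by algebra
  \<comment> \<open>The lower left entry of \<open>c\<inverse> l d\<close> is \<open>t\<close>, so \<open>\<bar>t\<bar>\<close> is at most a multiple of \<open>max E E'\<close>; \<open>\<epsilon>\<close> stands for \<open>min E E'\<close>.\<close>
  have small: "\<bar>t * \<epsilon>\<bar> \<le> 2 * (R * R)"
    if "\<epsilon> * E \<le> 1" "\<epsilon> * E' \<le> 1" "0 \<le> \<epsilon>" for \<epsilon>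
  proof -
    have *: "\<bar>\<alpha> * r\<bar> \<le> R * R" "\<bar>\<gamma> * p\<bar> \<le> R * R"
      by (intro abs_mult_le R order_refl)+
    have "\<bar>E' * \<epsilon>\<bar> \<le> 1" "\<bar>E * \<epsilon>\<bar> \<le> 1" using that E by (simp_all add: mult.commute)
    then have "\<bar>(\<alpha> * r) * (E' * \<epsilon>)\<bar> \<le> R * R * 1" "\<bar>(\<gamma> * p) * (E * \<epsilon>)\<bar> \<le> R * R * 1"
      using * abs_mult_le by blast+
    moreover have "t * \<epsilon> = (\<alpha> * r) * (E' * \<epsilon>) - (\<gamma> * p) * (E * \<epsilon>)"
      unfolding t by (simp add: algebra_simps)
    ultimately show ?thesis by linarith
  qed
  have "\<bar>t\<bar> \<le> R * ?A + 1"
  proof (cases "1 \<le> E")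
    case True
    have E': "E' \<le> 1" "E' * E' \<le> 1" using True E mult_mono[OF True order_refl, of E'] mult_le_one[of E' E'] by auto
    have "\<bar>t * E'\<bar> \<le> 2 * (R * R)" using E E' by (intro small) (auto simp: mult.commute)
    then have 1: "\<bar>(t * E') * r\<bar> \<le> 2 * (R * R) * R" using R(10) by (rule abs_mult_le)
    have 2: "\<bar>E' * y\<bar> \<le> 1 * R" using E(2) E'(1) R(13) by (intro abs_mult_le) auto
    \<comment> \<open>Multiplying the second-row equation for \<open>\<gamma> + \<delta> t\<close> by \<open>t\<close> and subtracting the one for the translation.\<close>
    have "\<delta> * t\<^sup>2 = 2 * ((t * E') * r - E' * y + v)" using e by algebra
    then have 3: "\<bar>\<delta> * t\<^sup>2\<bar> \<le> 4 * (R * (R * R)) + 4 * R" using abs_twice_sum_le[OF 1 2 R(7)] by (simp add: mult.assoc)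
    have "\<gamma> * t = (t * E') * r - \<delta> * t\<^sup>2" using e by algebra
    then have 4: "\<bar>\<gamma> * t\<bar> \<le> ?A" using 1 3 R(1) by linarith
    have "0 \<le> R * (R * R)" using R(1) by simp
    then have 5: "\<bar>\<delta>\<bar> * t\<^sup>2 \<le> ?A" "\<bar>\<gamma>\<bar> * \<bar>t\<bar> \<le> ?A" using 3 4 by (simp_all add: abs_mult)
    have "\<bar>\<alpha> * \<delta>\<bar> \<le> R * \<bar>\<delta>\<bar>" "\<bar>\<beta> * \<gamma>\<bar> \<le> R * \<bar>\<gamma>\<bar>"
      by (intro abs_mult_le R order_refl)+
    then have "1 \<le> R * (\<bar>\<delta>\<bar> + \<bar>\<gamma>\<bar>)" using d1(1) by (simp add: distrib_left)
    then show ?thesis using abs_bound_of_unit_row 5 R(1) by simp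
  next
    case False
    have E1: "E \<le> 1" "E * E \<le> 1" using False E by (simp_all add: mult_le_one)
    have "\<bar>t * E\<bar> \<le> 2 * (R * R)" using E E1 by (intro small) (auto simp: mult.commute)
    then have 1: "\<bar>(t * E) * \<gamma>\<bar> \<le> 2 * (R * R) * R" using R(4) by (rule abs_mult_le)
    have 2: "\<bar>E * v\<bar> \<le> 1 * R" using E(1) E1(1) R(7) by (intro abs_mult_le) auto
    \<comment> \<open>The same elimination, with the equations multiplied by \<open>E\<close> and solved for the second row of \<open>d\<close>.\<close>
    have "s * t\<^sup>2 = 2 * (- ((t * E) * \<gamma>) - E * v + y)" using e E(3) by algebra
    moreover have neg: "\<bar>- ((t * E) * \<gamma>)\<bar> \<le> 2 * (R * R) * R" using 1 by simp
    ultimately have 3: "\<bar>s * t\<^sup>2\<bar> \<le> 4 * (R * (R * R)) + 4 * R" using abs_twice_sum_le[OF neg 2 R(13)] by (simp add: mult.assoc)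
    have "r * t = (t * E) * \<gamma> + s * t\<^sup>2" using e E(3) by algebra
    then have 4: "\<bar>r * t\<bar> \<le> ?A" using 1 3 R(1) by linarith
    have "0 \<le> R * (R * R)" using R(1) by simp
    then have 5: "\<bar>s\<bar> * t\<^sup>2 \<le> ?A" "\<bar>r\<bar> * \<bar>t\<bar> \<le> ?A" using 3 4 by (simp_all add: abs_mult)
    have "\<bar>p * s\<bar> \<le> R * \<bar>s\<bar>" "\<bar>q * r\<bar> \<le> R * \<bar>r\<bar>"
      by (intro abs_mult_le R order_refl)+
    then have "1 \<le> R * (\<bar>s\<bar> + \<bar>r\<bar>)" using d1(2) by (simp add: distrib_left)
    then show ?thesis using abs_bound_of_unit_row 5 R(1) by simp
  qed
  then show "\<exists>h'\<in>coord_ball (1 + (R * ?A + 1) + (R * ?A + 1) * (R * ?A + 1)). near R l h'"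
    using N_coord_ball near h by blast
qed

section \<open>Pairs that are not proper\<close>

lemma not_properI:
  assumes c: "L \<subseteq> carrier SL2_R2" "H \<subseteq> carrier SL2_R2"
    and "\<And>n. \<exists>l\<in>L. \<exists>h\<in>H. near R l h \<and> l \<notin> coord_ball n"
  shows "\<not> proper_pair SL2_R2 L H"
  unfolding proper_iff[OF c] using assms(3) by blast

lemma not_proper_if_common:
  assumes c: "L \<subseteq> carrier SL2_R2" "H \<subseteq> carrier SL2_R2"
    and "\<And>n. \<exists>l\<in>L \<inter> H. l \<notin> coord_ball n"
  shows "\<not> proper_pair SL2_R2 L H"
  using assms near_refl by (intro not_properI[of _ _ 1]) blast+

lemma unbounded_families:
  "\<exists>a. elt (exp a) 0 0 (exp (-a)) 0 0 \<notin> coord_ball n"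
  "\<exists>b. 1 \<le> b \<and> elt 1 0 b 1 x y \<notin> coord_ball n"
  "\<exists>x. elt 1 0 0 1 x 0 \<notin> coord_ball n"
  "\<exists>y. elt 1 0 0 1 0 y \<notin> coord_ball n"
proof -
  have "elt (exp n) 0 0 (exp (- n)) 0 0 \<notin> coord_ball n"
    using exp_ge_add_one_self[of n] unfolding elt_coord_ball by linarith
  then show "\<exists>a. elt (exp a) 0 0 (exp (-a)) 0 0 \<notin> coord_ball n" ..
  have *: "\<not> \<bar>\<bar>n\<bar> + 1\<bar> \<le> n" by simp
  then show "\<exists>b. 1 \<le> b \<and> elt 1 0 b 1 x y \<notin> coord_ball n"
    by (intro exI[of _ "\<bar>n\<bar> + 1"]) (simp add: elt_coord_ball)
  show "\<exists>x. elt 1 0 0 1 x 0 \<notin> coord_ball n" "\<exists>y. elt 1 0 0 1 0 y \<notin> coord_ball n"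
    using * by (intro exI[of _ "\<bar>n\<bar> + 1"]; simp add: elt_coord_ball)+
qed

lemma N_unbounded: "\<exists>l\<in>N_sub. l \<notin> coord_ball n"
proof -
  have *: "\<not> \<bar>\<bar>n\<bar> + 1\<bar> \<le> n" by simp
  have "elt 1 0 (\<bar>n\<bar> + 1) 1 (\<bar>n\<bar> + 1) ((\<bar>n\<bar> + 1)\<^sup>2 / 2) \<notin> coord_ball n"
    using * by (simp add: elt_coord_ball)
  then show ?thesis unfolding N_sub_elt by blast
qed

lemma diag_in: "elt (exp a) 0 0 (exp (-a)) 0 0 \<in> SL2_sub" "elt (exp a) 0 0 (exp (-a)) 0 0 \<in> S_sub"
  and shear_in: "elt 1 0 b 1 0 0 \<in> SL2_sub" "elt 1 0 b 1 0 0 \<in> L_sub"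
  and x_in: "elt 1 0 0 1 x 0 \<in> R2_sub" "elt 1 0 0 1 x 0 \<in> S_sub"
  and y_in: "elt 1 0 0 1 0 y \<in> R2_sub" "elt 1 0 0 1 0 y \<in> L_sub" "elt 1 0 0 1 0 y \<in> M_sub"
proof -
  have "elt 1 0 0 1 x 0 = elt (exp 0) 0 0 (exp (-0)) x 0" for x by simp
  then show "elt 1 0 0 1 x 0 \<in> S_sub" unfolding S_sub_elt by blast
qed (force simp: subs_elt simp flip: exp_add)+

lemma subs_unbounded:
  assumes "K \<in> {R2_sub, SL2_sub, S_sub, L_sub, M_sub, N_sub}"
  shows "\<exists>l\<in>K. l \<notin> coord_ball n"
  using assms unbounded_families[of n] N_unbounded[of n] diag_in x_in y_in by fast

lemma not_proper_pairs:
  "\<not> proper_pair SL2_R2 SL2_sub S_sub" "\<not> proper_pair SL2_R2 SL2_sub L_sub"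
  "\<not> proper_pair SL2_R2 R2_sub S_sub" "\<not> proper_pair SL2_R2 R2_sub L_sub"
  "\<not> proper_pair SL2_R2 R2_sub M_sub" "\<not> proper_pair SL2_R2 L_sub M_sub"
  "\<not> proper_pair SL2_R2 M_sub N_sub"
  by (intro not_proper_if_common subs_carrier; 
      use unbounded_families diag_in shear_in x_in y_in N_unbounded N_subset_M in blast)+

text \<open>
  A quarter turn carries the horizontal translations in \<open>S\<close> to vertical ones.
\<close>

lemma not_proper_S_translation:
  assumes "H \<subseteq> carrier SL2_R2" "\<And>y. elt 1 0 0 1 0 y \<in> H"
  shows "\<not> proper_pair SL2_R2 S_sub H"
proof (rule not_properI[OF subs_carrier(3) assms(1), of 1])
  fix n
  obtain x where x: "elt 1 0 0 1 x 0 \<notin> coord_ball n" using unbounded_families by blast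
  have "near 1 (elt 1 0 0 1 x 0) (elt 1 0 0 1 0 (- x))"
  proof (rule nearI)
    show "elt 1 0 0 1 x 0 ** elt 0 (-1) 1 0 0 0 = elt 0 (-1) 1 0 0 0 ** elt 1 0 0 1 0 (- x)"
      by (simp add: elt_mult)
  qed (simp_all add: elt_coord_ball)
  then show "\<exists>l\<in>S_sub. \<exists>h\<in>H. near 1 l h \<and> l \<notin> coord_ball n"
    using x x_in(2) assms(2) by blast
qed

text \<open>
  Although the translations of \<open>N\<close> run along a parabola, its direction at parameter \<open>b\<close> differs from the vertical by
  an angle of order \<open>1/b\<close> only. Correcting this angle changes the linear part by a bounded factor as well.
\<close>

lemma not_proper_L_N: "\<not> proper_pair SL2_R2 L_sub N_sub"
proof (rule not_properI[OF subs_carrier(4,6), of 2])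
  fix n
  obtain b where b: "1 \<le> b" "elt 1 0 b 1 0 0 \<notin> coord_ball n" using unbounded_families by blast
  let ?l = "elt 1 0 (- b) 1 0 (b\<^sup>2 / 2)"
  have "near 2 ?l (elt 1 0 b 1 b (b\<^sup>2 / 2))"
  proof (rule nearI)
    \<comment> \<open>The shear on the right-hand side sends \<open>(b, b\<^sup>2/2)\<close> to \<open>(0, b\<^sup>2/2)\<close>. The parameter \<open>-b\<close> of \<open>?l\<close> is the one that keeps the other factor bounded.\<close>
    show "?l ** elt (-1) (-2/b) 0 (-1) 0 0 = elt 1 (-2/b) 0 1 0 0 ** elt 1 0 b 1 b (b\<^sup>2 / 2)"
      using b by (simp add: elt_mult power2_eq_square)
  qed (use b in \<open>simp_all add: elt_coord_ball divide_le_eq\<close>)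
  moreover have "?l \<notin> coord_ball n" using b by (auto simp: elt_coord_ball)
  moreover have "?l \<in> L_sub" "elt 1 0 b 1 b (b\<^sup>2 / 2) \<in> N_sub"
    unfolding L_sub_elt N_sub_elt by blast+
  ultimately show "\<exists>l\<in>L_sub. \<exists>h\<in>N_sub. near 2 l h \<and> l \<notin> coord_ball n" by blast
qed

text \<open>
  On \<open>L\<close> one has \<open>g\<inverse> v = v\<close> for \<open>l = (g, v)\<close>, so on \<open>C L C\<inverse>\<close> the length of \<open>g\<inverse> v\<close> grows at most
  linearly in the lengths of \<open>v\<close> and \<open>g\<close>. For \<open>g = diag(k, 1/k)\<close> and \<open>v = k e\<^sub>2\<close> it is \<open>k\<^sup>2\<close>.
\<close>

lemma L_not_sim_carrier: "\<not> sim_in SL2_R2 L_sub (carrier SL2_R2)"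
proof
  assume "sim_in SL2_R2 L_sub (carrier SL2_R2)"
  then obtain R where R: "\<forall>g\<in>carrier SL2_R2. \<exists>l\<in>L_sub. near R g l"
    unfolding sim_iff[OF subs_carrier(4) order_refl] by blast
  \<comment> \<open>Large enough that \<open>f\<close>, which the second coordinate forces to be at least \<open>k (k - 2 R) / R\<close>, exceeds its linear bound in \<open>k\<close>.\<close>
  define k where "k = 5 * (R * (R * R)) + 2 * R + 1"
  show False
  proof (cases "1 \<le> k")
    case True
    let ?g = "elt k 0 0 (1 / k) 0 k"
    have "?g \<in> carrier SL2_R2" using True by simp
    then obtain l where "l \<in> L_sub" and near: "near R ?g l" using R by blast
    then obtain b f where l: "l = elt 1 0 b 1 0 f" by (auto simp: L_sub_elt)
    obtain \<alpha> \<beta> \<gamma> \<delta> u v p q r s x y where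
      e: "?g ** elt p q r s x y = elt \<alpha> \<beta> \<gamma> \<delta> u v ** l"
      and d1: "\<alpha> * \<delta> - \<beta> * \<gamma> = 1" "p * s - q * r = 1" and R: "1 \<le> R"
      "\<bar>\<alpha>\<bar> \<le> R" "\<bar>\<beta>\<bar> \<le> R" "\<bar>\<gamma>\<bar> \<le> R" "\<bar>\<delta>\<bar> \<le> R" "\<bar>u\<bar> \<le> R" "\<bar>v\<bar> \<le> R"
      "\<bar>p\<bar> \<le> R" "\<bar>q\<bar> \<le> R" "\<bar>r\<bar> \<le> R" "\<bar>s\<bar> \<le> R" "\<bar>x\<bar> \<le> R" "\<bar>y\<bar> \<le> R"
      by (rule nearE[OF near]) (rule that)
    have e: "s / k = \<delta>" "k * x = \<beta> * f + u" "y / k + k = \<delta> * f + v"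
      using e by (simp_all add: l elt_mult)
    have R3: "1 \<le> R * R" "R * R \<le> R * (R * R)" "0 \<le> R * (R * R)"
      using R(1) by (simp_all add: mult_ge1_I)
    have \<beta>f: "\<bar>\<beta> * f\<bar> \<le> k * R + R" 
      using e(2) abs_mult_le[of k k x R] True R(6,12) by linarith
    have yk: "\<bar>y / k\<bar> \<le> R"
      using R(1,13) True mult_mono[of 1 k "\<bar>y\<bar>" R] by (simp add: abs_divide divide_le_eq mult.commute)
    have \<delta>f: "\<bar>\<delta> * f\<bar> \<le> k + 2 * R" using e(3) yk R(1,7) True by linarith
    have "f = \<alpha> * (\<delta> * f) - \<gamma> * (\<beta> * f)" using d1(1) by algebra
    moreover have "\<bar>\<alpha> * (\<delta> * f)\<bar> \<le> R * (k + 2 * R)" "\<bar>\<gamma> * (\<beta> * f)\<bar> \<le> R * (k * R + R)"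
      by (intro abs_mult_le R \<beta>f \<delta>f)+
    ultimately have f: "\<bar>f\<bar> \<le> R * (k + 2 * R) + R * (k * R + R)" by linarith
    have "s * f = k * (k + y / k - v)" using e True by (simp add: field_simps)
    moreover have "k * (k - 2 * R) \<le> k * (k + y / k - v)"
      using yk R(1,7) True by (intro mult_left_mono) linarith+
    moreover have "\<bar>s * f\<bar> \<le> R * (R * (k + 2 * R) + R * (k * R + R))"
      by (intro abs_mult_le R f)
    ultimately have "k * (k - 2 * R) \<le> R * (R * (k + 2 * R) + R * (k * R + R))" by linarith
    also have "\<dots> = k * (R * R) + 3 * (R * (R * R)) + k * (R * (R * R))"
      by (simp add: algebra_simps)
    also have "\<dots> \<le> k * (R * (R * R)) + k * (3 * (R * (R * R))) + k * (R * (R * R))"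
      using mult_left_mono[OF R3(2), of k] mult_right_mono[OF True, of "3 * (R * (R * R))"] R3(3) True
      by linarith
    also have "\<dots> = k * (5 * (R * (R * R)))" by (simp add: algebra_simps)
    finally have "k - 2 * R \<le> 5 * (R * (R * R))" using True by simp
    then show False by (simp add: k_def)
  next
    case False
    have "mat 1 \<in> carrier SL2_R2" by (simp add: mat_1_elt)
    then obtain l where "near R (mat 1) l" using R by blast
    then have "1 \<le> R" unfolding near_def by (auto elim: coord_ball_cases)
    then show False using False by (simp add: k_def)
  qed
qed

section \<open>The matrix exponential\<close>

text \<open>
  The class operation of powers on this type is not the one for the matrix product.
\<close>

definition mpow :: "real^'n^'n \<Rightarrow> nat \<Rightarrow> real^'n^'n"
  where "mpow X k = ((**) X ^^ k) (mat 1)"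

lemma mpow_0 [simp]: "mpow X 0 = mat 1"
  and mpow_Suc: "mpow X (Suc k) = X ** mpow X k"
  by (simp_all add: mpow_def)

lemma matrix_mult_scaleR:
  fixes A B :: "real^'n^'n"
  shows "(k *\<^sub>R A) ** B = k *\<^sub>R (A ** B)" "A ** (k *\<^sub>R B) = k *\<^sub>R (A ** B)"
  by (simp_all add: vec_eq_iff matrix_matrix_mult_def sum_distrib_left mult.assoc mult.left_commute)

lemma mpow_scaleR: "mpow (t *\<^sub>R X) k = t ^ k *\<^sub>R mpow X k"
  by (induction k) (simp_all add: mpow_Suc matrix_mult_scaleR)

lemma mpow_commute: "X ** mpow X k = mpow X k ** X"
  by (induction k) (simp_all add: mpow_Suc, metis matrix_mul_assoc)

lemma bounded_bilinear_matrix_mult: "bounded_bilinear ((**) :: real^'n^'n \<Rightarrow> real^'n^'n \<Rightarrow> real^'n^'n)"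
proof -
  have "bilinear ((**) :: real^'n^'n \<Rightarrow> real^'n^'n \<Rightarrow> real^'n^'n)"
    unfolding bilinear_def
    by (intro conjI allI linearI)
      (simp_all add: matrix_add_ldistrib matrix_mult_scaleR, simp_all add: vec_eq_iff
        matrix_matrix_mult_def distrib_right sum.distrib)
  then show ?thesis by (simp add: bilinear_conv_bounded_bilinear)
qed

lemma bounded_linear_sandwich: "bounded_linear (\<lambda>A. p ** A ** q)" for p q :: "real^'n^'n"
  using bounded_linear_compose[OF
      bounded_bilinear.bounded_linear_left[OF bounded_bilinear_matrix_mult, of q]
      bounded_bilinear.bounded_linear_right[OF bounded_bilinear_matrix_mult, of p]] .

lemma summable_mexp: "summable (\<lambda>k. (1 / fact k) *\<^sub>R mpow X k)" for X :: "real^'n^'n"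
proof -
  have bb: "bounded_bilinear ((**) :: real^'n^'n \<Rightarrow> real^'n^'n \<Rightarrow> real^'n^'n)"
    by (rule bounded_bilinear_matrix_mult)
  obtain K where "0 < K \<and> (\<forall>A B. norm ((A::real^'n^'n) ** (B::real^'n^'n)) \<le> norm A * norm B * K)"
    using bounded_bilinear.pos_bounded[OF bb] ..
  then have K: "0 < K" "norm (A ** B) \<le> norm A * norm B * K" for A B :: "real^'n^'n"
    by auto
  have bound: "norm (mpow X k) \<le> norm (mat 1 :: real^'n^'n) * (norm X * K) ^ k" for k
  proof (induction k)
    case (Suc k)
    have "norm (mpow X (Suc k)) \<le> norm X * K * norm (mpow X k)"
      using K(2)[of X "mpow X k"] by (simp add: mpow_Suc mult.commute mult.left_commute)
    also have "\<dots> \<le> norm X * K * (norm (mat 1 :: real^'n^'n) * (norm X * K) ^ k)"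
      using Suc K(1) by (intro mult_left_mono) auto
    finally show ?case by (simp add: mult.commute mult.left_commute)
  qed simp
  let ?g = "\<lambda>k. norm (mat 1 :: real^'n^'n) * ((norm X * K) ^ k /\<^sub>R fact k)"
  show ?thesis
  proof (rule summable_comparison_test')
    show "summable ?g"
      by (intro summable_mult summable_exp_generic)
    show "norm ((1 / fact k) *\<^sub>R mpow X k) \<le> ?g k" for k
      using mult_left_mono[OF bound[of k], of "inverse (fact k)"]
      by (simp add: divide_inverse mult.left_commute)
  qed
qed

lemma mexp_sums: "(\<lambda>k. (1 / fact k) *\<^sub>R mpow X k) sums mexp X"
  using summable_sums[OF summable_mexp[of X]] by (simp add: mexp_def mpow_def)

lemma linear_mexp_sums:
  fixes f :: "real^'n^'n \<Rightarrow> 'a::real_normed_vector"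
  assumes "bounded_linear f"
  shows "(\<lambda>k. (1 / fact k) *\<^sub>R f (mpow X k)) sums f (mexp X)"
  using bounded_linear.sums[OF assms mexp_sums[of X]]
  by (simp add: linear_simps(5)[OF assms])

lemma mexp_conj:
  fixes p q X :: "real^'n^'n"
  assumes "q ** p = mat 1" "p ** q = mat 1"
  shows "mexp (p ** X ** q) = p ** mexp X ** q"
proof -
  have pow: "mpow (p ** X ** q) k = p ** mpow X k ** q" for k
  proof (induction k)
    case (Suc k)
    have "mpow (p ** X ** q) (Suc k) = p ** X ** (q ** p) ** mpow X k ** q"
      by (simp add: mpow_Suc Suc matrix_mul_assoc)
    then show ?case using assms by (simp add: mpow_Suc matrix_mul_assoc)
  qed (use assms in simp)
  from linear_mexp_sums[OF bounded_linear_sandwich[of p q], of X] mexp_sums[of "p ** X ** q"] show ?thesis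
    by (simp add: pow sums_unique2)
qed

text \<open>
  Entries of an exponential can be read off without summing a matrix series: it is enough that the functional is
  multiplied by \<open>s\<close> at each step. Only powers of \<open>X\<close> occur, which commute with \<open>X\<close>, so the eigenvalue equation
  may be checked for multiplication from either side.
\<close>

lemma mexp_eigen_functional:
  fixes f :: "real^'n^'n \<Rightarrow> real"
  assumes f: "linear f" and eigen: "\<And>Y. X ** Y = Y ** X \<Longrightarrow> f (X ** Y) = s * f Y"
  shows "f (mexp X) = exp s * f (mat 1)"
proof -
  have pow: "f (mpow X k) = s ^ k * f (mat 1)" for k
    by (induction k) (simp_all add: mpow_Suc eigen[OF mpow_commute])
  have "(\<lambda>k. (1 / fact k) *\<^sub>R f (mpow X k)) sums f (mexp X)"
    using f by (intro linear_mexp_sums) (simp add: linear_conv_bounded_linear)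
  moreover have "(\<lambda>k. s ^ k /\<^sub>R fact k * f (mat 1)) sums (exp s * f (mat 1))"
    by (intro sums_mult2 exp_converges)
  ultimately show ?thesis
    by (simp add: pow sums_unique2 divide_inverse mult.assoc)
qed

lemma mexp_in_subspace:
  assumes W: "subspace W" and "mat 1 \<in> W" "\<And>Y. Y \<in> W \<Longrightarrow> X ** Y \<in> W"
  shows "mexp X \<in> W"
proof -
  have "mpow X k \<in> W" for k
    by (induction k) (use assms in \<open>simp_all add: mpow_Suc\<close>)
  then have "(\<Sum>k<n. (1 / fact k) *\<^sub>R mpow X k) \<in> W" for n
    using W by (intro subspace_sum subspace_scale)
  then show ?thesis
    by (rule closed_sequentially[OF closed_subspace[OF W] _ mexp_sums[of X, unfolded sums_def]])
qed

lemma mexp_nilpotent: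
  assumes "X ** X ** X = 0"
  shows "mexp X = mat 1 + X + (1 / 2) *\<^sub>R (X ** X)"
proof -
  have zero: "mpow X (k + 3) = 0" for k
  proof (induction k)
    case 0
    show ?case using assms by (simp add: mpow_Suc numeral_3_eq_3 matrix_mul_assoc)
  next
    case (Suc k)
    then show ?case using mpow_Suc[of X "k + 3"] by simp
  qed
  have "(1 / fact k) *\<^sub>R mpow X k = 0" if "k \<notin> {..<3}" for k
    using zero[of "k - 3"] that by simp
  then have "(\<lambda>k. (1 / fact k) *\<^sub>R mpow X k) sums (\<Sum>k<3. (1 / fact k) *\<^sub>R mpow X k)"
    by (intro sums_finite) auto
  then show ?thesis
    using mexp_sums[of X] sums_unique2 by (fastforce simp: eval_nat_numeral mpow_Suc)
qed

lemma mexp_zero: "mexp 0 = mat 1"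
  using mexp_nilpotent[of 0] by simp

text \<open>
  At \<open>t = 0\<close> this turns equations satisfied by a group into linear equations for its Lie algebra; for all \<open>t\<close> it
  gives conserved quantities such as the determinant.
\<close>

lemma has_derivative_mexp:
  fixes f :: "real^'n^'n \<Rightarrow> real"
  assumes f: "linear f"
  shows "((\<lambda>t. f (mexp (t *\<^sub>R X))) has_real_derivative f (X ** mexp (t *\<^sub>R X))) (at t)"
proof -
  have bl: "bounded_linear f" using f by (simp add: linear_conv_bounded_linear)
  define c where "c k = f (mpow X k) / fact k" for k
  have sums: "(\<lambda>k. c k * t ^ k) sums f (mexp (t *\<^sub>R X))" for t
    using linear_mexp_sums[OF bl, of "t *\<^sub>R X"] linear_scale[OF f]
    by (simp add: mpow_scaleR c_def mult.commute)
  have bl': "bounded_linear (\<lambda>Y. f (X ** Y))"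
    by (rule bounded_linear_compose[OF bl bounded_bilinear.bounded_linear_right[OF bounded_bilinear_matrix_mult]])
  have "diffs c k = f (X ** mpow X k) / fact k" for k
    by (simp add: diffs_def c_def mpow_Suc del: of_nat_Suc)
  then have sums': "(\<lambda>k. diffs c k * t ^ k) sums f (X ** mexp (t *\<^sub>R X))"
    using linear_mexp_sums[OF bl', of "t *\<^sub>R X"] linear_scale[OF bounded_linear.linear[OF bl']]
    by (simp add: mpow_scaleR mult.commute)
  have "((\<lambda>t. \<Sum>k. c k * t ^ k) has_real_derivative (\<Sum>k. diffs c k * t ^ k)) (at t)"
    using sums sums_summable by (intro termdiffs_strong_converges_everywhere) blast
  then show ?thesis
    unfolding sums_unique[OF sums, symmetric] sums_unique[OF sums', symmetric] .
qed

section \<open>Lie algebras of the six subgroups\<close>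

text \<open>
  The elements of the Lie algebra of the group: trace zero in the linear part, and a zero bottom row.
\<close>

definition lie_elt :: "real \<Rightarrow> real \<Rightarrow> real \<Rightarrow> real \<Rightarrow> real \<Rightarrow> real^3^3"
  where "lie_elt a b c x y = vector [vector [a, b, x], vector [c, - a, y], vector [0, 0, 0]]"

lemma lie_elt_nth [simp]:
  "lie_elt a b c x y $ 1 $ 1 = a" "lie_elt a b c x y $ 1 $ 2 = b" "lie_elt a b c x y $ 1 $ 3 = x"
  "lie_elt a b c x y $ 2 $ 1 = c" "lie_elt a b c x y $ 2 $ 2 = - a" "lie_elt a b c x y $ 2 $ 3 = y"
  "lie_elt a b c x y $ 3 $ 1 = 0" "lie_elt a b c x y $ 3 $ 2 = 0" "lie_elt a b c x y $ 3 $ 3 = 0"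
  by (simp_all add: lie_elt_def)

lemma lie_elt_eq_iff [simp]:
  "lie_elt a b c x y = lie_elt a' b' c' x' y' \<longleftrightarrow> a = a' \<and> b = b' \<and> c = c' \<and> x = x' \<and> y = y'"
  by (auto simp: vec_eq_iff forall_3)

lemma lie_elt_zero: "0 = lie_elt 0 0 0 0 0"
  and lie_elt_add: "lie_elt a b c x y + lie_elt a' b' c' x' y' = lie_elt (a + a') (b + b') (c + c') (x + x') (y + y')"
  and lie_elt_diff: "lie_elt a b c x y - lie_elt a' b' c' x' y' = lie_elt (a - a') (b - b') (c - c') (x - x') (y - y')"
  and lie_elt_scaleR: "t *\<^sub>R lie_elt a b c x y = lie_elt (t * a) (t * b) (t * c) (t * x) (t * y)"
  by (simp_all add: vec_eq_iff forall_3)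

lemma lie_elt_bracket:
  "lie_elt a b c x y ** lie_elt a' b' c' x' y' - lie_elt a' b' c' x' y' ** lie_elt a b c x y =
     lie_elt (b * c' - c * b') (2 * (a * b' - b * a')) (2 * (c * a' - a * c'))
         (a * x' + b * y' - a' * x - b' * y) (c * x' - a * y' - c' * x + a' * y)"
  by (simp add: vec_eq_iff forall_3 matrix_matrix_mult_def sum_3 algebra_simps)

lemma mat_1_nth:
  "(mat 1 :: real^3^3)$1$1 = 1" "(mat 1 :: real^3^3)$1$2 = 0" "(mat 1 :: real^3^3)$1$3 = 0"
  "(mat 1 :: real^3^3)$2$1 = 0" "(mat 1 :: real^3^3)$2$2 = 1" "(mat 1 :: real^3^3)$2$3 = 0"
  "(mat 1 :: real^3^3)$3$1 = 0" "(mat 1 :: real^3^3)$3$2 = 0" "(mat 1 :: real^3^3)$3$3 = 1"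
  by (simp_all add: mat_1_elt)

text \<open>
  The other factor is an arbitrary matrix here, because the eigenvalue equations for \<open>mexp\<close> are to be checked on all
  matrices.
\<close>

lemma lie_elt_mult_nth:
  "(lie_elt a b c x y ** Y) $ 1 $ j = a * Y$1$j + b * Y$2$j + x * Y$3$j"
  "(lie_elt a b c x y ** Y) $ 2 $ j = c * Y$1$j - a * Y$2$j + y * Y$3$j"
  "(lie_elt a b c x y ** Y) $ 3 $ j = 0"
  "(Y ** lie_elt a b c x y) $ i $ 1 = a * Y$i$1 + c * Y$i$2"
  "(Y ** lie_elt a b c x y) $ i $ 2 = b * Y$i$1 - a * Y$i$2"
  "(Y ** lie_elt a b c x y) $ i $ 3 = x * Y$i$1 + y * Y$i$2"
  by (simp_all add: matrix_matrix_mult_def sum_3 mult.commute)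

lemma linear_nth_nth: "linear (\<lambda>Y :: real^3^3. Y$i$j)"
  by (intro linearI) simp_all

lemma linear_diff_nth: "linear (\<lambda>Y :: real^3^3. Y$i$j - Y$k$l)"
  by (intro linearI) (simp_all add: algebra_simps)

lemma lie_algebra_linear_zero:
  fixes f :: "real^'n^'n \<Rightarrow> real"
  assumes "X \<in> lie_algebra_of H" "linear f" "\<And>z. z \<in> H \<Longrightarrow> f z = k"
  shows "f X = 0"
proof -
  have "((\<lambda>t. f (mexp (t *\<^sub>R X))) has_real_derivative f X) (at 0)"
    using has_derivative_mexp[OF assms(2), of X 0] by (simp add: mexp_zero)
  moreover have "(\<lambda>t. f (mexp (t *\<^sub>R X))) = (\<lambda>t. k)"
    using assms by (auto simp: lie_algebra_of_def)
  ultimately show ?thesis using DERIV_unique DERIV_const by metis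
qed

lemma lie_algebra_mono: "H \<subseteq> K \<Longrightarrow> lie_algebra_of H \<subseteq> lie_algebra_of K"
  by (auto simp: lie_algebra_of_def)

lemma lie_algebra_carrier:
  assumes "H \<subseteq> carrier SL2_R2" and X: "X \<in> lie_algebra_of H"
  obtains a b c x y where "X = lie_elt a b c x y"
proof -
  have 3: "X$3$j = 0" for j
  proof (rule lie_algebra_linear_zero[OF X linear_nth_nth, where k = "(mat 1 :: real^3^3)$3$j"])
    fix z assume "z \<in> H"
    then have "z \<in> carrier SL2_R2" using assms by blast
    then obtain a b c d x y where "z = elt a b c d x y" by (rule carrier_cases)
    then show "z$3$j = (mat 1 :: real^3^3)$3$j"
      using exhaust_3[of j] by (auto simp: mat_1_elt)
  qed
  let ?e = "\<lambda>t i j. mexp (t *\<^sub>R X) $ i $ j"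
  have d: "((\<lambda>t. ?e t i j) has_real_derivative X$i$j) (at 0)" for i j
    using has_derivative_mexp[OF linear_nth_nth[of i j], of X 0] by (simp add: mexp_zero)
  have "((\<lambda>t. ?e t 1 1 * ?e t 2 2 - ?e t 1 2 * ?e t 2 1) has_real_derivative X$1$1 + X$2$2) (at 0)"
    by (auto intro!: derivative_eq_intros d simp: mexp_zero mat_1_nth)
  moreover have "?e t 1 1 * ?e t 2 2 - ?e t 1 2 * ?e t 2 1 = 1" for t
  proof -
    have "mexp (t *\<^sub>R X) \<in> carrier SL2_R2"
      using X assms(1) by (auto simp: lie_algebra_of_def)
    then show ?thesis by (auto elim: carrier_cases)
  qed
  ultimately have "((\<lambda>t. 1) has_real_derivative X$1$1 + X$2$2) (at 0)" by simp
  then have tr: "X$1$1 + X$2$2 = 0" using DERIV_unique DERIV_const by blast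
  have "X = lie_elt (X$1$1) (X$1$2) (X$2$1) (X$1$3) (X$2$3)"
    using tr by (simp add: vec_eq_iff forall_3 3)
  then show thesis by (rule that)
qed

lemma mexp_lie_elt_row3:
  "mexp (lie_elt a b c x y) $ 3 $ 1 = 0" "mexp (lie_elt a b c x y) $ 3 $ 2 = 0" "mexp (lie_elt a b c x y) $ 3 $ 3 = 1"
proof -
  have "mexp (lie_elt a b c x y) $ 3 $ j = exp 0 * (mat 1 :: real^3^3) $ 3 $ j" for j
    by (rule mexp_eigen_functional[OF linear_nth_nth], drule sym, simp add: lie_elt_mult_nth)
  then show "mexp (lie_elt a b c x y) $ 3 $ 1 = 0" "mexp (lie_elt a b c x y) $ 3 $ 2 = 0"
    "mexp (lie_elt a b c x y) $ 3 $ 3 = 1"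
    by (simp_all add: mat_1_nth)
qed

lemma mexp_lie_elt_carrier: "mexp (lie_elt a b c x y) \<in> carrier SL2_R2"
proof -
  let ?X = "lie_elt a b c x y"
  let ?e = "\<lambda>t i j. mexp (t *\<^sub>R ?X) $ i $ j"
  have d: "((\<lambda>t. ?e t i j) has_real_derivative (?X ** mexp (t *\<^sub>R ?X))$i$j) (at t)" for i j t
    by (rule has_derivative_mexp[OF linear_nth_nth])
  have z: "?e t 3 1 = 0" "?e t 3 2 = 0" for t
    using mexp_lie_elt_row3 by (simp_all add: lie_elt_scaleR)
  \<comment> \<open>The derivative of the determinant is the trace times the determinant.\<close>
  have "((\<lambda>t. ?e t 1 1 * ?e t 2 2 - ?e t 1 2 * ?e t 2 1) has_real_derivative 0) (at t)" for t
    by (rule derivative_eq_intros d refl)+ (simp add: lie_elt_mult_nth z algebra_simps)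
  then have "?e 1 1 1 * ?e 1 2 2 - ?e 1 1 2 * ?e 1 2 1 = ?e 0 1 1 * ?e 0 2 2 - ?e 0 1 2 * ?e 0 2 1"
    using DERIV_isconst_all by blast
  then have det: "mexp ?X$1$1 * mexp ?X$2$2 - mexp ?X$1$2 * mexp ?X$2$1 = 1"
    by (simp add: mexp_zero mat_1_nth)
  have "mexp ?X = elt (mexp ?X$1$1) (mexp ?X$1$2) (mexp ?X$2$1) (mexp ?X$2$2) (mexp ?X$1$3) (mexp ?X$2$3)"
    by (simp add: vec_eq_iff forall_3 mexp_lie_elt_row3)
  then show ?thesis using det by (metis elt_in_carrier)
qed

lemma mexp_linear_part:
  "mexp (lie_elt a b c 0 0) \<in> SL2_sub"
proof -
  let ?X = "lie_elt a b c 0 0"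
  have col: "mexp ?X $ i $ 3 = exp 0 * (mat 1 :: real^3^3) $ i $ 3" for i
    by (rule mexp_eigen_functional[OF linear_nth_nth]) (simp add: lie_elt_mult_nth)
  obtain a b c d x y where e: "mexp ?X = elt a b c d x y" "a * d - b * c = 1"
    using mexp_lie_elt_carrier by (rule carrier_cases)
  have "x = 0" "y = 0" using col[of 1] col[of 2] by (simp_all add: e mat_1_nth)
  then show ?thesis using e by (auto simp: SL2_sub_elt)
qed

lemma mexp_lower: "mexp (lie_elt 0 0 c x y) = elt 1 0 c 1 x (y + c * x / 2)"
proof -
  have "lie_elt 0 0 c x y ** lie_elt 0 0 c x y ** lie_elt 0 0 c x y = 0"
    by (simp add: vec_eq_iff forall_3 matrix_matrix_mult_def sum_3)
  then have "mexp (lie_elt 0 0 c x y) = mat 1 + lie_elt 0 0 c x y + (1 / 2) *\<^sub>R (lie_elt 0 0 c x y ** lie_elt 0 0 c x y)"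
    by (rule mexp_nilpotent)
  then show ?thesis
    by (simp add: vec_eq_iff forall_3 matrix_matrix_mult_def sum_3 mat_1_nth)
qed

lemma mexp_upper: "mexp (lie_elt 0 b 0 0 0) = elt 1 b 0 1 0 0"
proof -
  have "lie_elt 0 b 0 0 0 ** lie_elt 0 b 0 0 0 ** lie_elt 0 b 0 0 0 = 0"
    by (simp add: vec_eq_iff forall_3 matrix_matrix_mult_def sum_3)
  then have "mexp (lie_elt 0 b 0 0 0) = mat 1 + lie_elt 0 b 0 0 0 + (1 / 2) *\<^sub>R (lie_elt 0 b 0 0 0 ** lie_elt 0 b 0 0 0)"
    by (rule mexp_nilpotent)
  then show ?thesis
    by (simp add: vec_eq_iff forall_3 matrix_matrix_mult_def sum_3 mat_1_nth)
qed

text \<open>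
  Both basis vectors are eigenvectors of the linear part, which gives the diagonal entries. The translation
  entry \<open>e\<close> is left implicit, since \<open>S\<close> contains the result whatever \<open>e\<close> is.
\<close>

lemma mexp_diag_translation:
  obtains e where "mexp (lie_elt a 0 0 x 0) = elt (exp a) 0 0 (exp (- a)) e 0" "x = 0 \<Longrightarrow> e = 0"
proof -
  let ?X = "lie_elt a 0 0 x 0"
  have "mexp ?X $ 1 $ 1 = exp a * (mat 1 :: real^3^3)$1$1"
    by (rule mexp_eigen_functional[OF linear_nth_nth]) (simp add: lie_elt_mult_nth)
  moreover have "mexp ?X $ 2 $ 2 = exp (- a) * (mat 1 :: real^3^3)$2$2"
    by (rule mexp_eigen_functional[OF linear_nth_nth]) (simp add: lie_elt_mult_nth)
  moreover have "mexp ?X $ 1 $ 2 = exp (- a) * (mat 1 :: real^3^3)$1$2"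
    by (rule mexp_eigen_functional[OF linear_nth_nth]) (simp add: lie_elt_mult_nth)
  moreover have "mexp ?X $ 2 $ 1 = exp a * (mat 1 :: real^3^3)$2$1"
    by (rule mexp_eigen_functional[OF linear_nth_nth]) (simp add: lie_elt_mult_nth)
  moreover have "mexp ?X $ 2 $ 3 = exp (- a) * (mat 1 :: real^3^3)$2$3"
    by (rule mexp_eigen_functional[OF linear_nth_nth], drule sym, simp add: lie_elt_mult_nth)
  ultimately have 1: "mexp ?X = elt (exp a) 0 0 (exp (- a)) (mexp ?X $ 1 $ 3) 0"
    by (simp add: vec_eq_iff forall_3 mexp_lie_elt_row3 mat_1_nth)
  have "mexp ?X $ 1 $ 3 = 0" if "x = 0"
    using mexp_linear_part[of a 0 0] that by (auto simp: SL2_sub_elt)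
  then show thesis using that 1 by blast
qed

lemma mexp_diag: "mexp (lie_elt a 0 0 0 0) = elt (exp a) 0 0 (exp (- a)) 0 0"
  using mexp_diag_translation[of a 0] by metis

lemma lie_SL2: "lie_algebra_of SL2_sub = {lie_elt a b c 0 0 |a b c. True}"
proof (intro equalityI subsetI)
  fix X assume X: "X \<in> lie_algebra_of SL2_sub"
  then obtain a b c x y where e: "X = lie_elt a b c x y" using subs_carrier(1) lie_algebra_carrier by blast
  have "X$1$3 = 0" "X$2$3 = 0"
    by (rule lie_algebra_linear_zero[OF X linear_nth_nth]; auto simp: SL2_sub_elt)+
  then show "X \<in> {lie_elt a b c 0 0 |a b c. True}" by (simp add: e)
next
  fix X assume "X \<in> {lie_elt a b c 0 0 |a b c. True}"
  then show "X \<in> lie_algebra_of SL2_sub"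
    by (auto simp: lie_algebra_of_def lie_elt_scaleR intro: mexp_linear_part)
qed

lemma lie_R2: "lie_algebra_of R2_sub = {lie_elt 0 0 0 x y |x y. True}"
proof (intro equalityI subsetI)
  fix X assume X: "X \<in> lie_algebra_of R2_sub"
  then obtain a b c x y where e: "X = lie_elt a b c x y" using subs_carrier(2) lie_algebra_carrier by blast
  have "X$1$1 = 0" "X$1$2 = 0" "X$2$1 = 0"
    by (rule lie_algebra_linear_zero[OF X linear_nth_nth]; auto simp: R2_sub_elt)+
  then show "X \<in> {lie_elt 0 0 0 x y |x y. True}" by (simp add: e)
next
  fix X assume "X \<in> {lie_elt 0 0 0 x y |x y. True}"
  then show "X \<in> lie_algebra_of R2_sub"
    by (auto simp: lie_algebra_of_def lie_elt_scaleR mexp_lower R2_sub_elt)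
qed

lemma lie_S: "lie_algebra_of S_sub = {lie_elt a 0 0 x 0 |a x. True}"
proof (intro equalityI subsetI)
  fix X assume X: "X \<in> lie_algebra_of S_sub"
  then obtain a b c x y where e: "X = lie_elt a b c x y" using subs_carrier(3) lie_algebra_carrier by blast
  have "X$1$2 = 0" "X$2$1 = 0" "X$2$3 = 0"
    by (rule lie_algebra_linear_zero[OF X linear_nth_nth]; auto simp: S_sub_elt)+
  then show "X \<in> {lie_elt a 0 0 x 0 |a x. True}" by (simp add: e)
next
  fix X assume "X \<in> {lie_elt a 0 0 x 0 |a x. True}"
  then obtain a x where X: "X = lie_elt a 0 0 x 0" by blast
  have "mexp (lie_elt a 0 0 x 0) \<in> S_sub" for a x
    using mexp_diag_translation[of a x] unfolding S_sub_elt by blast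
  then show "X \<in> lie_algebra_of S_sub"
    by (auto simp: X lie_algebra_of_def lie_elt_scaleR)
qed

lemma lie_L: "lie_algebra_of L_sub = {lie_elt 0 0 c 0 y |c y. True}"
proof (intro equalityI subsetI)
  fix X assume X: "X \<in> lie_algebra_of L_sub"
  then obtain a b c x y where e: "X = lie_elt a b c x y" using subs_carrier(4) lie_algebra_carrier by blast
  have "X$1$1 = 0" "X$1$2 = 0" "X$1$3 = 0"
    by (rule lie_algebra_linear_zero[OF X linear_nth_nth]; auto simp: L_sub_elt)+
  then show "X \<in> {lie_elt 0 0 c 0 y |c y. True}" by (simp add: e)
next
  fix X assume "X \<in> {lie_elt 0 0 c 0 y |c y. True}"
  then show "X \<in> lie_algebra_of L_sub"
    by (auto simp: lie_algebra_of_def lie_elt_scaleR mexp_lower L_sub_elt)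
qed

lemma lie_M: "lie_algebra_of M_sub = {lie_elt 0 0 c c y |c y. True}"
proof (intro equalityI subsetI)
  fix X assume X: "X \<in> lie_algebra_of M_sub"
  then obtain a b c x y where e: "X = lie_elt a b c x y" using subs_carrier(5) lie_algebra_carrier by blast
  have "X$1$1 = 0" "X$1$2 = 0"
    by (rule lie_algebra_linear_zero[OF X linear_nth_nth]; auto simp: M_sub_elt)+
  moreover have "X$1$3 - X$2$1 = 0"
    by (rule lie_algebra_linear_zero[OF X linear_diff_nth]) (auto simp: M_sub_elt)
  ultimately show "X \<in> {lie_elt 0 0 c c y |c y. True}" by (simp add: e)
next
  fix X assume "X \<in> {lie_elt 0 0 c c y |c y. True}"
  then show "X \<in> lie_algebra_of M_sub"
    by (auto simp: lie_algebra_of_def lie_elt_scaleR mexp_lower M_sub_elt)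
qed

lemma lie_N: "lie_algebra_of N_sub = {lie_elt 0 0 c c 0 |c. True}"
proof (intro equalityI subsetI)
  fix X assume X: "X \<in> lie_algebra_of N_sub"
  then obtain c y where e: "X = lie_elt 0 0 c c y"
    using lie_algebra_mono[OF N_subset_M] lie_M by auto
  have "mexp (1 *\<^sub>R X) \<in> N_sub" using X unfolding lie_algebra_of_def by blast
  then show "X \<in> {lie_elt 0 0 c c 0 |c. True}"
    by (auto simp: e mexp_lower N_sub_elt power2_eq_square)
next
  fix X assume "X \<in> {lie_elt 0 0 c c 0 |c. True}"
  then show "X \<in> lie_algebra_of N_sub"
    by (auto simp: lie_algebra_of_def lie_elt_scaleR mexp_lower N_sub_elt power2_eq_square)
qed

lemma subgroup_SL2_R2I:
  assumes "K \<subseteq> carrier SL2_R2" "mat 1 \<in> K" "\<And>z w. z \<in> K \<Longrightarrow> w \<in> K \<Longrightarrow> z ** w \<in> K"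
    "\<And>z. z \<in> K \<Longrightarrow> inv\<^bsub>SL2_R2\<^esub> z \<in> K"
  shows "subgroup K SL2_R2"
  using assms by unfold_locales (simp_all add: mult_SL2_R2 one_SL2_R2)

lemma subgroups:
  "subgroup SL2_sub SL2_R2" "subgroup R2_sub SL2_R2" "subgroup S_sub SL2_R2"
  "subgroup L_sub SL2_R2" "subgroup M_sub SL2_R2" "subgroup N_sub SL2_R2"
proof -
  have 1: "mat 1 \<in> SL2_sub" "mat 1 \<in> R2_sub" "mat 1 \<in> S_sub" "mat 1 \<in> L_sub" "mat 1 \<in> M_sub" "mat 1 \<in> N_sub"
    by (auto simp: mat_1_elt subs_elt intro: exI[of _ 0])
  have "(a * a' + b * c') * (c * b' + d * d') - (a * b' + b * d') * (c * a' + d * c') = 1"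
    if "a * d - b * c = 1" "a' * d' - b' * c' = 1" for a b c d a' b' c' d' :: real
    using that by algebra
  then have "z ** w \<in> SL2_sub" if "z \<in> SL2_sub" "w \<in> SL2_sub" for z w
    using that by (auto simp: SL2_sub_elt elt_mult)
  moreover have "inv\<^bsub>SL2_R2\<^esub> z \<in> SL2_sub" if "z \<in> SL2_sub" for z
    using that by (auto simp: SL2_sub_elt inv_elt algebra_simps)
  ultimately show "subgroup SL2_sub SL2_R2"
    using 1 subs_carrier by (intro subgroup_SL2_R2I) auto
  show "subgroup R2_sub SL2_R2"
    using 1 subs_carrier by (intro subgroup_SL2_R2I) (auto simp: R2_sub_elt elt_mult inv_elt)
  have "elt (exp a) 0 0 (exp (- a)) e 0 ** elt (exp b) 0 0 (exp (- b)) f 0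
      = elt (exp (a + b)) 0 0 (exp (- (a + b))) (exp a * f + e) 0" for a b e f
    by (simp add: elt_mult mult_exp_exp)
  moreover have "inv\<^bsub>SL2_R2\<^esub> (elt (exp a) 0 0 (exp (- a)) e 0)
      = elt (exp (- a)) 0 0 (exp (- (- a))) (- exp (- a) * e) 0" for a e
    by (simp add: inv_elt flip: exp_add)
  ultimately show "subgroup S_sub SL2_R2"
    using 1 subs_carrier unfolding S_sub_elt by (intro subgroup_SL2_R2I) (fast, fast, fastforce, fastforce)
  show "subgroup L_sub SL2_R2"
    using 1 subs_carrier by (intro subgroup_SL2_R2I) (auto simp: L_sub_elt elt_mult inv_elt)
  show "subgroup M_sub SL2_R2"
    using 1 subs_carrier by (intro subgroup_SL2_R2I) (auto simp: M_sub_elt elt_mult inv_elt)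
  show "subgroup N_sub SL2_R2"
    using 1 subs_carrier
    by (intro subgroup_SL2_R2I) (auto simp: N_sub_elt elt_mult inv_elt power2_eq_square field_simps)
qed

lemma subspace_lelI:
  assumes "0 \<in> V" "\<And>X Y. X \<in> V \<Longrightarrow> Y \<in> V \<Longrightarrow> X + Y \<in> V" "\<And>t X. X \<in> V \<Longrightarrow> t *\<^sub>R X \<in> V"
  shows "subspace V"
  using assms by (simp add: subspace_def)

text \<open>
  Apart from \<open>SL\<^sub>2\<close> and \<open>S\<close>, every element is a single exponential. In \<open>S\<close> a translation and a diagonal matrix are
  multiplied. A matrix of \<open>SL\<^sub>2\<close> with \<open>c \<noteq> 0\<close> is upper times lower times upper unipotent, and \<open>c \<noteq> 0\<close> can be
  arranged by one more lower unipotent factor.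
\<close>

lemma connected_subs:
  assumes "K \<in> {R2_sub, SL2_sub, S_sub, L_sub, M_sub, N_sub}"
  shows "connected_lie_subgroup K SL2_R2"
proof -
  have sub: "subgroup K SL2_R2" using assms subgroups by blast
  have space: "subspace (lie_algebra_of K)"
    using assms by (elim insertE emptyE; simp only: lie_SL2 lie_R2 lie_S lie_L lie_M lie_N;
        intro subspace_lelI; auto simp: lie_elt_add lie_elt_scaleR lie_elt_zero)
  have bracket: "X ** Y - Y ** X \<in> lie_algebra_of K"
    if "X \<in> lie_algebra_of K" "Y \<in> lie_algebra_of K" for X Y
    using assms that by (elim insertE emptyE; auto simp: lie_SL2 lie_R2 lie_S lie_L lie_M lie_N lie_elt_bracket)
  have "\<exists>Xs. set Xs \<subseteq> lie_algebra_of K \<and> A = foldr (**) (map mexp Xs) (mat 1)" if A: "A \<in> K" for A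
    using assms
  proof (elim insertE emptyE)
    assume K: "K = R2_sub"
    with A obtain x y where "A = elt 1 0 0 1 x y" by (auto simp: R2_sub_elt)
    then show ?thesis using K by (intro exI[of _ "[lie_elt 0 0 0 x y]"]) (auto simp: mexp_lower lie_R2)
  next
    assume K: "K = L_sub"
    with A obtain b f where "A = elt 1 0 b 1 0 f" by (auto simp: L_sub_elt)
    then show ?thesis using K by (intro exI[of _ "[lie_elt 0 0 b 0 f]"]) (auto simp: mexp_lower lie_L)
  next
    assume K: "K = M_sub"
    with A obtain b f where "A = elt 1 0 b 1 b f" by (auto simp: M_sub_elt)
    then show ?thesis using K
      by (intro exI[of _ "[lie_elt 0 0 b b (f - b * b / 2)]"]) (auto simp: mexp_lower lie_M)
  next
    assume K: "K = N_sub"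
    with A obtain b where "A = elt 1 0 b 1 b (b\<^sup>2 / 2)" by (auto simp: N_sub_elt)
    then show ?thesis using K
      by (intro exI[of _ "[lie_elt 0 0 b b 0]"]) (auto simp: mexp_lower lie_N power2_eq_square)
  next
    assume K: "K = S_sub"
    with A obtain a e where "A = elt (exp a) 0 0 (exp (- a)) e 0" by (auto simp: S_sub_elt)
    then show ?thesis using K
      by (intro exI[of _ "[lie_elt 0 0 0 e 0, lie_elt a 0 0 0 0]"])
        (auto simp: mexp_lower mexp_diag elt_mult lie_S)
  next
    assume K: "K = SL2_sub"
    have big: "elt a b c d 0 0 = foldr (**) (map mexp
        [lie_elt 0 ((a - 1) / c) 0 0 0, lie_elt 0 0 c 0 0, lie_elt 0 ((d - 1) / c) 0 0 0]) (mat 1)"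
      if "c \<noteq> 0" "a * d - b * c = 1" for a b c d
      using that by (simp add: mexp_lower mexp_upper elt_mult field_simps)
    obtain a b c d where A': "A = elt a b c d 0 0" "a * d - b * c = 1"
      using A K by (auto simp: SL2_sub_elt)
    show ?thesis
    proof (cases "c = 0")
      case False
      show ?thesis unfolding K lie_SL2 A'(1)
        by (rule exI, rule conjI[rotated], rule big[OF False A'(2)]) auto
    next
      case True
      then have "a \<noteq> 0" using A'(2) by auto
      moreover have "a * (b + d) - b * a = 1" using A'(2) True by (simp add: algebra_simps)
      ultimately have e: "elt a b a (b + d) 0 0 = foldr (**) (map mexp
          [lie_elt 0 ((a - 1) / a) 0 0 0, lie_elt 0 0 a 0 0, lie_elt 0 ((b + d - 1) / a) 0 0 0]) (mat 1)"
        by (rule big)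
      have "A = mexp (lie_elt 0 0 (- 1) 0 0) ** elt a b a (b + d) 0 0"
        by (simp add: A' True mexp_lower elt_mult)
      also have "\<dots> = foldr (**) (map mexp
          [lie_elt 0 0 (- 1) 0 0, lie_elt 0 ((a - 1) / a) 0 0 0, lie_elt 0 0 a 0 0, lie_elt 0 ((b + d - 1) / a) 0 0 0]) (mat 1)"
        by (simp add: e)
      finally have 4: "A = \<dots>" .
      show ?thesis unfolding K lie_SL2 by (rule exI, rule conjI[rotated], rule 4) auto
    qed
  qed
  then show ?thesis
    using sub space bracket unfolding connected_lie_subgroup_def by blast
qed

section \<open>Decompositions of Cartan type\<close>

text \<open>
  The decomposition \<open>SL\<^sub>2 = K A K\<close>: some rotation of the standard basis is mapped to an orthogonal pair, by the
  intermediate value theorem. With determinant \<open>1\<close> the lengths of the images are reciprocal.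
\<close>

lemma near_diag:
  assumes "z \<in> SL2_sub"
  shows "\<exists>t. near 1 z (elt (exp t) 0 0 (exp (- t)) 0 0)"
proof -
  obtain a b c d where z: "z = elt a b c d 0 0" "a * d - b * c = 1"
    using assms by (auto simp: SL2_sub_elt)
  \<comment> \<open>The inner product of the images of the orthonormal basis rotated by \<open>\<theta>\<close>; a quarter turn changes its sign.\<close>
  define f where "f \<theta> = (a * cos \<theta> + b * sin \<theta>) * (b * cos \<theta> - a * sin \<theta>)
    + (c * cos \<theta> + d * sin \<theta>) * (d * cos \<theta> - c * sin \<theta>)" for \<theta>
  have cont: "continuous_on {0..pi/2} f" unfolding f_def by (intro continuous_intros)
  have neg: "f (pi/2) = - f 0" by (simp add: f_def algebra_simps)
  have "\<exists>\<theta>. f \<theta> = 0"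
  proof (cases "f 0 \<le> 0")
    case True
    then show ?thesis using IVT'[of f 0 0 "pi/2"] cont neg by auto
  next
    case False
    then show ?thesis using IVT2'[of f "pi/2" 0 0] cont neg by auto
  qed
  then obtain \<theta> where \<theta>: "f \<theta> = 0" ..
  define u1 u2 w1 w2 where "u1 = a * cos \<theta> + b * sin \<theta>" and "u2 = c * cos \<theta> + d * sin \<theta>"
    and "w1 = b * cos \<theta> - a * sin \<theta>" and "w2 = d * cos \<theta> - c * sin \<theta>"
  have orth: "u1 * w1 + u2 * w2 = 0"
    using \<theta> by (simp add: f_def u1_def u2_def w1_def w2_def)
  have cs: "cos \<theta> * cos \<theta> + sin \<theta> * sin \<theta> = 1" by (simp flip: power2_eq_square)
  have det: "u1 * w2 - w1 * u2 = 1"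
    unfolding u1_def u2_def w1_def w2_def using cs z(2) by algebra
  define r where "r = sqrt (u1\<^sup>2 + u2\<^sup>2)"
  have "u1\<^sup>2 + u2\<^sup>2 \<noteq> 0" using det by (auto simp: sum_power2_eq_zero_iff)
  then have "0 < u1\<^sup>2 + u2\<^sup>2" by (metis less_eq_real_def sum_power2_ge_zero)
  then have r: "0 < r" "r\<^sup>2 = u1\<^sup>2 + u2\<^sup>2" by (simp_all add: r_def)
  have w: "w1 * r\<^sup>2 = - u2" "w2 * r\<^sup>2 = u1"
    unfolding r(2) using orth det by algebra+
  have "\<bar>u1\<bar> \<le> r" "\<bar>u2\<bar> \<le> r"
    unfolding r_def by (simp_all add: real_le_rsqrt)
  then have le: "\<bar>u1 / r\<bar> \<le> 1" "\<bar>u2 / r\<bar> \<le> 1" using r by simp_all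
  have "near 1 (elt a b c d 0 0) (elt (exp (ln r)) 0 0 (exp (- ln r)) 0 0)"
  proof (rule nearI)
    show "elt a b c d 0 0 ** elt (cos \<theta>) (- sin \<theta>) (sin \<theta>) (cos \<theta>) 0 0
        = elt (u1 / r) (- u2 / r) (u2 / r) (u1 / r) 0 0 ** elt (exp (ln r)) 0 0 (exp (- ln r)) 0 0"
    proof -
      have "exp (ln r) = r" "exp (- ln r) = 1 / r"
        using r(1) by (simp_all add: exp_minus divide_inverse)
      moreover have "w1 = - u2 / r * (1 / r)" "w2 = u1 / r * (1 / r)"
        using r(1) w by (simp_all add: field_simps power2_eq_square)
      ultimately have "elt (u1 / r) (- u2 / r) (u2 / r) (u1 / r) 0 0 ** elt (exp (ln r)) 0 0 (exp (- ln r)) 0 0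
          = elt u1 w1 u2 w2 0 0"
        using r(1) by (simp add: elt_mult)
      then show ?thesis
        by (simp add: elt_mult u1_def u2_def w1_def w2_def)
    qed
    show "elt (cos \<theta>) (- sin \<theta>) (sin \<theta>) (cos \<theta>) 0 0 \<in> coord_ball 1"
      by (simp add: elt_coord_ball flip: power2_eq_square)
    have "u1 / r * (u1 / r) + u2 / r * (u2 / r) = 1"
      using r(1) by (simp add: r(2)[unfolded power2_eq_square, symmetric] flip: add_divide_distrib)
    then show "elt (u1 / r) (- u2 / r) (u2 / r) (u1 / r) 0 0 \<in> coord_ball 1"
      using le by (simp add: elt_coord_ball)
  qed
  then show ?thesis unfolding z by blast
qed

text \<open>
  For \<open>r \<ge> 1\<close> the matrix \<open>diag(r, 1/r)\<close> and the shear with entry \<open>r\<close> agree up to bounded factors, so lower unipotent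
  matrices can replace diagonal ones in \<open>near_diag\<close>.
\<close>

lemma near_lower:
  assumes "z \<in> SL2_sub"
  shows "\<exists>b. near 3 z (elt 1 0 b 1 0 0)"
proof -
  obtain t where t: "near 1 z (elt (exp t) 0 0 (exp (- t)) 0 0)"
    using near_diag[OF assms] by blast
  have "\<exists>b. near 1 (elt (exp t) 0 0 (exp (- t)) 0 0) (elt 1 0 b 1 0 0)"
  proof (cases "0 \<le> t")
    case True
    have "near 1 (elt (exp t) 0 0 (exp (- t)) 0 0) (elt 1 0 (exp t) 1 0 0)"
      by (rule nearI[of _ _ _ _ _ _ "-1" "- exp (- t)" 0 "-1" 0 0 0 "-1" 1 "- exp (- t)" 0 0])
        (use True in \<open>simp_all add: elt_mult elt_coord_ball mult_exp_exp\<close>)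
    then show ?thesis ..
  next
    case False
    have "near 1 (elt (exp t) 0 0 (exp (- t)) 0 0) (elt 1 0 (exp (- t)) 1 0 0)"
      by (rule nearI[of _ _ _ _ _ _ 0 1 "-1" "- exp t" 0 0 "-1" "exp t" 0 "-1" 0 0])
        (use False in \<open>simp_all add: elt_mult elt_coord_ball mult_exp_exp\<close>)
    then show ?thesis ..
  qed
  then obtain b where b: "near 1 (elt (exp t) 0 0 (exp (- t)) 0 0) (elt 1 0 b 1 0 0)" ..
  have "near (3 * (1 * 1)) z (elt 1 0 b 1 0 0)"
    using near_trans[OF t b] assms subs_carrier(1) by (auto simp: mult_exp_exp)
  then show ?thesis by auto
qed

text \<open>
  Bounded linear factors act on translations invertibly, so a decomposition of the linear part extends to all of the group
  once all translations are available.
\<close>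

lemma near_translate:
  assumes "near R (elt a b c d 0 0) (elt a' b' c' d' 0 0)"
  shows "\<exists>x' y'. near R (elt a b c d x y) (elt a' b' c' d' x' y')"
proof -
  obtain \<alpha> \<beta> \<gamma> \<delta> u v p q r s i j where
    e: "elt a b c d 0 0 ** elt p q r s i j = elt \<alpha> \<beta> \<gamma> \<delta> u v ** elt a' b' c' d' 0 0"
    and d1: "\<alpha> * \<delta> - \<beta> * \<gamma> = 1" "p * s - q * r = 1" and R: "1 \<le> R"
    "\<bar>\<alpha>\<bar> \<le> R" "\<bar>\<beta>\<bar> \<le> R" "\<bar>\<gamma>\<bar> \<le> R" "\<bar>\<delta>\<bar> \<le> R" "\<bar>u\<bar> \<le> R" "\<bar>v\<bar> \<le> R"
    "\<bar>p\<bar> \<le> R" "\<bar>q\<bar> \<le> R" "\<bar>r\<bar> \<le> R" "\<bar>s\<bar> \<le> R" "\<bar>i\<bar> \<le> R" "\<bar>j\<bar> \<le> R"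
    by (rule nearE[OF assms]) (rule that)
  have "\<alpha> * (\<delta> * x - \<beta> * y) + \<beta> * (\<alpha> * y - \<gamma> * x) = x" "\<gamma> * (\<delta> * x - \<beta> * y) + \<delta> * (\<alpha> * y - \<gamma> * x) = y"
    using d1(1) by algebra+
  then have "elt a b c d x y ** elt p q r s 0 0
      = elt \<alpha> \<beta> \<gamma> \<delta> 0 0 ** elt a' b' c' d' (\<delta> * x - \<beta> * y) (\<alpha> * y - \<gamma> * x)"
    using e by (simp add: elt_mult)
  moreover have "\<bar>0\<bar> \<le> R" using R(1) by simp
  then have "elt p q r s 0 0 \<in> coord_ball R" "elt \<alpha> \<beta> \<gamma> \<delta> 0 0 \<in> coord_ball R"
    unfolding elt_coord_ball by (intro conjI R d1; assumption)+
  ultimately have "near R (elt a b c d x y) (elt a' b' c' d' (\<delta> * x - \<beta> * y) (\<alpha> * y - \<gamma> * x))"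
    by (rule nearI)
  then show ?thesis by blast
qed

lemma unit_vector:
  fixes x y :: real
  assumes "x \<noteq> 0 \<or> y \<noteq> 0"
  defines "r \<equiv> sqrt (x\<^sup>2 + y\<^sup>2)"
  shows "0 < r" "r * r = x * x + y * y" "x / r * (x / r) + y / r * (y / r) = 1"
    "elt (x / r) (- (y / r)) (y / r) (x / r) 0 0 \<in> coord_ball 1"
    "elt (x / r) (y / r) (- (y / r)) (x / r) 0 0 \<in> coord_ball 1"
proof -
  have "x\<^sup>2 + y\<^sup>2 \<noteq> 0" using assms(1) by (simp add: sum_power2_eq_zero_iff)
  then have "0 < x\<^sup>2 + y\<^sup>2" by (metis less_eq_real_def sum_power2_ge_zero)
  then show r: "0 < r" by (simp add: r_def)
  show r2: "r * r = x * x + y * y" by (simp add: r_def flip: power2_eq_square)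
  show 1: "x / r * (x / r) + y / r * (y / r) = 1"
    using r by (simp add: r2[symmetric] flip: add_divide_distrib)
  have "\<bar>x\<bar> \<le> r" "\<bar>y\<bar> \<le> r" unfolding r_def by (simp_all add: real_le_rsqrt)
  then have "\<bar>x / r\<bar> \<le> 1" "\<bar>y / r\<bar> \<le> 1" using r by simp_all
  then show "elt (x / r) (- (y / r)) (y / r) (x / r) 0 0 \<in> coord_ball 1"
    "elt (x / r) (y / r) (- (y / r)) (x / r) 0 0 \<in> coord_ball 1"
    using 1 by (simp_all add: elt_coord_ball)
qed

text \<open>
  Rotating on the left brings the translation to the first axis. A rotation on the right, which does not affect
  translations, then makes the linear part upper triangular with positive diagonal.
\<close>

lemma near_upper_translate:
  assumes "z \<in> carrier SL2_R2"
  shows "\<exists>t b x. near 1 z (elt (exp t) b 0 (exp (- t)) x 0)"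
proof -
  obtain a b c d x y where z: "z = elt a b c d x y" "a * d - b * c = 1"
    using assms by (rule carrier_cases)
  obtain p q r where c: "elt p (- q) q p 0 0 \<in> coord_ball 1" "p * r = x" "q * r = y"
  proof (cases "x \<noteq> 0 \<or> y \<noteq> 0")
    case True
    from unit_vector[OF this] show ?thesis
      by (intro that[of "x / sqrt (x\<^sup>2 + y\<^sup>2)" "y / sqrt (x\<^sup>2 + y\<^sup>2)" "sqrt (x\<^sup>2 + y\<^sup>2)"]) auto
  next
    case False
    then show ?thesis by (intro that[of 1 0 0]) (auto simp: elt_coord_ball)
  qed
  have pq: "p * p + q * q = 1" using c(1) by (simp add: elt_coord_ball)
  define m n where "m = p * c - q * a" and "n = p * d - q * b"
  define k where "k = sqrt (n\<^sup>2 + m\<^sup>2)"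
  have mn: "(p * a + q * c) * n - (p * b + q * d) * m = 1"
    unfolding m_def n_def using z(2) pq by algebra
  then have nz: "n \<noteq> 0 \<or> m \<noteq> 0" by auto
  note k = unit_vector[OF nz, folded k_def]
  have "near 1 (elt a b c d x y) (elt (exp (ln (1 / k))) (((p * a + q * c) * m + (p * b + q * d) * n) / k)
      0 (exp (- ln (1 / k))) r 0)"
  proof (rule nearI[OF _ k(5) c(1)])
    have "exp (ln (1 / k)) = 1 / k" "exp (- ln (1 / k)) = k"
      using k(1) by (simp_all add: exp_minus)
    moreover have "a * n - b * m = p" "c * n - d * m = q"
      unfolding m_def n_def using z(2) by algebra+
    moreover have "a * m + b * n = p * ((p * a + q * c) * m + (p * b + q * d) * n) - q * (k * k)"
      "c * m + d * n = q * ((p * a + q * c) * m + (p * b + q * d) * n) + p * (k * k)"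
      unfolding k(2) unfolding m_def n_def using pq by algebra+
    ultimately show "elt a b c d x y ** elt (n / k) (m / k) (- (m / k)) (n / k) 0 0
      = elt p (- q) q p 0 0 ** elt (exp (ln (1 / k)))
          (((p * a + q * c) * m + (p * b + q * d) * n) / k) 0 (exp (- ln (1 / k))) r 0"
      using k(1) c(2,3) by (simp add: elt_mult field_simps)
  qed
  then show ?thesis unfolding z by blast
qed

text \<open>
  Conjugation by a rotation.
\<close>

lemma near_translation_axis:
  "near 1 (elt 1 0 0 1 x y) (elt 1 0 0 1 (sqrt (x\<^sup>2 + y\<^sup>2)) 0)"
proof (cases "x \<noteq> 0 \<or> y \<noteq> 0")
  case True
  note u = unit_vector[OF True]
  show ?thesis
    by (rule nearI[OF _ u(4) u(4)]) (use u(1) in \<open>simp add: elt_mult\<close>)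
next
  case False
  then show ?thesis by (simp add: near_refl)
qed

definition SO2_R2 :: "(real^3^3) set"
  where "SO2_R2 = {elt p (- q) q p x y |p q x y. p * p + q * q = 1}"

lemma SO2_entries:
  fixes p q :: real
  assumes "p * p + q * q = 1" shows "\<bar>p\<bar> \<le> 1" "\<bar>q\<bar> \<le> 1"
proof -
  have "p\<^sup>2 \<le> 1" "q\<^sup>2 \<le> 1"
    using assms zero_le_square[of p] zero_le_square[of q] unfolding power2_eq_square by linarith+
  then show "\<bar>p\<bar> \<le> 1" "\<bar>q\<bar> \<le> 1" by (simp_all add: abs_square_le_1)
qed

lemma near_SO2_R2:
  assumes "z \<in> SO2_R2"
  shows "\<exists>w\<in>R2_sub. near 1 z w"
proof -
  obtain p q x y where z: "z = elt p (- q) q p x y" "p * p + q * q = 1"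
    using assms by (auto simp: SO2_R2_def)
  have "near 1 z (elt 1 0 0 1 x y)"
    unfolding z
    by (rule nearI[of _ _ _ _ _ _ p q "- q" p 0 0 1 0 0 1 0 0])
      (use z(2) SO2_entries[OF z(2)] in \<open>simp_all add: elt_mult elt_coord_ball algebra_simps\<close>)
  then show ?thesis by (auto simp: R2_sub_elt)
qed

lemma SO2_R2_subgroup: "subgroup SO2_R2 SL2_R2"
proof (rule subgroup_SL2_R2I)
  show "SO2_R2 \<subseteq> carrier SL2_R2" by (auto simp: SO2_R2_def)
  show "mat 1 \<in> SO2_R2" by (auto simp: SO2_R2_def mat_1_elt)
  fix z w
  assume "z \<in> SO2_R2"
  then obtain p q x y where z: "z = elt p (- q) q p x y" "p * p + q * q = 1"
    by (auto simp: SO2_R2_def)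
  show "inv\<^bsub>SL2_R2\<^esub> z \<in> SO2_R2" using z by (auto simp: SO2_R2_def inv_elt)
  assume "w \<in> SO2_R2"
  then obtain p' q' x' y' where w: "w = elt p' (- q') q' p' x' y'" "p' * p' + q' * q' = 1"
    by (auto simp: SO2_R2_def)
  have "(p * p' - q * q') * (p * p' - q * q') + (q * p' + p * q') * (q * p' + p * q') = 1"
    using z(2) w(2) by algebra
  moreover have "z ** w = elt (p * p' - q * q') (- (q * p' + p * q')) (q * p' + p * q') (p * p' - q * q')
      (p * x' - q * y' + x) (q * x' + p * y' + y)"
    unfolding z(1) w(1) by (simp add: elt_mult algebra_simps)
  ultimately show "z ** w \<in> SO2_R2"
    unfolding SO2_R2_def by blast
qed

text \<open>
  The linear part commutes with the quarter turn, so every power of it has the form \<open>(p, -q; q, p)\<close>; determinant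
  \<open>1\<close> makes the exponential a rotation.
\<close>

lemma mexp_SO2_R2: "mexp (lie_elt 0 (- c) c x y) \<in> SO2_R2"
proof -
  let ?X = "lie_elt 0 (- c) c x y"
  let ?W = "{Y :: real^3^3. Y$1$1 = Y$2$2 \<and> Y$1$2 = - Y$2$1 \<and> Y$3$1 = 0 \<and> Y$3$2 = 0}"
  have W: "mexp ?X \<in> ?W"
    by (rule mexp_in_subspace) (auto simp: subspace_def lie_elt_mult_nth mat_1_nth)
  obtain a b c d x y where "mexp ?X = elt a b c d x y" "a * d - b * c = 1"
    using mexp_lie_elt_carrier by (rule carrier_cases)
  with W show ?thesis by (auto simp: SO2_R2_def)
qed

section \<open>Groups generated by the exponentials of a Lie algebra\<close>

text \<open>
  What the classification uses about a connected subgroup \<open>H\<close> with Lie algebra \<open>V\<close>. Keeping \<open>V\<close> as a separate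
  argument avoids computing the Lie algebra of a conjugate.
\<close>

definition exp_generated :: "(real^3^3) set \<Rightarrow> (real^3^3) set \<Rightarrow> bool"
  where "exp_generated H V \<longleftrightarrow> subgroup H SL2_R2 \<and> subspace V \<and>
    (\<forall>X\<in>V. \<forall>Y\<in>V. X ** Y - Y ** X \<in> V) \<and> (\<forall>X\<in>V. mexp X \<in> H) \<and>
    (\<forall>A\<in>H. \<exists>Xs. set Xs \<subseteq> V \<and> A = foldr (**) (map mexp Xs) (mat 1))"

lemma exp_generated_of_connected:
  assumes "connected_lie_subgroup H SL2_R2"
  shows "exp_generated H (lie_algebra_of H)"
proof -
  have "mexp X \<in> H" if "X \<in> lie_algebra_of H" for X
    using that unfolding lie_algebra_of_def by (auto dest: spec[of _ 1])
  then show ?thesis using assms unfolding connected_lie_subgroup_def exp_generated_def by blast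
qed

lemma exp_groupD:
  assumes "exp_generated H V"
  shows "H \<subseteq> carrier SL2_R2" "mat 1 \<in> H" "\<And>z w. z \<in> H \<Longrightarrow> w \<in> H \<Longrightarrow> z ** w \<in> H"
    "subspace V" "\<And>X. X \<in> V \<Longrightarrow> mexp X \<in> H"
    "\<And>X Y. X \<in> V \<Longrightarrow> Y \<in> V \<Longrightarrow> X ** Y - Y ** X \<in> V"
    "\<And>z. z \<in> H \<Longrightarrow> inv\<^bsub>SL2_R2\<^esub> z \<in> H"
  using assms subgroup.subset subgroup.one_closed[of H SL2_R2] subgroup.m_closed[of H SL2_R2]
    subgroup.m_inv_closed[of H SL2_R2]
  unfolding exp_generated_def one_SL2_R2 mult_SL2_R2 by auto

lemma exp_generated_lie_elt:
  assumes "exp_generated H V" "X \<in> V"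
  obtains a b c x y where "X = lie_elt a b c x y"
proof -
  have "X \<in> lie_algebra_of H"
    using exp_groupD[OF assms(1)] assms(2) by (auto simp: lie_algebra_of_def subspace_scale)
  then show thesis using that by (rule lie_algebra_carrier[OF exp_groupD(1)[OF assms(1)]])
qed

lemma exp_generated_subset:
  assumes "exp_generated H V" "subgroup K SL2_R2" "\<And>X. X \<in> V \<Longrightarrow> mexp X \<in> K"
  shows "H \<subseteq> K"
proof
  fix A assume "A \<in> H"
  then obtain Xs where Xs: "set Xs \<subseteq> V" "A = foldr (**) (map mexp Xs) (mat 1)"
    using assms(1) unfolding exp_generated_def by blast
  have "set Xs \<subseteq> V \<Longrightarrow> foldr (**) (map mexp Xs) (mat 1) \<in> K" for Xs
    using subgroup.one_closed[OF assms(2)] subgroup.m_closed[OF assms(2)] assms(3)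
    by (induction Xs) (auto simp: one_SL2_R2 mult_SL2_R2)
  then show "A \<in> K" using Xs by blast
qed

definition conj_set :: "real^3^3 \<Rightarrow> (real^3^3) set \<Rightarrow> (real^3^3) set"
  where "conj_set p A = (\<lambda>z. p ** z ** inv\<^bsub>SL2_R2\<^esub> p) ` A"

lemma exp_generated_conj:
  assumes E: "exp_generated H V" and p: "p \<in> carrier SL2_R2"
  shows "exp_generated (conj_set p H) (conj_set p V)"
proof -
  let ?q = "inv\<^bsub>SL2_R2\<^esub> p"
  let ?c = "\<lambda>z. p ** z ** ?q"
  note H = exp_groupD[OF E]
  have pq: "p ** ?q = mat 1" "?q ** p = mat 1" using p by simp_all
  have mult: "?c z ** ?c w = ?c (z ** w)" for z w
  proof -
    have "?c z ** ?c w = p ** z ** (?q ** p) ** w ** ?q" by (simp only: matrix_mul_assoc)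
    then show ?thesis by (simp add: pq(2) matrix_mul_assoc)
  qed
  have inv: "inv\<^bsub>SL2_R2\<^esub> (?c z) = ?c (inv\<^bsub>SL2_R2\<^esub> z)" if "z \<in> H" for z
  proof -
    have "z \<in> carrier SL2_R2" using that H(1) by blast
    then show ?thesis using p by (simp add: G.inv_mult_group G.m_assoc)
  qed
  have mexp: "mexp (?c X) = ?c (mexp X)" for X
    using mexp_conj pq by blast
  have "subgroup (conj_set p H) SL2_R2"
  proof (rule subgroup_SL2_R2I)
    show "conj_set p H \<subseteq> carrier SL2_R2" using H(1) p by (auto simp: conj_set_def)
    show "mat 1 \<in> conj_set p H" unfolding conj_set_def
      by (rule image_eqI[OF _ H(2)]) (simp add: pq)
  qed (use H in \<open>auto simp: conj_set_def mult inv\<close>)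
  moreover have lin: "linear ?c"
    by (rule bounded_linear.linear[OF bounded_linear_sandwich])
  then have "subspace (conj_set p V)"
    unfolding conj_set_def using H(4) by (rule linear_subspace_image)
  moreover have "X ** Y - Y ** X \<in> conj_set p V" if XY: "X \<in> conj_set p V" "Y \<in> conj_set p V" for X Y
  proof -
    obtain X' Y' where "X' \<in> V" "X = ?c X'" "Y' \<in> V" "Y = ?c Y'"
      using XY unfolding conj_set_def by blast
    then show ?thesis
      using H(6)[of X' Y'] unfolding conj_set_def
      by (intro image_eqI[of _ _ "X' ** Y' - Y' ** X'"]) (simp_all add: mult linear_diff[OF lin])
  qed
  moreover have "mexp X \<in> conj_set p H" if "X \<in> conj_set p V" for X
    using that H(5) by (auto simp: conj_set_def mexp)
  moreover have "\<exists>Xs. set Xs \<subseteq> conj_set p V \<and> A = foldr (**) (map mexp Xs) (mat 1)"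
    if A: "A \<in> conj_set p H" for A
  proof -
    obtain A' where A': "A' \<in> H" "A = ?c A'" using A unfolding conj_set_def by blast
    then obtain Xs where Xs: "set Xs \<subseteq> V" "A' = foldr (**) (map mexp Xs) (mat 1)"
      using E unfolding exp_generated_def by blast
    have "?c (foldr (**) (map mexp Xs) (mat 1)) = foldr (**) (map mexp (map ?c Xs)) (mat 1)" for Xs
      by (induction Xs) (simp_all add: pq mexp flip: mult)
    then have "A = foldr (**) (map mexp (map ?c Xs)) (mat 1)" using A' Xs by simp
    moreover have "set (map ?c Xs) \<subseteq> conj_set p V" using Xs(1) by (auto simp: conj_set_def)
    ultimately show ?thesis by blast
  qed
  ultimately show ?thesis unfolding exp_generated_def by blast
qed

lemma sim_conj:
  assumes "H \<subseteq> carrier SL2_R2" and p: "p \<in> carrier SL2_R2"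
  shows "sim_in SL2_R2 H (conj_set p H)"
proof -
  let ?q = "inv\<^bsub>SL2_R2\<^esub> p"
  have pq: "p ** ?q = mat 1" "?q ** p = mat 1" using p by simp_all
  obtain R where R: "{p, ?q} \<subseteq> coord_ball R"
    using bounded_iff_coord_ball[of "{p, ?q}"] p by auto
  show ?thesis
  proof (rule simI)
    show "conj_set p H \<subseteq> carrier SL2_R2" using assms by (auto simp: conj_set_def)
    fix h assume h: "h \<in> H"
    have "?q ** (p ** h ** ?q) = (?q ** p) ** h ** ?q" by (simp only: matrix_mul_assoc)
    then have "h ** ?q = ?q ** (p ** h ** ?q)" by (simp add: pq(2))
    then have "near R h (p ** h ** ?q)" using R unfolding near_def by blast
    then show "\<exists>k\<in>conj_set p H. near R h k" using h unfolding conj_set_def by blast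
  next
    fix k assume "k \<in> conj_set p H"
    then obtain h where h: "h \<in> H" "k = p ** h ** ?q" by (auto simp: conj_set_def)
    have "k ** p = p ** h ** (?q ** p)" unfolding h(2) by (simp only: matrix_mul_assoc)
    then have "k ** p = p ** h" by (simp add: pq(2))
    then have "near R k h" using R unfolding near_def by blast
    then show "\<exists>h\<in>H. near R k h" using h by blast
  qed (use assms in auto)
qed

definition classified :: "(real^3^3) set \<Rightarrow> bool"
  where "classified H \<longleftrightarrow>
    (\<exists>K\<in>{{mat 1}, carrier SL2_R2, R2_sub, SL2_sub, S_sub, L_sub, M_sub, N_sub}. sim_in SL2_R2 H K)"

lemma mat_1_carrier: "mat 1 \<in> carrier SL2_R2"
  by (simp add: mat_1_elt)

lemma classified_conj_set:
  assumes E: "exp_generated H V" and p: "p \<in> carrier SL2_R2" and "classified (conj_set p H)"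
  shows "classified H"
proof -
  obtain K where K: "K \<in> {{mat 1}, carrier SL2_R2, R2_sub, SL2_sub, S_sub, L_sub, M_sub, N_sub}"
    "sim_in SL2_R2 (conj_set p H) K" using assms(3) unfolding classified_def by blast
  have "K \<subseteq> carrier SL2_R2" using K(1) subs_carrier mat_1_carrier by blast
  moreover have "H \<subseteq> carrier SL2_R2" "conj_set p H \<subseteq> carrier SL2_R2"
    using exp_groupD(1)[OF E] exp_groupD(1)[OF exp_generated_conj[OF E p]] by blast+
  ultimately have "sim_in SL2_R2 H K"
    using sim_trans[OF sim_conj K(2)] p by blast
  then show ?thesis using K(1) unfolding classified_def by blast
qed

text \<open>
  Moving one chosen element \<open>X\<close> of \<open>V\<close> to a normal form \<open>Y\<close>. The equation \<open>Y p = p X\<close> avoids the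
  inverse of \<open>p\<close>.
\<close>

lemma classified_conj:
  assumes E: "exp_generated H V" and X: "X \<in> V" and p: "p \<in> carrier SL2_R2" and XY: "Y ** p = p ** X"
    and *: "\<And>H' V'. exp_generated H' V' \<Longrightarrow> Y \<in> V' \<Longrightarrow> classified H'"
  shows "classified H"
proof -
  have "p ** X ** inv\<^bsub>SL2_R2\<^esub> p = Y ** (p ** inv\<^bsub>SL2_R2\<^esub> p)"
    by (simp only: XY[symmetric] matrix_mul_assoc)
  then have "Y = p ** X ** inv\<^bsub>SL2_R2\<^esub> p" using p by simp
  then have "Y \<in> conj_set p V" using X by (auto simp: conj_set_def)
  then show ?thesis using * exp_generated_conj[OF E p] classified_conj_set[OF E p] by blast
qed

section \<open>Classification of connected subgroups\<close>

lemma exp_generated_add: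
  "exp_generated H V \<Longrightarrow> lie_elt a b c x y \<in> V \<Longrightarrow> lie_elt a' b' c' x' y' \<in> V \<Longrightarrow>
    lie_elt (a + a') (b + b') (c + c') (x + x') (y + y') \<in> V"
  unfolding lie_elt_add[symmetric] by (intro subspace_add exp_groupD(4))

lemma exp_generated_diff:
  "exp_generated H V \<Longrightarrow> lie_elt a b c x y \<in> V \<Longrightarrow> lie_elt a' b' c' x' y' \<in> V \<Longrightarrow>
    lie_elt (a - a') (b - b') (c - c') (x - x') (y - y') \<in> V"
  unfolding lie_elt_diff[symmetric] by (intro subspace_diff exp_groupD(4))

lemma exp_generated_scale:
  "exp_generated H V \<Longrightarrow> lie_elt a b c x y \<in> V \<Longrightarrow> lie_elt (t * a) (t * b) (t * c) (t * x) (t * y) \<in> V"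
  unfolding lie_elt_scaleR[symmetric] by (intro subspace_scale exp_groupD(4))

lemma exp_generated_bracket:
  "exp_generated H V \<Longrightarrow> lie_elt a b c x y \<in> V \<Longrightarrow> lie_elt a' b' c' x' y' \<in> V \<Longrightarrow>
    lie_elt (b * c' - c * b') (2 * (a * b' - b * a')) (2 * (c * a' - a * c'))
      (a * x' + b * y' - a' * x - b' * y) (c * x' - a * y' - c' * x + a' * y) \<in> V"
  unfolding lie_elt_bracket[symmetric] by (rule exp_groupD(6))

lemma classified_carrierI:
  assumes "exp_generated H V" "\<And>z. z \<in> carrier SL2_R2 \<Longrightarrow> \<exists>h\<in>H. near R z h"
  shows "classified H"
  using simI_subset[OF exp_groupD(1)[OF assms(1)] order_refl] assms(2)
  unfolding classified_def by blast

lemma classified_SL2I: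
  assumes "H \<subseteq> SL2_sub" "\<And>z. z \<in> SL2_sub \<Longrightarrow> \<exists>h\<in>H. near R z h"
  shows "classified H"
  using simI_subset[OF assms(1) subs_carrier(1)] assms(2) unfolding classified_def by blast

lemma classified_eqI:
  assumes "exp_generated H V" "subgroup K SL2_R2" "\<And>X. X \<in> V \<Longrightarrow> mexp X \<in> K" "K \<subseteq> H"
    "K \<in> {S_sub, L_sub, M_sub, N_sub}"
  shows "classified H"
proof -
  have "H = K" using exp_generated_subset[OF assms(1-3)] assms(4) by blast
  then show ?thesis
    using assms(5) sim_refl[OF exp_groupD(1)[OF assms(1)]] unfolding classified_def by blast
qed

lemma lie_algebra_mexp: "X \<in> lie_algebra_of K \<Longrightarrow> mexp X \<in> K"
  unfolding lie_algebra_of_def by (auto dest: spec[of _ 1])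

text \<open>
  A subspace that is stable under an operator with distinct eigenvalues is the sum of its intersections with the eigenspaces;
  here the operator is bracketing with \<open>A = diag(1, -1)\<close>, with eigenvalues \<open>0, 2, -2, 1, -1\<close>.
\<close>

lemma torus_components:
  assumes E: "exp_generated H V" and A: "lie_elt 1 0 0 0 0 \<in> V" and X: "lie_elt a b c x y \<in> V"
  shows "lie_elt 0 b 0 0 0 \<in> V" "lie_elt 0 0 c 0 0 \<in> V" "lie_elt 0 0 0 x 0 \<in> V" "lie_elt 0 0 0 0 y \<in> V"
proof -
  \<comment> \<open>Applying \<open>T\<close> twice multiplies \<open>(b, c)\<close> by 4 and fixes \<open>(x, y)\<close>, which separates the two pairs; one more application separates within each pair.\<close>
  have T: "lie_elt 0 (2 * b) (- 2 * c) x (- y) \<in> V" if "lie_elt 0 b c x y \<in> V" for b c x y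
    using exp_generated_bracket[OF E A that] by simp
  have Y: "lie_elt 0 b c x y \<in> V"
    using exp_generated_diff[OF E X exp_generated_scale[OF E A, of a]] by simp
  have "lie_elt 0 (3 * b) (3 * c) 0 0 \<in> V"
    using exp_generated_diff[OF E T[OF T[OF Y]] Y] by simp
  then have P: "lie_elt 0 b c 0 0 \<in> V"
    using exp_generated_scale[OF E, of _ _ _ _ _ "1/3"] by fastforce
  have Q: "lie_elt 0 0 0 x y \<in> V"
    using exp_generated_diff[OF E Y P] by simp
  have "lie_elt 0 (4 * b) 0 0 0 \<in> V"
    using exp_generated_add[OF E T[OF P] exp_generated_scale[OF E P, of 2]] by simp
  then show b: "lie_elt 0 b 0 0 0 \<in> V"
    using exp_generated_scale[OF E, of _ _ _ _ _ "1/4"] by fastforce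
  show "lie_elt 0 0 c 0 0 \<in> V" using exp_generated_diff[OF E P b] by simp
  have "lie_elt 0 0 0 (2 * x) 0 \<in> V"
    using exp_generated_add[OF E T[OF Q] Q] by simp
  then show x: "lie_elt 0 0 0 x 0 \<in> V"
    using exp_generated_scale[OF E, of _ _ _ _ _ "1/2"] by fastforce
  show "lie_elt 0 0 0 0 y \<in> V" using exp_generated_diff[OF E Q x] by simp
qed

text \<open>
  If all translations are in \<open>H\<close> then \<open>K H K\<close> is everything. Otherwise \<open>e\<^sub>2\<close> is missing from \<open>V\<close>, and
  with it the lower unipotent direction, whose bracket with \<open>e\<^sub>1\<close> is \<open>e\<^sub>2\<close>. What remains is \<open>S\<close> or, with
  the upper unipotent direction, a group to which \<open>near_upper_translate\<close> applies.
\<close>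

lemma classified_torus_x:
  assumes E: "exp_generated H V" and A: "lie_elt 1 0 0 0 0 \<in> V" and e1: "lie_elt 0 0 0 1 0 \<in> V"
  shows "classified H"
proof -
  note H = exp_groupD[OF E]
  have diag: "elt (exp t) 0 0 (exp (- t)) 0 0 \<in> H" for t
    using H(5)[OF exp_generated_scale[OF E A, of t]] by (simp add: mexp_diag)
  have trans_x: "elt 1 0 0 1 x 0 \<in> H" for x
    using H(5)[OF exp_generated_scale[OF E e1, of x]] by (simp add: mexp_lower)
  show ?thesis
  proof (cases "lie_elt 0 0 0 0 1 \<in> V")
    case True
    have trans_y: "elt 1 0 0 1 0 y \<in> H" for y
      using H(5)[OF exp_generated_scale[OF E True, of y]] by (simp add: mexp_lower)
    have "elt (exp t) 0 0 (exp (- t)) x y \<in> H" for t x y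
      using H(3)[OF trans_x[of x] H(3)[OF trans_y[of y] diag[of t]]] by (simp add: elt_mult)
    moreover have "\<exists>t x y. near 1 z (elt (exp t) 0 0 (exp (- t)) x y)" if zG: "z \<in> carrier SL2_R2" for z
    proof -
      obtain a b c d x y where z: "z = elt a b c d x y" "a * d - b * c = 1"
        using zG by (rule carrier_cases)
      then have "elt a b c d 0 0 \<in> SL2_sub" by (auto simp: SL2_sub_elt)
      then obtain t where "near 1 (elt a b c d 0 0) (elt (exp t) 0 0 (exp (- t)) 0 0)"
        using near_diag by blast
      from near_translate[OF this, of x y] show ?thesis unfolding z by blast
    qed
    ultimately have "\<exists>h\<in>H. near 1 z h" if "z \<in> carrier SL2_R2" for z
      using that by meson
    then show ?thesis by (rule classified_carrierI[OF E])
  next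
    case False
    have y0: "y = 0" if "lie_elt a b c x y \<in> V" for a b c x y
      using exp_generated_scale[OF E torus_components(4)[OF E A that], of "1 / y"] False
      by (cases "y = 0") auto
    have c0: "c = 0" if "lie_elt a b c x y \<in> V" for a b c x y
      using y0[OF exp_generated_bracket[OF E torus_components(2)[OF E A that] e1]] by simp
    show ?thesis
    proof (cases "lie_elt 0 1 0 0 0 \<in> V")
      case True
      have "elt 1 b 0 1 0 0 \<in> H" for b
        using H(5)[OF exp_generated_scale[OF E True, of b]] by (simp add: mexp_upper)
      then have "elt 1 0 0 1 x 0 ** (elt 1 (b * exp t) 0 1 0 0 ** elt (exp t) 0 0 (exp (- t)) 0 0) \<in> H"
        for x b t using H(3) trans_x diag by blast
      then have "elt (exp t) b 0 (exp (- t)) x 0 \<in> H" for t b x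
        by (simp add: elt_mult mult.assoc mult_exp_exp)
      then have "\<exists>h\<in>H. near 1 z h" if "z \<in> carrier SL2_R2" for z
        using near_upper_translate[OF that] by meson
      then show ?thesis by (rule classified_carrierI[OF E])
    next
      case False
      have b0: "b = 0" if "lie_elt a b c x y \<in> V" for a b c x y
        using exp_generated_scale[OF E torus_components(1)[OF E A that], of "1 / b"] False
        by (cases "b = 0") auto
      show ?thesis
      proof (rule classified_eqI[OF E subgroups(3)])
        fix X assume X: "X \<in> V"
        obtain a b c x y where e: "X = lie_elt a b c x y" using exp_generated_lie_elt[OF E X] .
        have "X \<in> lie_algebra_of S_sub"
          using b0[of a b c x y] c0[of a b c x y] y0[of a b c x y] X unfolding e lie_S by simp
        then show "mexp X \<in> S_sub" by (rule lie_algebra_mexp)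
      next
        have "elt (exp a) 0 0 (exp (- a)) e 0 \<in> H" for a e
          using H(3)[OF trans_x[of e] diag[of a]] by (simp add: elt_mult)
        then show "S_sub \<subseteq> H" by (auto simp: S_sub_elt)
      qed simp
    qed
  qed
qed

text \<open>
  Without translations in \<open>V\<close> the group lies in \<open>SL\<^sub>2\<close> and contains the diagonal matrices.
\<close>

lemma classified_torus:
  assumes E: "exp_generated H V" and A: "lie_elt 1 0 0 0 0 \<in> V"
  shows "classified H"
proof -
  consider (e1) "lie_elt 0 0 0 1 0 \<in> V" | (e2) "lie_elt 0 0 0 0 1 \<in> V"
    | (none) "lie_elt 0 0 0 1 0 \<notin> V" "lie_elt 0 0 0 0 1 \<notin> V" by blast
  then show ?thesis
  proof cases
    case e1
    then show ?thesis using classified_torus_x[OF E A] by blast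
  next
    case e2
    \<comment> \<open>The quarter turn exchanges the axes and negates \<open>diag(1, -1)\<close>.\<close>
    let ?J = "elt 0 (- 1) 1 0 0 0"
    have J: "?J \<in> carrier SL2_R2" by simp
    let ?q = "inv\<^bsub>SL2_R2\<^esub> ?J"
    have "lie_elt (- 1) 0 0 0 0 \<in> V" "lie_elt 0 0 0 0 (- 1) \<in> V"
      using exp_generated_scale[OF E A, of "- 1"] exp_generated_scale[OF E e2, of "- 1"] by simp_all
    then have "?J ** lie_elt (- 1) 0 0 0 0 ** ?q \<in> conj_set ?J V" "?J ** lie_elt 0 0 0 0 (- 1) ** ?q \<in> conj_set ?J V"
      unfolding conj_set_def by simp_all
    moreover have "?J ** lie_elt (- 1) 0 0 0 0 ** ?q = lie_elt 1 0 0 0 0" "?J ** lie_elt 0 0 0 0 (- 1) ** ?q = lie_elt 0 0 0 1 0"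
      by (simp_all add: inv_elt vec_eq_iff forall_3 matrix_matrix_mult_def sum_3)
    ultimately have "lie_elt 1 0 0 0 0 \<in> conj_set ?J V" "lie_elt 0 0 0 1 0 \<in> conj_set ?J V"
      by simp_all
    then have "classified (conj_set ?J H)" using classified_torus_x exp_generated_conj[OF E J] by blast
    then show ?thesis using classified_conj_set[OF E J] by blast
  next
    case none
    have xy0: "x = 0 \<and> y = 0" if "lie_elt a b c x y \<in> V" for a b c x y
      using exp_generated_scale[OF E torus_components(3)[OF E A that], of "1 / x"]
        exp_generated_scale[OF E torus_components(4)[OF E A that], of "1 / y"] none
      by (cases "x = 0"; cases "y = 0") auto
    have "mexp X \<in> SL2_sub" if X: "X \<in> V" for X
    proof -
      obtain a b c x y where e: "X = lie_elt a b c x y" using exp_generated_lie_elt[OF E X] .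
      then show ?thesis using xy0[of a b c x y] X mexp_linear_part by simp
    qed
    then have "H \<subseteq> SL2_sub" using exp_generated_subset[OF E subgroups(1)] by blast
    moreover have "elt (exp t) 0 0 (exp (- t)) 0 0 \<in> H" for t
      using exp_groupD(5)[OF E exp_generated_scale[OF E A, of t]] by (simp add: mexp_diag)
    ultimately have "\<exists>h\<in>H. near 1 z h" if "z \<in> SL2_sub" for z
      using near_diag[OF that] by meson
    with \<open>H \<subseteq> SL2_sub\<close> show ?thesis by (rule classified_SL2I)
  qed
qed

text \<open>
  Such a group consists of rotations combined with translations, so it lies in \<open>\<real>\<^sup>2\<close> up to the compact
  factor of rotations. Conversely it contains a line of translations, and rotating this line
  sweeps out \<open>\<real>\<^sup>2\<close>.
\<close>

lemma classified_translations:
  assumes E: "exp_generated H V" and V: "\<And>a b c x y. lie_elt a b c x y \<in> V \<Longrightarrow> a = 0 \<and> b = - c"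
    and XY: "lie_elt 0 0 0 x y \<in> V" "x \<noteq> 0 \<or> y \<noteq> 0"
  shows "classified H"
proof -
  note H = exp_groupD[OF E]
  have "mexp X \<in> SO2_R2" if X: "X \<in> V" for X
  proof -
    obtain a b c x y where "X = lie_elt a b c x y" using exp_generated_lie_elt[OF E X] .
    then show ?thesis using V[of a b c x y] X mexp_SO2_R2 by simp
  qed
  then have sub: "H \<subseteq> SO2_R2" using exp_generated_subset[OF E SO2_R2_subgroup] by blast
  have line: "elt 1 0 0 1 (t * x) (t * y) \<in> H" for t
    using H(5)[OF exp_generated_scale[OF E XY(1), of t]] by (simp add: mexp_lower)
  have "sim_in SL2_R2 H R2_sub"
  proof (rule simI[OF H(1) subs_carrier(2)])
    show "\<exists>w\<in>R2_sub. near 1 z w" if "z \<in> H" for z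
      using near_SO2_R2 sub that by blast
    fix w assume "w \<in> R2_sub"
    then obtain u v where w: "w = elt 1 0 0 1 u v" by (auto simp: R2_sub_elt)
    \<comment> \<open>The element of the line in \<open>H\<close> with the same length as \<open>w\<close>.\<close>
    define t where "t = sqrt (u\<^sup>2 + v\<^sup>2) / sqrt (x\<^sup>2 + y\<^sup>2)"
    have "t * sqrt (x\<^sup>2 + y\<^sup>2) = sqrt (u\<^sup>2 + v\<^sup>2)" "0 \<le> t"
      using unit_vector(1)[OF XY(2)] by (auto simp: t_def)
    moreover have "(t * x)\<^sup>2 + (t * y)\<^sup>2 = t\<^sup>2 * (x\<^sup>2 + y\<^sup>2)" by (simp add: power_mult_distrib distrib_left)
    ultimately have len: "sqrt ((t * x)\<^sup>2 + (t * y)\<^sup>2) = sqrt (u\<^sup>2 + v\<^sup>2)"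
      by (simp add: real_sqrt_mult)
    have "near (2 * (1 * 1)) (elt 1 0 0 1 (sqrt (u\<^sup>2 + v\<^sup>2)) 0) (elt 1 0 0 1 (t * x) (t * y))"
      using near_sym[OF near_translation_axis[of "t * x" "t * y"]] unfolding len by simp
    then have "near (3 * (1 * (2 * (1 * 1)))) w (elt 1 0 0 1 (t * x) (t * y))"
      unfolding w by (intro near_trans[OF near_translation_axis]) auto
    then show "\<exists>h\<in>H. near (3 * (1 * (2 * (1 * 1)))) w h" using line by blast
  qed
  then show ?thesis unfolding classified_def by blast
qed

lemma classified_compact:
  assumes E: "exp_generated H V"
    and V: "\<And>a b c x y. lie_elt a b c x y \<in> V \<Longrightarrow> a = 0 \<and> b = - c \<and> x = 0 \<and> y = 0"
  shows "classified H"
proof -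
  note H = exp_groupD[OF E]
  have "mexp X \<in> SO2_R2 \<and> mexp X \<in> SL2_sub" if X: "X \<in> V" for X
  proof -
    obtain a b c x y where "X = lie_elt a b c x y" using exp_generated_lie_elt[OF E X] .
    then show ?thesis using V[of a b c x y] X mexp_SO2_R2[of c 0 0] mexp_linear_part[of 0 "- c" c] by simp
  qed
  then have sub: "H \<subseteq> SO2_R2" "H \<subseteq> SL2_sub"
    using exp_generated_subset[OF E SO2_R2_subgroup] exp_generated_subset[OF E subgroups(1)] by blast+
  have one: "mat 1 \<in> coord_ball 1" by (simp add: mat_1_elt elt_coord_ball)
  have "sim_in SL2_R2 H {mat 1}"
  proof (rule simI[OF H(1)])
    show "{mat 1} \<subseteq> carrier SL2_R2" using mat_1_carrier by simp
    fix z assume z: "z \<in> H"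
    obtain p q x y where z': "z = elt p (- q) q p x y" "p * p + q * q = 1"
      using sub(1) z unfolding SO2_R2_def by blast
    have "x = 0" "y = 0" using sub(2) z unfolding z' by (auto simp: SL2_sub_elt)
    then have "z \<in> coord_ball 1" using z'(2) SO2_entries[OF z'(2)] by (simp add: z'(1) elt_coord_ball)
    then have "near 1 z (mat 1)" using one unfolding near_def by fastforce
    then show "\<exists>h\<in>{mat 1}. near 1 z h" by simp
  next
    fix z :: "real^3^3" assume "z \<in> {mat 1}"
    then show "\<exists>l\<in>H. near 1 z l" using H(2) near_refl by blast
  qed
  then show ?thesis unfolding classified_def by blast
qed

text \<open>
  The linear part has the eigenvalues \<open>\<plusminus>\<mu>\<close> with \<open>\<mu> = sqrt(a\<^sup>2 + b c)\<close>. The rows of the conjugating matrix are its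
  left eigenvectors; the translation part of that matrix removes the translation, which is possible since \<open>\<mu> \<noteq> 0\<close>.
\<close>

lemma classified_hyperbolic:
  assumes E: "exp_generated H V" and X: "lie_elt a b c x y \<in> V" and q: "0 < a\<^sup>2 + b * c"
  shows "classified H"
proof -
  define \<mu> where "\<mu> = sqrt (a\<^sup>2 + b * c)"
  have \<mu>: "0 < \<mu>" using q by (simp add: \<mu>_def)
  have "\<mu>\<^sup>2 = a\<^sup>2 + b * c" using q by (simp add: \<mu>_def)
  then have \<mu>2: "\<mu> * \<mu> = a * a + b * c" by (simp add: power2_eq_square)
  obtain p q r s where rows: "p * a + q * c = \<mu> * p" "p * b - q * a = \<mu> * q"
    "r * a + s * c = - \<mu> * r" "r * b - s * a = - \<mu> * s" "p * s - q * r = 1"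
  \<comment> \<open>Left eigenvectors are \<open>(\<mu> + a, b)\<close> and \<open>(c, - \<mu> - a)\<close>; they degenerate when \<open>a = - \<mu>\<close>, and then \<open>(c, \<mu> - a)\<close> and \<open>(a - \<mu>, b)\<close> serve. The factor \<open>k\<close> makes the determinant 1.\<close>
  proof (cases "a = - \<mu>")
    case False
    define k where "k = - 1 / (2 * \<mu> * (\<mu> + a))"
    have k: "k * (2 * \<mu> * (\<mu> + a)) = - 1" using False \<mu> by (simp add: k_def)
    show thesis
    proof (rule that)
      show "(\<mu> + a) * a + b * c = \<mu> * (\<mu> + a)"
        using \<mu>2 by algebra
      show "k * c * b - k * (- \<mu> - a) * a = - \<mu> * (k * (- \<mu> - a))"
        using \<mu>2 by algebra
      show "(\<mu> + a) * (k * (- \<mu> - a)) - b * (k * c) = 1"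
        using \<mu>2 k by algebra
    qed (simp_all add: algebra_simps)
  next
    case True
    define k where "k = 1 / (4 * \<mu> * \<mu>)"
    have k: "k * (4 * \<mu> * \<mu>) = 1" using \<mu> by (simp add: k_def)
    have bc: "b * c = 0" using \<mu>2 True by simp
    show thesis
    proof (rule that)
      show "c * a + 2 * \<mu> * c = \<mu> * c" "c * b - 2 * \<mu> * a = \<mu> * (2 * \<mu>)"
        using bc True by algebra+
      show "k * (- 2 * \<mu>) * a + k * b * c = - \<mu> * (k * (- 2 * \<mu>))"
        "k * (- 2 * \<mu>) * b - k * b * a = - \<mu> * (k * b)"
        using bc True by algebra+
      show "c * (k * b) - 2 * \<mu> * (k * (- 2 * \<mu>)) = 1"
        using bc k by algebra
    qed
  qed
  let ?p = "elt p q r s ((p * x + q * y) / \<mu>) (- (r * x + s * y) / \<mu>)"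
  have p: "?p \<in> carrier SL2_R2" using rows by simp
  show ?thesis
  proof (rule classified_conj[OF E X p, of "lie_elt \<mu> 0 0 0 0"])
    show "lie_elt \<mu> 0 0 0 0 ** ?p = ?p ** lie_elt a b c x y"
      using rows \<mu>(1) by (simp add: vec_eq_iff forall_3 matrix_matrix_mult_def sum_3 mult.commute)
    fix H' V' assume E': "exp_generated H' V'" and "lie_elt \<mu> 0 0 0 0 \<in> V'"
    then have "lie_elt 1 0 0 0 0 \<in> V'" using exp_generated_scale[OF E', of \<mu> 0 0 0 0 "1 / \<mu>"] \<mu>(1) by simp
    then show "classified H'" using classified_torus E' by blast
  qed
qed

text \<open>
  Unless a hyperbolic element is present, symmetric traceless parts must vanish, since their square is a positive multiple of
  the identity. So \<open>V\<close> consists of rotation generators and translations.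
\<close>

lemma classified_rotation:
  assumes E: "exp_generated H V" and J: "lie_elt 0 (- 1) 1 0 0 \<in> V"
  shows "classified H"
proof (cases "\<exists>a b c x y. lie_elt a b c x y \<in> V \<and> 0 < a\<^sup>2 + b * c")
  case True
  then show ?thesis using classified_hyperbolic[OF E] by blast
next
  case False
  have skew: "a = 0 \<and> b = - c" if X: "lie_elt a b c x y \<in> V" for a b c x y
  proof -
    \<comment> \<open>The element minus its skew part.\<close>
    have "lie_elt a ((b + c) / 2) ((b + c) / 2) x y \<in> V"
      using exp_generated_diff[OF E X exp_generated_scale[OF E J, of "(c - b) / 2"]] by (simp add: field_simps)
    then have "\<not> 0 < a\<^sup>2 + (b + c) / 2 * ((b + c) / 2)" using False by blast
    then have "a\<^sup>2 + ((b + c) / 2)\<^sup>2 = 0"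
      using sum_power2_ge_zero[of a "(b + c) / 2"] unfolding power2_eq_square by linarith
    then show ?thesis by (simp add: sum_power2_eq_zero_iff)
  qed
  have part: "lie_elt 0 0 0 x y \<in> V" if X: "lie_elt a b c x y \<in> V" for a b c x y
    using exp_generated_diff[OF E X exp_generated_scale[OF E J, of c]] skew[OF X] by simp
  show ?thesis
  proof (cases "\<exists>x y. lie_elt 0 0 0 x y \<in> V \<and> (x \<noteq> 0 \<or> y \<noteq> 0)")
    case True
    then obtain x y where "lie_elt 0 0 0 x y \<in> V" "x \<noteq> 0 \<or> y \<noteq> 0" by blast
    then show ?thesis using classified_translations[OF E] skew by blast
  next
    case False
    then show ?thesis using classified_compact[OF E] skew part by meson
  qed
qed

text \<open>
  The linear part squares to \<open>-\<omega>\<^sup>2\<close>, so it is conjugate to \<open>\<omega>\<close> times the quarter turn; its translation is removed by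
  conjugation as it is invertible.
\<close>

lemma classified_elliptic:
  assumes E: "exp_generated H V" and X: "lie_elt a b c x y \<in> V" and q: "a\<^sup>2 + b * c < 0"
  shows "classified H"
proof -
  have b: "b \<noteq> 0" using q by auto
  \<comment> \<open>The sign is the one for which \<open>p\<^sup>2 = - \<omega> / b\<close> is solvable, that is, for which the conjugating matrix has determinant 1 rather than \<open>-1\<close>.\<close>
  define \<omega> where "\<omega> = - sgn b * sqrt (- (a\<^sup>2 + b * c))"
  have "\<omega>\<^sup>2 = (sgn b)\<^sup>2 * - (a\<^sup>2 + b * c)"
    using q by (simp add: \<omega>_def power_mult_distrib)
  then have \<omega>2: "\<omega> * \<omega> = - (a * a + b * c)"
    using b by (simp add: power2_eq_square sgn_if)
  have \<omega>: "\<omega> \<noteq> 0" "0 < - \<omega> / b"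
    using q b by (auto simp: \<omega>_def sgn_if zero_less_divide_iff)
  define p where "p = sqrt (- \<omega> / b)"
  have "p\<^sup>2 = - \<omega> / b" using \<omega>(2) by (simp add: p_def)
  then have p: "p * p * b = - \<omega>" using b by (simp add: power2_eq_square)
  define r s where "r = - p * a / \<omega>" and "s = - p * b / \<omega>"
  have rs: "r * \<omega> = - p * a" "s * \<omega> = - p * b" using \<omega>(1) by (simp_all add: r_def s_def)
  have ps: "p * s = 1" using p \<omega>(1) by (simp add: s_def field_simps)
  have "\<omega> * (r * a + s * c) = \<omega> * (\<omega> * p)" "\<omega> * (r * b - s * a) = 0"
    using rs \<omega>2 by algebra+
  then have rX: "r * a + s * c = \<omega> * p" "r * b - s * a = 0"
    using \<omega>(1) by simp_all
  let ?p = "elt p 0 r s ((r * x + s * y) / \<omega>) (- (p * x) / \<omega>)"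
  show ?thesis
  proof (rule classified_conj[OF E X, of ?p "lie_elt 0 (- \<omega>) \<omega> 0 0"])
    show "?p \<in> carrier SL2_R2" using ps by simp
    show "lie_elt 0 (- \<omega>) \<omega> 0 0 ** ?p = ?p ** lie_elt a b c x y"
      using rs rX \<omega>(1) by (simp add: vec_eq_iff forall_3 matrix_matrix_mult_def sum_3 mult.commute)
    fix H' V' assume E': "exp_generated H' V'" and "lie_elt 0 (- \<omega>) \<omega> 0 0 \<in> V'"
    then have "lie_elt 0 (- 1) 1 0 0 \<in> V'"
      using exp_generated_scale[OF E', of 0 "- \<omega>" \<omega> 0 0 "1 / \<omega>"] \<omega>(1) by simp
    then show "classified H'" using classified_rotation E' by blast
  qed
qed

text \<open>
  Here \<open>a\<^sup>2 + b c\<close> vanishes on \<open>V\<close>, and together with the shear this forces \<open>V\<close> to be lower triangular. An additional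
  translation with non-zero first coordinate generates all translations, by bracketing with the shear. Otherwise
  \<open>V\<close> is spanned by the shear and possibly \<open>e\<^sub>2\<close>: for \<open>k = 0\<close> this gives \<open>L\<close> or a unipotent subgroup of
  \<open>SL\<^sub>2\<close>, for \<open>k = 1\<close> it gives \<open>M\<close> or \<open>N\<close>.
\<close>

lemma classified_shear:
  assumes E: "exp_generated H V" and F: "lie_elt 0 0 1 k 0 \<in> V" and k: "k = 0 \<or> k = 1"
  shows "classified H"
proof (cases "\<exists>a b c x y. lie_elt a b c x y \<in> V \<and> a\<^sup>2 + b * c \<noteq> 0")
  case True
  then show ?thesis
    using classified_hyperbolic[OF E] classified_elliptic[OF E] by (metis linorder_neqE_linordered_idom)
next
  case False
  note H = exp_groupD[OF E]
  have lower: "a = 0 \<and> b = 0" if X: "lie_elt a b c x y \<in> V" for a b c x y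
  proof -
    \<comment> \<open>The form vanishes at the element and at its sum with the shear.\<close>
    have "a\<^sup>2 + b * c = 0" "a\<^sup>2 + b * (c + 1) = 0"
      using False X exp_generated_add[OF E X F] by fastforce+
    then show ?thesis by (simp add: algebra_simps)
  qed
  have part: "lie_elt 0 0 0 (x - k * c) y \<in> V" if X: "lie_elt a b c x y \<in> V" for a b c x y
    using exp_generated_diff[OF E X exp_generated_scale[OF E F, of c]] lower[OF X] by (simp add: mult.commute)
  show ?thesis
  proof (cases "\<exists>x y. lie_elt 0 0 0 x y \<in> V \<and> x \<noteq> 0")
    case True
    then obtain x y where xy: "lie_elt 0 0 0 x y \<in> V" "x \<noteq> 0" by blast
    have y: "lie_elt 0 0 0 0 t \<in> V" for t
      using exp_generated_scale[OF E exp_generated_bracket[OF E F xy(1)], of "t / x"] xy(2) by simp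
    have x: "lie_elt 0 0 0 t 0 \<in> V" for t
      using exp_generated_scale[OF E exp_generated_diff[OF E xy(1) y[of y]], of "t / x"] xy(2) by simp
    have all: "lie_elt 0 0 c x y \<in> V" for c x y
      using exp_generated_add[OF E exp_generated_scale[OF E F, of c] exp_generated_add[OF E x[of "x - k * c"] y[of y]]]
      by (simp add: mult.commute)
    have "elt 1 0 b 1 x y \<in> H" for b x y
      using H(5)[OF all[of b x "y - b * x / 2"]] by (simp add: mexp_lower)
    moreover have "\<exists>b x y. near 3 z (elt 1 0 b 1 x y)" if zG: "z \<in> carrier SL2_R2" for z
    proof -
      obtain a b c d x y where z: "z = elt a b c d x y" "a * d - b * c = 1"
        using zG by (rule carrier_cases)
      then have "elt a b c d 0 0 \<in> SL2_sub" by (auto simp: SL2_sub_elt)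
      then obtain t where "near 3 (elt a b c d 0 0) (elt 1 0 t 1 0 0)"
        using near_lower by blast
      from near_translate[OF this, of x y] show ?thesis unfolding z by blast
    qed
    ultimately have "\<exists>h\<in>H. near 3 z h" if "z \<in> carrier SL2_R2" for z
      using that by meson
    then show ?thesis by (rule classified_carrierI[OF E])
  next
    case False
    then have form: "a = 0 \<and> b = 0 \<and> x = k * c \<and> lie_elt 0 0 0 0 y \<in> V"
      if X: "lie_elt a b c x y \<in> V" for a b c x y
      using lower[OF X] part[OF X] by auto
    show ?thesis
    proof (cases "lie_elt 0 0 0 0 1 \<in> V")
      case True
      have all: "lie_elt 0 0 c (k * c) y \<in> V" for c y
        using exp_generated_add[OF E exp_generated_scale[OF E F, of c] exp_generated_scale[OF E True, of y]]
        by (simp add: mult.commute)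
      have in_H: "elt 1 0 b 1 (k * b) y \<in> H" for b y
        using H(5)[OF all[of b "y - b * (k * b) / 2"]] by (simp add: mexp_lower)
      show ?thesis
      proof (cases "k = 0")
        case True
        show ?thesis
        proof (rule classified_eqI[OF E subgroups(4)])
          fix X assume X: "X \<in> V"
          obtain a b c x y where e: "X = lie_elt a b c x y" using exp_generated_lie_elt[OF E X] .
          have "X \<in> lie_algebra_of L_sub"
            using form X True unfolding e lie_L by fastforce
          then show "mexp X \<in> L_sub" by (rule lie_algebra_mexp)
        qed (use in_H True in \<open>auto simp: L_sub_elt\<close>)
      next
        case False
        then have k1: "k = 1" using k by blast
        show ?thesis
        proof (rule classified_eqI[OF E subgroups(5)])
          fix X assume X: "X \<in> V"
          obtain a b c x y where e: "X = lie_elt a b c x y" using exp_generated_lie_elt[OF E X] .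
          have "X \<in> lie_algebra_of M_sub"
            using form X k1 unfolding e lie_M by fastforce
          then show "mexp X \<in> M_sub" by (rule lie_algebra_mexp)
        qed (use in_H k1 in \<open>auto simp: M_sub_elt\<close>)
      qed
    next
      case False
      have y0: "y = 0" if "lie_elt a b c x y \<in> V" for a b c x y
        using exp_generated_scale[OF E, of 0 0 0 0 y "1 / y"] form[OF that] False
        by (cases "y = 0") auto
      have in_H: "elt 1 0 b 1 (k * b) (b * (k * b) / 2) \<in> H" for b
        using H(5)[OF exp_generated_scale[OF E F, of b]] by (simp add: mexp_lower mult.commute)
      show ?thesis
      proof (cases "k = 0")
        case True
        have "mexp X \<in> SL2_sub" if X: "X \<in> V" for X
        proof -
          obtain a b c x y where e: "X = lie_elt a b c x y" using exp_generated_lie_elt[OF E X] .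
          then show ?thesis using form[of a b c x y] y0[of a b c x y] X True mexp_linear_part by simp
        qed
        then have "H \<subseteq> SL2_sub" using exp_generated_subset[OF E subgroups(1)] by blast
        moreover have "elt 1 0 b 1 0 0 \<in> H" for b using in_H[of b] True by simp
        then have "\<exists>h\<in>H. near 3 z h" if "z \<in> SL2_sub" for z
          using near_lower[OF that] by meson
        ultimately show ?thesis by (rule classified_SL2I)
      next
        case False
        then have k1: "k = 1" using k by blast
        show ?thesis
        proof (rule classified_eqI[OF E subgroups(6)])
          fix X assume X: "X \<in> V"
          obtain a b c x y where e: "X = lie_elt a b c x y" using exp_generated_lie_elt[OF E X] .
          have "X \<in> lie_algebra_of N_sub"
            using form y0 X k1 unfolding e lie_N by fastforce
          then show "mexp X \<in> N_sub" by (rule lie_algebra_mexp)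
        qed (use in_H k1 in \<open>auto simp: N_sub_elt power2_eq_square\<close>)
      qed
    qed
  qed
qed

text \<open>
  The linear part is nilpotent, hence conjugate to a multiple \<open>s\<close> of the shear. A conjugation by a translation removes
  the second coordinate of the translation; its first coordinate is rescaled by \<open>diag(t, 1/t)\<close>.
\<close>

lemma classified_parabolic:
  assumes E: "exp_generated H V" and X: "lie_elt a b c x y \<in> V" and q: "a\<^sup>2 + b * c = 0"
    and nz: "b \<noteq> 0 \<or> c \<noteq> 0"
  shows "classified H"
proof -
  have q: "a * a + b * c = 0" using q by (simp add: power2_eq_square)
  obtain p q r u s where rows: "p * a + q * c = 0" "p * b - q * a = 0"
    "r * a + u * c = s * p" "r * b - u * a = s * q" "p * u - q * r = 1" "s \<noteq> 0"
  proof (cases "c = 0")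
    case False
    show thesis
      by (rule that[of c "- a" 0 "1 / c" "1 / c"]) (use False q in \<open>simp_all add: field_simps\<close>)
  next
    case True
    then show thesis
      using nz q by (intro that[of 0 1 "- 1" 0 "- b"]) simp_all
  qed
  define k where "k = (p * x + q * y) / s"
  \<comment> \<open>Conjugation by \<open>diag(t, 1/t)\<close> multiplies the ratio \<open>k\<close> by \<open>t\<^sup>3\<close>, so it can be normalised to 0 or 1 whatever its sign.\<close>
  define t where "t = (if k = 0 then 1 else root 3 (1 / k))"
  have t: "t \<noteq> 0" by (simp add: t_def)
  have tk: "t ^ 3 * k = 0 \<or> t ^ 3 * k = 1"
    by (simp add: t_def odd_real_root_pow)
  let ?p = "elt (t * p) (t * q) (r / t) (u / t) ((r * x + u * y) * t / s) 0"
  let ?Y = "lie_elt 0 0 (s / t\<^sup>2) (t * (p * x + q * y)) 0"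
  show ?thesis
  proof (rule classified_conj[OF E X, of ?p ?Y])
    show "?p \<in> carrier SL2_R2" using rows(5) t by simp
    have "s / t\<^sup>2 * (t * p) = (r * a + u * c) / t" "s / t\<^sup>2 * (t * q) = (r * b - u * a) / t"
      using t rows(3,4) by (simp_all add: power2_eq_square)
    moreover have "s / t\<^sup>2 * ((r * x + u * y) * t / s) = (r * x + u * y) / t"
      using t rows(6) by (simp add: power2_eq_square)
    moreover have "t * p * a + t * q * c = 0" "t * p * b - t * q * a = 0"
      using rows(1,2) by algebra+
    ultimately show "?Y ** ?p = ?p ** lie_elt a b c x y"
      by (simp add: vec_eq_iff forall_3 matrix_matrix_mult_def sum_3 add_divide_distrib
          diff_divide_distrib distrib_left mult.assoc)
    fix H' V' assume E': "exp_generated H' V'" and Y: "?Y \<in> V'"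
    have "t\<^sup>2 / s * (t * (p * x + q * y)) = t ^ 3 * k"
      by (simp add: k_def power2_eq_square power3_eq_cube)
    then have "lie_elt 0 0 1 (t ^ 3 * k) 0 \<in> V'"
      using exp_generated_scale[OF E' Y, of "t\<^sup>2 / s"] rows(6) t by simp
    then show "classified H'" using classified_shear E' tk by blast
  qed
qed

theorem classified_exp_generated:
  assumes E: "exp_generated H V"
  shows "classified H"
proof (cases "\<exists>a b c x y. lie_elt a b c x y \<in> V \<and> \<not> (a = 0 \<and> b = 0 \<and> c = 0)")
  case True
  then obtain a b c x y where X: "lie_elt a b c x y \<in> V" and nz: "\<not> (a = 0 \<and> b = 0 \<and> c = 0)"
    by blast
  consider "0 < a\<^sup>2 + b * c" | "a\<^sup>2 + b * c < 0" | "a\<^sup>2 + b * c = 0" by linarith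
  then show ?thesis
  proof cases
    case 1
    then show ?thesis using classified_hyperbolic[OF E X] by blast
  next
    case 2
    then show ?thesis using classified_elliptic[OF E X] by blast
  next
    case 3
    then have "b \<noteq> 0 \<or> c \<noteq> 0" using nz by auto
    then show ?thesis using classified_parabolic[OF E X 3] by blast
  qed
next
  case False
  then have V: "\<And>a b c x y. lie_elt a b c x y \<in> V \<Longrightarrow> a = 0 \<and> b = - c" by fastforce
  show ?thesis
  proof (cases "\<exists>x y. lie_elt 0 0 0 x y \<in> V \<and> (x \<noteq> 0 \<or> y \<noteq> 0)")
    case True
    then obtain x y where "lie_elt 0 0 0 x y \<in> V" "x \<noteq> 0 \<or> y \<noteq> 0" by blast
    then show ?thesis using classified_translations[OF E] V by blast
  next
    case no: False
    have "a = 0 \<and> b = - c \<and> x = 0 \<and> y = 0" if X: "lie_elt a b c x y \<in> V" for a b c x y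
      using False no X by fastforce
    then show ?thesis using classified_compact[OF E] by blast
  qed
qed

section \<open>Equivalence classes and proper pairs\<close>

abbreviation (input) six_subgroups :: "(real^3^3) set set"
  where "six_subgroups \<equiv> {R2_sub, SL2_sub, S_sub, L_sub, M_sub, N_sub}"

abbreviation (input) listed_pairs :: "((real^3^3) set \<times> (real^3^3) set) set"
  where "listed_pairs \<equiv> {(SL2_sub, R2_sub), (SL2_sub, M_sub), (SL2_sub, N_sub),
                        (R2_sub, N_sub), (S_sub, N_sub)}"

lemma six_subgroups_carrier: "K \<in> six_subgroups \<Longrightarrow> K \<subseteq> carrier SL2_R2"
  using subs_carrier by blast

lemma proper_commute:
  assumes "L \<subseteq> carrier SL2_R2" "H \<subseteq> carrier SL2_R2"
  shows "proper_pair SL2_R2 L H \<longleftrightarrow> proper_pair SL2_R2 H L"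
  using proper_sym assms by blast

lemmas proper_facts =
  proper_SL2_R2 proper_SL2_M proper_mono[OF proper_SL2_M N_subset_M subs_carrier(1,5)]
  proper_R2_N proper_S_N

lemma not_proper_self:
  assumes "K \<in> six_subgroups"
  shows "\<not> proper_pair SL2_R2 K K"
  by (rule not_proper_if_common[OF six_subgroups_carrier[OF assms] six_subgroups_carrier[OF assms]])
    (use subs_unbounded[OF assms] in simp)

lemmas not_proper_facts =
  not_proper_pairs not_proper_L_N
  not_proper_S_translation[OF subs_carrier(4) y_in(2)]
  not_proper_S_translation[OF subs_carrier(5) y_in(3)]

lemma proper_iff_list:
  assumes "K \<in> six_subgroups" "K' \<in> six_subgroups"
  shows "proper_pair SL2_R2 K K' \<longleftrightarrow> (K, K') \<in> listed_pairs \<or> (K', K) \<in> listed_pairs"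
proof
  assume P: "proper_pair SL2_R2 K K'"
  have "proper_pair SL2_R2 K' K"
    by (rule proper_sym[OF P six_subgroups_carrier[OF assms(1)] six_subgroups_carrier[OF assms(2)]])
  with P show "(K, K') \<in> listed_pairs \<or> (K', K) \<in> listed_pairs"
    using assms not_proper_self[OF assms(1)] not_proper_facts
    by (elim insertE emptyE; simp)
next
  assume "(K, K') \<in> listed_pairs \<or> (K', K) \<in> listed_pairs"
  then have "proper_pair SL2_R2 K K' \<or> proper_pair SL2_R2 K' K"
    using proper_facts by auto
  then show "proper_pair SL2_R2 K K'"
    using proper_commute[OF six_subgroups_carrier[OF assms(1)] six_subgroups_carrier[OF assms(2)]] by blast
qed

lemma proper_row_cong:
  assumes "sim_in SL2_R2 K K'" "K \<in> six_subgroups" "K' \<in> six_subgroups" "X \<in> six_subgroups"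
  shows "proper_pair SL2_R2 K X \<longleftrightarrow> proper_pair SL2_R2 K' X"
proof -
  note c = six_subgroups_carrier[OF assms(2)] six_subgroups_carrier[OF assms(3)] six_subgroups_carrier[OF assms(4)]
  show ?thesis
    using proper_sim[OF assms(1) _ c] proper_sim[OF sim_sym[OF assms(1)] _ c(2,1,3)] by blast
qed

text \<open>
  The six rows of the table of proper pairs are pairwise different.
\<close>

lemma six_subgroups_not_sim:
  assumes "K \<in> six_subgroups" "K' \<in> six_subgroups" "K \<noteq> K'"
  shows "\<not> sim_in SL2_R2 K K'"
proof
  assume "sim_in SL2_R2 K K'"
  then have row: "proper_pair SL2_R2 K R2_sub \<longleftrightarrow> proper_pair SL2_R2 K' R2_sub"
    "proper_pair SL2_R2 K SL2_sub \<longleftrightarrow> proper_pair SL2_R2 K' SL2_sub"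
    "proper_pair SL2_R2 K S_sub \<longleftrightarrow> proper_pair SL2_R2 K' S_sub"
    "proper_pair SL2_R2 K M_sub \<longleftrightarrow> proper_pair SL2_R2 K' M_sub"
    "proper_pair SL2_R2 K N_sub \<longleftrightarrow> proper_pair SL2_R2 K' N_sub"
    by (rule proper_row_cong[OF _ assms(1,2)], simp)+
  have flip: "proper_pair SL2_R2 X Y \<longleftrightarrow> proper_pair SL2_R2 Y X" if "X \<in> six_subgroups" "Y \<in> six_subgroups" for X Y
    by (rule proper_commute[OF six_subgroups_carrier[OF that(1)] six_subgroups_carrier[OF that(2)]])
  note facts = proper_facts not_proper_facts
    proper_facts[THEN proper_sym[OF _ six_subgroups_carrier six_subgroups_carrier], simplified]
    not_proper_self
  show False
    using assms(1,2) row facts flip[of M_sub S_sub] flip[of L_sub R2_sub] flip[of L_sub SL2_sub]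
      flip[of M_sub R2_sub] flip[of N_sub L_sub] flip[of N_sub M_sub] flip[of S_sub R2_sub]
      flip[of S_sub SL2_sub] flip[of L_sub S_sub] flip[of M_sub L_sub] assms(3)
    by (elim insertE emptyE; simp)
qed

text \<open>
  Nothing unbounded is proper with the whole group, so an equivalence with it would leave the row of \<open>K\<close> empty; this
  happens for \<open>L\<close> only.
\<close>

lemma six_subgroups_nontrivial:
  assumes K: "K \<in> six_subgroups"
  shows "nontrivial_in SL2_R2 K"
  unfolding nontrivial_in_def one_SL2_R2
proof
  note c = six_subgroups_carrier[OF K]
  show "\<not> sim_in SL2_R2 K {mat 1}"
  proof
    assume "sim_in SL2_R2 K {mat 1}"
    then obtain R where R: "\<And>l. l \<in> K \<Longrightarrow> near R l (mat 1)"
      using sim_iff[OF c, of "{mat 1}"] mat_1_carrier by auto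
    obtain T where "\<And>z w. near R z w \<Longrightarrow> w \<in> coord_ball 1 \<Longrightarrow> z \<in> carrier SL2_R2 \<Longrightarrow> z \<in> coord_ball T"
      using near_coord_ball by blast
    then have "K \<subseteq> coord_ball T" using R c by (force simp: mat_1_elt elt_coord_ball)
    then show False using subs_unbounded[OF K, of T] by blast
  qed
  show "\<not> sim_in SL2_R2 K (carrier SL2_R2)"
  proof
    assume sim: "sim_in SL2_R2 K (carrier SL2_R2)"
    have "\<not> proper_pair SL2_R2 K X" if X: "X \<in> six_subgroups" for X
    proof
      assume "proper_pair SL2_R2 K X"
      then have "proper_pair SL2_R2 (carrier SL2_R2) X"
        using proper_sim[OF sim_sym[OF sim] _ order_refl c six_subgroups_carrier[OF X]] by blast
      moreover have "\<not> proper_pair SL2_R2 (carrier SL2_R2) X"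
        using not_proper_if_common[OF order_refl six_subgroups_carrier[OF X]] subs_unbounded[OF X]
          six_subgroups_carrier[OF X] by blast
      ultimately show False by blast
    qed
    then have "K = L_sub"
      using K proper_iff_list[OF K, of SL2_sub] proper_iff_list[OF K, of N_sub]
      by (elim insertE emptyE; simp)
    then show False using sim L_not_sim_carrier by blast
  qed
qed

lemma nontrivial_connected_sim_six_subgroups:
  assumes "connected_lie_subgroup H SL2_R2" "nontrivial_in SL2_R2 H"
  shows "\<exists>K\<in>six_subgroups. sim_in SL2_R2 H K"
  using classified_exp_generated[OF exp_generated_of_connected[OF assms(1)]] assms(2)
  unfolding classified_def nontrivial_in_def one_SL2_R2 by blast

theorem theorem1p2:
  shows
    "(let G = SL2_R2; reps = {R2_sub, SL2_sub, S_sub, L_sub, M_sub, N_sub} in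
       (\<forall>K\<in>reps. connected_lie_subgroup K G \<and> nontrivial_in G K) \<and>
       (\<forall>H. connected_lie_subgroup H G \<and> nontrivial_in G H \<longrightarrow> (\<exists>K\<in>reps. sim_in G H K)) \<and>
       (\<forall>K\<in>reps. \<forall>K'\<in>reps. K \<noteq> K' \<longrightarrow> \<not> sim_in G K K') \<and>
       (\<forall>K\<in>reps. \<forall>K'\<in>reps.
          proper_pair G K K' \<longleftrightarrow>
            (K, K') \<in> {(SL2_sub, R2_sub), (SL2_sub, M_sub), (SL2_sub, N_sub),
                        (R2_sub, N_sub), (S_sub, N_sub)} \<or>
            (K', K) \<in> {(SL2_sub, R2_sub), (SL2_sub, M_sub), (SL2_sub, N_sub),
                        (R2_sub, N_sub), (S_sub, N_sub)}))"
  unfolding Let_def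
proof (intro conjI ballI allI impI)
  fix K assume "K \<in> six_subgroups"
  then show "connected_lie_subgroup K SL2_R2" "nontrivial_in SL2_R2 K"
    by (rule connected_subs, rule six_subgroups_nontrivial)
next
  fix H assume "connected_lie_subgroup H SL2_R2 \<and> nontrivial_in SL2_R2 H"
  then show "\<exists>K\<in>six_subgroups. sim_in SL2_R2 H K"
    using nontrivial_connected_sim_six_subgroups by blast
next
  fix K K' assume "K \<in> six_subgroups" "K' \<in> six_subgroups" "K \<noteq> K'"
  then show "\<not> sim_in SL2_R2 K K'" by (rule six_subgroups_not_sim)
next
  fix K K' assume "K \<in> six_subgroups" "K' \<in> six_subgroups"
  then show "proper_pair SL2_R2 K K' \<longleftrightarrow> (K, K') \<in> listed_pairs \<or> (K', K) \<in> listed_pairs"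
    by (rule proper_iff_list)
qed

end
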